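(* Let $\mathcal{C}=\mathcal{C}_1\uplus\mathcal{C}_2$ be a (decomposable) $d$-uniform clutter, and let $I=I(\overline{\mathcal{C}})$, $I_1=I(\overline{\mathcal{C}_1})$, $I_2=I(\overline{\mathcal{C}_2})$ be the circuit ideals of $\mathcal{C}$, $\mathcal{C}_1$, $\mathcal{C}_2$ respectively. Then: (i) $\beta_{i,j}(I)\ge \beta_{i,j}(I_1)+\beta_{i,j}(I_2)$ for $j-i>d$. (ii) If $I_1$ and $I_2$ are non-zero ideals, then $\operatorname{reg}(I)=\max\{\operatorname{reg}(I_1),\operatorname{reg}(I_2)\}$.
   Context: $K$ is a fixed field. A $d$-uniform clutter $\mathcal{C}$ on a finite vertex set $V(\mathcal{C})$ is a set of $d$-element subsets (called circuits) of $V(\mathcal{C})$. Its complement $\overline{\mathcal{C}}$ is the set of all $d$-element subsets of $V(\mathcal{C})$ not belonging to $\mathcal{C}$. The circuit ideal of $\mathcal{C}$ is the ideal $I(\overline{\mathcal{C}})$ of $K[x_v : v\in V(\mathcal{C})]$ generated by the squarefree monomials $\prod_{v\in T}x_v$, $T\in\overline{\mathcal{C}}$ (with $I(\varnothing)=0$). A submaximal circuit of $\mathcal{C}$ is a $(d-1)$-element set of vertices contained in some circuit of $\mathcal{C}$; ${\rm SC}(\mathcal{C})$ is the set of all of them. A set $V$ of vertices is a clique in $\mathcal{C}$ if all $d$-element subsets of $V$ belong to $\mathcal{C}$ (so any set with fewer than $d$ elements is a clique). A $d$-uniform clutter $\mathcal{C}$ is decomposable, and one writes $\mathcal{C}=\mathcal{C}_1\uplus\mathcal{C}_2$,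 if there are proper $d$-uniform subclutters $\mathcal{C}_1,\mathcal{C}_2\subsetneq\mathcal{C}$, with vertex sets $V(\mathcal{C}_1),V(\mathcal{C}_2)$ and $V(\mathcal{C})=V(\mathcal{C}_1)\cup V(\mathcal{C}_2)$, such that $\mathcal{C}=\mathcal{C}_1\cup\mathcal{C}_2$ and either $V(\mathcal{C}_1)\cap V(\mathcal{C}_2)$ is a clique in $\mathcal{C}$, or ${\rm SC}(\mathcal{C}_1)\cap{\rm SC}(\mathcal{C}_2)=\varnothing$. $\beta_{i,j}(M)=\dim_K\operatorname{Tor}_i(K,M)_j$ are the graded Betti numbers over the relevant polynomial ring, and $\operatorname{reg}(M)=\sup\{j-i:\beta_{i,j}(M)\ne0\}$ is the Castelnuovo–Mumford regularity of $M\neq 0$.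
   Formalization: When V(C1)∩V(C2) is a clique in C (the first alternative), C1 and C2 are taken to be the induced subclutters of C on their vertex sets; for arbitrary subclutters (i) fails, e.g. d=2, C1={13,23,24,14}, C2={12,15,25}. *)

theory Defs
  imports
    Complex_Main
    "HOL-Library.Poly_Mapping"
    "HOL-Library.Function_Algebras"
    "HOL-Library.Extended_Real"
begin

section \<open>Uniform clutters\<close>

text \<open>
  A clutter is a vertex set \<open>V\<close> together with a set \<open>C\<close> of circuits; vertices that lie in no
  circuit are allowed, and the vertex set determines the polynomial ring.
\<close>

definition uniform_clutter :: "nat \<Rightarrow> 'v set \<Rightarrow> 'v set set \<Rightarrow> bool" where
  "uniform_clutter d V C \<longleftrightarrow> finite V \<and> (\<forall>T\<in>C. T \<subseteq> V \<and> card T = d)"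

definition clutter_complement :: "nat \<Rightarrow> 'v set \<Rightarrow> 'v set set \<Rightarrow> 'v set set" where
  "clutter_complement d V C = {T. T \<subseteq> V \<and> card T = d \<and> T \<notin> C}"

definition submaximal_circuits :: "nat \<Rightarrow> 'v set set \<Rightarrow> 'v set set" where
  "submaximal_circuits d C = {e. finite e \<and> Suc (card e) = d \<and> (\<exists>T\<in>C. e \<subseteq> T)}"

definition is_clique :: "nat \<Rightarrow> 'v set set \<Rightarrow> 'v set \<Rightarrow> bool" where
  "is_clique d C W \<longleftrightarrow> (\<forall>T. T \<subseteq> W \<and> card T = d \<longrightarrow> T \<in> C)"

definition induced_subclutter :: "'v set set \<Rightarrow> 'v set \<Rightarrow> 'v set set" where
  "induced_subclutter C W = {T\<in>C. T \<subseteq> W}"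

text \<open>
  \<open>decomposition d V C V1 C1 V2 C2\<close> says that the \<open>d\<close>-uniform clutter \<open>C\<close> on \<open>V\<close> is
  \<open>C1 \<uplus> C2\<close> with \<open>C1\<close> on \<open>V1\<close> and \<open>C2\<close> on \<open>V2\<close>.

  When the two pieces are glued along a clique, ``subclutter'' means the induced subclutter on
  its vertex set; given that \<open>V1 \<inter> V2\<close> is a clique in \<open>C\<close>, this says precisely that
  \<open>V1 \<inter> V2\<close> is a clique in both pieces.  With arbitrary subsets of circuits there, the Betti
  number inequality fails: the graph on \<open>{1,...,5}\<close> with edges 12, 13, 14, 15, 23, 24, 25 is
  chordal, and it is the union of the 4-cycle 13, 23, 24, 14 and the triangle 12, 15, 25, whose
  vertex sets meet in the edge 12.  When the sets of submaximal circuits are disjoint, the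
  pieces are arbitrary proper subsets of circuits.
\<close>

definition decomposition ::
  "nat \<Rightarrow> 'v set \<Rightarrow> 'v set set \<Rightarrow> 'v set \<Rightarrow> 'v set set \<Rightarrow> 'v set \<Rightarrow> 'v set set \<Rightarrow> bool" where
  "decomposition d V C V1 C1 V2 C2 \<longleftrightarrow>
     uniform_clutter d V C \<and> uniform_clutter d V1 C1 \<and> uniform_clutter d V2 C2 \<and>
     C1 \<subset> C \<and> C2 \<subset> C \<and> V = V1 \<union> V2 \<and> C = C1 \<union> C2 \<and>
     ((is_clique d C (V1 \<inter> V2) \<and>
       C1 = induced_subclutter C V1 \<and> C2 = induced_subclutter C V2) \<or>
      submaximal_circuits d C1 \<inter> submaximal_circuits d C2 = {})"


section \<open>Polynomials in the variables indexed by a finite set\<close>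

text \<open>
  \<open>poly_ring V\<close> is the ring \<open>K[x\<^sub>v : v \<in> V]\<close>, with \<open>K\<close> the field given by the type \<open>'k\<close>.
\<close>

type_synonym ('v, 'k) mpoly = "('v \<Rightarrow>\<^sub>0 nat) \<Rightarrow>\<^sub>0 'k"

definition poly_ring :: "'v set \<Rightarrow> ('v, 'k::field) mpoly set" where
  "poly_ring V = {p. \<forall>m\<in>Poly_Mapping.keys p. Poly_Mapping.keys m \<subseteq> V}"

definition var :: "'v \<Rightarrow> ('v, 'k::field) mpoly" where
  "var v = Poly_Mapping.single (Poly_Mapping.single v 1) 1"

definition mdeg :: "('v \<Rightarrow>\<^sub>0 nat) \<Rightarrow> nat" where
  "mdeg m = (\<Sum>v\<in>Poly_Mapping.keys m. Poly_Mapping.lookup m v)"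

definition is_ideal :: "'v set \<Rightarrow> ('v, 'k::field) mpoly set \<Rightarrow> bool" where
  "is_ideal V J \<longleftrightarrow> J \<subseteq> poly_ring V \<and> 0 \<in> J \<and> (\<forall>p\<in>J. \<forall>q\<in>J. p + q \<in> J) \<and>
     (\<forall>r\<in>poly_ring V. \<forall>p\<in>J. r * p \<in> J)"

definition circuit_ideal :: "nat \<Rightarrow> 'v set \<Rightarrow> 'v set set \<Rightarrow> ('v, 'k::field) mpoly set" where
  "circuit_ideal d V C = is_ideal V hull ((\<lambda>T. \<Prod>v\<in>T. var v) ` clutter_complement d V C)"


section \<open>Graded free resolutions of the residue field\<close>

text \<open>
  For \<open>M\<close> an \<open>S\<close>-module inside the polynomials, \<open>copies n M\<close> is \<open>M\<^sup>n\<close>, which is both the free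
  module \<open>S\<^sup>n\<close> (for \<open>M = S\<close>) and the tensor product of \<open>S\<^sup>n\<close> with \<open>M\<close>.
\<close>

definition copies :: "nat \<Rightarrow> ('v, 'k::field) mpoly set \<Rightarrow> (nat \<Rightarrow> ('v, 'k) mpoly) set" where
  "copies n M = {f. (\<forall>b<n. f b \<in> M) \<and> (\<forall>b\<ge>n. f b = 0)}"

text \<open>
  A complex of finitely generated graded free modules with an augmentation to \<open>K\<close>: \<open>F\<^sub>i\<close> has basis
  elements \<open>e\<^sub>b\<close>, \<open>b < rk F i\<close>, of degree \<open>gdeg F i b\<close>; the map \<open>F\<^sub>i\<^sub>+\<^sub>1 \<rightarrow> F\<^sub>i\<close> sends \<open>e\<^sub>b\<close> to the sum of
  the \<open>mat F i b c \<cdot> e\<^sub>c\<close>; and \<open>F\<^sub>0 \<rightarrow> K\<close> sends \<open>e\<^sub>b\<close> to \<open>aug F b\<close>.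
\<close>

record (overloaded) ('v, 'k) free_complex =
  rk :: "nat \<Rightarrow> nat"
  gdeg :: "nat \<Rightarrow> nat \<Rightarrow> nat"
  mat :: "nat \<Rightarrow> nat \<Rightarrow> nat \<Rightarrow> ('v, 'k) mpoly"
  aug :: "nat \<Rightarrow> 'k"

definition diff ::
  "('v, 'k::field) free_complex \<Rightarrow> nat \<Rightarrow> (nat \<Rightarrow> ('v, 'k) mpoly) \<Rightarrow> nat \<Rightarrow> ('v, 'k) mpoly" where
  "diff F i f = (\<lambda>c. if c < rk F i then \<Sum>b<rk F (Suc i). f b * mat F i b c else 0)"

text \<open>The variables act on \<open>K\<close> as zero, so only the constant terms of the coordinates matter.\<close>

definition augment :: "('v, 'k::field) free_complex \<Rightarrow> (nat \<Rightarrow> ('v, 'k) mpoly) \<Rightarrow> 'k" where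
  "augment F f = (\<Sum>b<rk F 0. Poly_Mapping.lookup (f b) 0 * aug F b)"

definition is_graded :: "'v set \<Rightarrow> ('v, 'k::field) free_complex \<Rightarrow> bool" where
  "is_graded V F \<longleftrightarrow>
     (\<forall>i. \<forall>b<rk F (Suc i). \<forall>c<rk F i. mat F i b c \<in> poly_ring V \<and>
        (\<forall>m\<in>Poly_Mapping.keys (mat F i b c). mdeg m + gdeg F i c = gdeg F (Suc i) b)) \<and>
     (\<forall>b<rk F 0. aug F b \<noteq> 0 \<longrightarrow> gdeg F 0 b = 0)"

definition resolves_field :: "'v set \<Rightarrow> ('v, 'k::field) free_complex \<Rightarrow> bool" where
  "resolves_field V F \<longleftrightarrow> is_graded V F \<and>
     augment F ` copies (rk F 0) (poly_ring V) = UNIV \<and>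
     diff F 0 ` copies (rk F 1) (poly_ring V) =
       {f \<in> copies (rk F 0) (poly_ring V). augment F f = 0} \<and>
     (\<forall>i. diff F (Suc i) ` copies (rk F (i + 2)) (poly_ring V) =
       {f \<in> copies (rk F (i + 1)) (poly_ring V). diff F i f = 0})"


section \<open>Graded Betti numbers and regularity\<close>

text \<open>
  \<open>M\<close> is a homogeneous ideal.  The degree \<open>j\<close> part of the tensor product of \<open>F\<^sub>i\<close> with \<open>M\<close>, and
  the degree \<open>j\<close> cycles and boundaries of this complex; the homology is \<open>Tor\<^sub>i(K, M)\<^sub>j\<close> when \<open>F\<close>
  resolves \<open>K\<close>.
\<close>

definition tensor_part ::
  "('v, 'k::field) free_complex \<Rightarrow> ('v, 'k) mpoly set \<Rightarrow> nat \<Rightarrow> nat \<Rightarrow> (nat \<Rightarrow> ('v, 'k) mpoly) set" where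
  "tensor_part F M i j =
     {f \<in> copies (rk F i) M. \<forall>b<rk F i. \<forall>m\<in>Poly_Mapping.keys (f b). mdeg m + gdeg F i b = j}"

definition tor_cycles ::
  "('v, 'k::field) free_complex \<Rightarrow> ('v, 'k) mpoly set \<Rightarrow> nat \<Rightarrow> nat \<Rightarrow> (nat \<Rightarrow> ('v, 'k) mpoly) set" where
  "tor_cycles F M i j =
     {f \<in> tensor_part F M i j. case i of 0 \<Rightarrow> True | Suc l \<Rightarrow> diff F l f = 0}"

definition tor_boundaries ::
  "('v, 'k::field) free_complex \<Rightarrow> ('v, 'k) mpoly set \<Rightarrow> nat \<Rightarrow> nat \<Rightarrow> (nat \<Rightarrow> ('v, 'k) mpoly) set" where
  "tor_boundaries F M i j = diff F i ` tensor_part F M (Suc i) j"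

definition scale :: "'k::field \<Rightarrow> (nat \<Rightarrow> ('v, 'k) mpoly) \<Rightarrow> nat \<Rightarrow> ('v, 'k) mpoly" where
  "scale a f = (\<lambda>b. Poly_Mapping.single 0 a * f b)"

lemma vector_space_scale: "vector_space scale"
  by unfold_locales
    (auto simp: scale_def fun_eq_iff algebra_simps single_add mult_single
      simp flip: mult.assoc)

definition kdim :: "(nat \<Rightarrow> ('v, 'k::field) mpoly) set \<Rightarrow> nat" where
  "kdim = vector_space.dim scale"

text \<open>
  Over a finite set of variables the cycles form a finite-dimensional space containing the
  boundaries, so the difference below is the dimension of the quotient.  Tor does not depend on
  the choice of the graded free resolution.
\<close>

definition tor_dim ::
  "('v, 'k::field) free_complex \<Rightarrow> ('v, 'k) mpoly set \<Rightarrow> nat \<Rightarrow> nat \<Rightarrow> nat" where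
  "tor_dim F M i j = kdim (tor_cycles F M i j) - kdim (tor_boundaries F M i j)"

definition betti :: "'v set \<Rightarrow> ('v, 'k::field) mpoly set \<Rightarrow> nat \<Rightarrow> nat \<Rightarrow> nat" where
  "betti V M i j = tor_dim (SOME F. resolves_field V F) M i j"

definition reg :: "'v set \<Rightarrow> ('v, 'k::field) mpoly set \<Rightarrow> ereal" where
  "reg V M = Sup {ereal (real j - real i) | i j. betti V M i j \<noteq> 0}"

end

theory Submission
  imports Defs
begin

text \<open>
  Everything is reduced to a comparison of cochains on finite sets. The ideal \<open>I\<close> is the span of
  the monomials whose support is not a clique of \<open>C\<close>, that is, the Stanley-Reisner ideal of the
  complex \<open>\<Delta>\<close> of cliques of \<open>C\<close>.

  \<^emph>\<open>From an arbitrary resolution to the Koszul complex.\<close> A Betti number is defined through an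
  unspecified graded resolution of \<open>K\<close>. Two resolutions are related by chain maps that are
  mutually inverse up to homotopy, so they give the same Tor (\<open>tor_indep_mod_le\<close>). The Koszul
  complex is such a resolution (\<open>koszul_resolves\<close>): a monomial times a basis element \<open>e\<^sub>S\<close> has a
  multidegree \<open>a\<close>, the differential preserves \<open>a\<close>, and multiplication by \<open>e\<^sub>v\<close> followed by
  division by \<open>x\<^sub>v\<close>, for some \<open>v\<close> occurring in \<open>a\<close>, contracts the part of multidegree \<open>a \<noteq> 0\<close>.

  \<^emph>\<open>Squarefree multidegrees.\<close> If \<open>a\<^sub>v \<ge> 2\<close>, that contraction does not change the support of the
  monomial coefficient, so it preserves a squarefree monomial ideal tensored with the Koszul
  complex. Hence only the multidegrees \<open>1\<^sub>W\<close>, \<open>W \<subseteq> V\<close>, contribute. There a basis element \<open>e\<^sub>S\<close>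
  has coefficient \<open>x\<^sub>U\<close>, \<open>U = W - S\<close>, and after a change of signs the differential becomes the
  simplicial coboundary on functions of \<open>U\<close> (\<open>betti_cochains\<close>). So \<open>\<beta>\<^sub>i\<^sub>,\<^sub>j(I)\<close> is the
  dimension, summed over \<open>W\<close> with \<open>j\<close> elements, of the relative cohomology of the simplex on \<open>W\<close>
  modulo \<open>\<Delta>\<close>, on subsets \<open>U\<close> with \<open>j - i\<close> elements. This is Hochster's formula.

  \<^emph>\<open>The two pieces.\<close> A clique of \<open>C\<close> with at least \<open>d\<close> vertices is a clique of one of the pieces
  (\<open>decomposition_splits\<close>; the gluing along a clique needs \<open>d \<ge> 2\<close> for this), and no such clique
  is shared when the submaximal circuits are disjoint. For \<open>j - i > d\<close> the cohomology involves
  only cliques with at least \<open>d\<close> vertices, apart from the cochains on \<open>(d - 1)\<close>-sets whose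
  coboundaries are divided out. Restricting \<open>W\<close> to subsets of \<open>V1\<close> and of \<open>V2\<close> maps the
  cohomology of \<open>C\<close> onto the sum of those of \<open>C1\<close> and \<open>C2\<close> (\<open>lift_cocycle\<close>), which gives the
  inequality. In the other direction a Mayer-Vietoris argument for a fixed \<open>W\<close> shows that if the
  relative cohomologies of \<open>W \<inter> V1\<close> and \<open>W \<inter> V2\<close> vanish, so does that of \<open>W\<close>
  (\<open>rel_acyclic_glue\<close>); hence every \<open>j - i > d\<close> that occurs for \<open>I\<close> occurs for \<open>I1\<close> or \<open>I2\<close>.
  Nothing occurs below \<open>d\<close>, and for a nonzero ideal \<open>d\<close> itself occurs because of the generators.
  The regularities therefore agree.
\<close>

section \<open>Independence modulo a subspace\<close>

abbreviation keys :: "('a \<Rightarrow>\<^sub>0 'b::zero) \<Rightarrow> 'a set" where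
  "keys \<equiv> Poly_Mapping.keys"

abbreviation lookup :: "('a \<Rightarrow>\<^sub>0 'b::zero) \<Rightarrow> 'a \<Rightarrow> 'b" where
  "lookup \<equiv> Poly_Mapping.lookup"

abbreviation single :: "'a \<Rightarrow> 'b \<Rightarrow> 'a \<Rightarrow>\<^sub>0 'b::zero" where
  "single \<equiv> Poly_Mapping.single"

text \<open>
  The dimension of \<open>Z / B\<close> is the largest \<open>n\<close> with this property. Homologies living in spaces of
  different types are compared through this predicate: it is carried along linear maps and needs
  neither quotient spaces nor finite dimension.
\<close>

definition indep_mod ::
  "('k::field \<Rightarrow> 'a \<Rightarrow> 'a::comm_monoid_add) \<Rightarrow> nat \<Rightarrow> 'a set \<Rightarrow> 'a set \<Rightarrow> bool" where
  "indep_mod sc n Z B \<longleftrightarrow> (\<exists>g. (\<forall>i<n. g i \<in> Z) \<and>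
     (\<forall>a. (\<Sum>i<n. sc (a i) (g i)) \<in> B \<longrightarrow> (\<forall>i<n. a i = 0)))"

lemma indep_modI:
  assumes "\<And>i. i < n \<Longrightarrow> g i \<in> Z"
    and "\<And>a i. (\<Sum>i<n. sc (a i) (g i)) \<in> B \<Longrightarrow> i < n \<Longrightarrow> a i = 0"
  shows "indep_mod sc n Z B"
  using assms unfolding indep_mod_def by blast

text \<open>
  A basis of \<open>B\<close> extended to a basis of \<open>Z\<close> has \<open>dim Z - dim B\<close> additional vectors, which are
  independent modulo \<open>B\<close>; conversely, vectors that are independent modulo \<open>B\<close> stay independent
  when a basis of \<open>B\<close> is added.
\<close>

lemma (in vector_space) indep_mod_iff_dim:
  assumes Z: "subspace Z" and B: "subspace B" and BZ: "B \<subseteq> Z"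
    and fin: "finite A" "Z \<subseteq> span A"
  shows "indep_mod scale n Z B \<longleftrightarrow> n \<le> dim Z - dim B"
proof -
  obtain bB where bB: "bB \<subseteq> B" "independent bB" "B \<subseteq> span bB" "card bB = dim B"
    using basis_exists by blast
  obtain bZ where bZ: "bB \<subseteq> bZ" "bZ \<subseteq> Z" "independent bZ" "Z \<subseteq> span bZ"
    using maximal_independent_subset_extend[of bB Z] bB BZ by blast
  have fZ: "finite bZ" using independent_span_bound[OF fin(1) bZ(3)] bZ(2) fin(2) by blast
  have fB: "finite bB" using bZ(1) fZ finite_subset by blast
  have dZ: "card bZ = dim Z" using dim_unique[OF bZ(2) bZ(4) bZ(3)] by simp
  have sB: "span bB = B" using bB(1,3) span_minimal[OF bB(1) B] by blast
  show ?thesis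
  proof
    assume "n \<le> dim Z - dim B"
    then have "n \<le> card (bZ - bB)" by (simp add: card_Diff_subset fB bZ(1) dZ bB(4))
    then obtain D where D: "D \<subseteq> bZ - bB" "card D = n" "finite D"
      by (meson obtain_subset_with_card_n)
    obtain g where g: "bij_betw g {..<n} D"
      using D ex_bij_betw_nat_finite[of D] by (auto simp: lessThan_atLeast0)
    show "indep_mod scale n Z B"
    proof (rule indep_modI[of n g])
      show "g i \<in> Z" if "i < n" for i using that g D(1) bZ(2) by (auto simp: bij_betw_def)
    next
      fix a i assume s: "(\<Sum>i<n. scale (a i) (g i)) \<in> B" and i: "i < n"
      define a' where "a' x = a (the_inv_into {..<n} g x)" for x
      have inj: "inj_on g {..<n}" and im: "g ` {..<n} = D" using g by (auto simp: bij_betw_def)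
      have a': "a' (g k) = a k" if "k < n" for k
        using that inj by (simp add: a'_def the_inv_into_f_f)
      have "(\<Sum>i<n. scale (a i) (g i)) = (\<Sum>x\<in>D. scale (a' x) x)"
        unfolding im[symmetric] by (simp add: sum.reindex[OF inj] a')
      then have "(\<Sum>x\<in>D. scale (a' x) x) \<in> range (\<lambda>u. \<Sum>v\<in>bB. scale (u v) v)"
        using s sB span_finite[OF fB] by simp
      then obtain r where r: "(\<Sum>x\<in>D. scale (a' x) x) = (\<Sum>x\<in>bB. scale (r x) x)"
        by blast
      define u where "u x = (if x \<in> D then a' x else - r x)" for x
      have "(\<Sum>x\<in>D \<union> bB. scale (u x) x) = (\<Sum>x\<in>D. scale (u x) x) + (\<Sum>x\<in>bB. scale (u x) x)"
        using D fB by (intro sum.union_disjoint) auto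
      also have "(\<Sum>x\<in>D. scale (u x) x) = (\<Sum>x\<in>D. scale (a' x) x)" by (simp add: u_def)
      also have "(\<Sum>x\<in>bB. scale (u x) x) = (\<Sum>x\<in>bB. - scale (r x) x)"
        using D by (intro sum.cong) (auto simp: u_def)
      finally have "(\<Sum>x\<in>D \<union> bB. scale (u x) x) = 0" using r by (simp add: sum_negf)
      then have "u (g i) = 0"
        using independentD[OF bZ(3), of "D \<union> bB"] D fB bZ(1) im i by blast
      then show "a i = 0" using i im a' by (auto simp: u_def split: if_splits)
    qed
  next
    assume "indep_mod scale n Z B"
    then obtain g where gZ: "\<And>i. i < n \<Longrightarrow> g i \<in> Z"
      and g: "\<And>a i. (\<Sum>i<n. scale (a i) (g i)) \<in> B \<Longrightarrow> i < n \<Longrightarrow> a i = 0"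
      unfolding indep_mod_def by blast
    have inj: "inj_on g {..<n}"
    proof (rule inj_onI, rule ccontr)
      fix x y assume xy: "x \<in> {..<n}" "y \<in> {..<n}" "g x = g y" "x \<noteq> y"
      have "(\<Sum>i<n. scale (if i = x then 1 else if i = y then -1 else 0) (g i)) =
            (\<Sum>i<n. (if i = x then g x else 0) + (if i = y then - g x else 0))"
        using xy by (intro sum.cong) auto
      also have "\<dots> = 0" using xy by (simp add: sum.distrib)
      finally show False using g[of "\<lambda>i. if i = x then 1 else if i = y then -1 else 0" x] xy
          subspace_0[OF B] by auto
    qed
    have disj: "g ` {..<n} \<inter> bB = {}"
    proof (rule ccontr)
      assume "\<not> ?thesis"
      then obtain k where k: "k < n" "g k \<in> B" using bB by auto
      have "(\<Sum>i<n. scale (if i = k then 1 else 0) (g i)) = (\<Sum>i<n. (if i = k then g k else 0))"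
        by (intro sum.cong) auto
      also have "\<dots> = g k" using k by simp
      finally show False using g[of "\<lambda>i. if i = k then 1 else 0" k] k by auto
    qed
    have "independent (g ` {..<n} \<union> bB)"
    proof (rule independent_if_scalars_zero)
      show "finite (g ` {..<n} \<union> bB)" using fB by simp
      fix f x assume s: "(\<Sum>x\<in>g ` {..<n} \<union> bB. scale (f x) x) = 0" and x: "x \<in> g ` {..<n} \<union> bB"
      have *: "(\<Sum>i<n. scale (f (g i)) (g i)) + (\<Sum>x\<in>bB. scale (f x) x) = 0"
        using s by (subst (asm) sum.union_disjoint) (auto simp: fB disj sum.reindex[OF inj])
      have "(\<Sum>x\<in>bB. scale (f x) x) \<in> B"
        using bB(1) by (intro subspace_sum[OF B] subspace_scale[OF B]) auto
      then have "(\<Sum>i<n. scale (f (g i)) (g i)) \<in> B"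
        using * subspace_neg[OF B] by (metis add_eq_0_iff2)
      then have z: "f (g i) = 0" if "i < n" for i using g[of "\<lambda>i. f (g i)" i] that by blast
      then have "(\<Sum>x\<in>bB. scale (f x) x) = 0" using * by simp
      then have "f y = 0" if "y \<in> bB" for y
        using independentD[OF bB(2) fB order_refl] that by blast
      with z x show "f x = 0" by auto
    qed
    moreover have "g ` {..<n} \<union> bB \<subseteq> span bZ" using gZ bZ bB BZ by auto
    ultimately have "card (g ` {..<n} \<union> bB) \<le> card bZ" using independent_span_bound[OF fZ] by blast
    then have "n + dim B \<le> dim Z"
      by (simp add: card_Un_disjoint fB disj card_image[OF inj] bB(4) dZ)
    then show "n \<le> dim Z - dim B" by simp
  qed
qed

text \<open>
  The hypotheses say that \<open>L\<close> induces an injection from \<open>Z\<close> modulo \<open>B\<close> to \<open>Z'\<close> modulo \<open>B'\<close>.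
\<close>

lemma indep_mod_transfer:
  fixes sc :: "'k::field \<Rightarrow> 'a \<Rightarrow> 'a::comm_monoid_add"
    and sc' :: "'k \<Rightarrow> 'b \<Rightarrow> 'b::comm_monoid_add"
  assumes "indep_mod sc n Z B"
    and L: "L 0 = 0" "\<And>x y. L (x + y) = L x + L y" "\<And>a x. L (sc a x) = sc' a (L x)"
    and LZ: "\<And>z. z \<in> Z \<Longrightarrow> L z \<in> Z'"
    and LB: "\<And>z. z \<in> Z \<Longrightarrow> L z \<in> B' \<Longrightarrow> z \<in> B"
    and Z: "0 \<in> Z" "\<And>x y. x \<in> Z \<Longrightarrow> y \<in> Z \<Longrightarrow> x + y \<in> Z" "\<And>a x. x \<in> Z \<Longrightarrow> sc a x \<in> Z"
  shows "indep_mod sc' n Z' B'"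
proof -
  obtain g where gZ: "\<And>i. i < n \<Longrightarrow> g i \<in> Z"
    and g: "\<And>a i. (\<Sum>i<n. sc (a i) (g i)) \<in> B \<Longrightarrow> i < n \<Longrightarrow> a i = 0"
    using assms(1) unfolding indep_mod_def by blast
  have Ls: "L (\<Sum>i<m. sc (a i) (g i)) = (\<Sum>i<m. sc' (a i) (L (g i)))" for a and m :: nat
    by (induction m) (simp_all add: L)
  have Zs: "m \<le> n \<Longrightarrow> (\<Sum>i<m. sc (a i) (g i)) \<in> Z" for a and m :: nat
    by (induction m) (simp_all add: Z gZ)
  show ?thesis
    by (rule indep_modI[of n "\<lambda>i. L (g i)"])
      (use gZ LZ LB Zs[of n] g in \<open>auto simp flip: Ls\<close>)
qed

section \<open>Polynomials and homogeneous matrices\<close>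

lemma keys_plus_nat: "keys (a + b) = keys a \<union> keys (b :: 'v \<Rightarrow>\<^sub>0 nat)"
  by (auto simp: in_keys_iff lookup_add)

lemma mdeg_superset:
  assumes "finite A" "keys m \<subseteq> A"
  shows "mdeg m = (\<Sum>v\<in>A. lookup m v)"
  unfolding mdeg_def using assms by (intro sum.mono_neutral_left) (auto simp: in_keys_iff)

lemma mdeg_add: "mdeg (a + b) = mdeg a + mdeg b"
proof -
  have f: "finite (keys a \<union> keys b)" by simp
  show ?thesis
    using mdeg_superset[OF f, of a] mdeg_superset[OF f, of b] mdeg_superset[OF f, of "a + b"]
    by (simp add: keys_plus_nat lookup_add sum.distrib)
qed

lemma mdeg_zero [simp]: "mdeg 0 = 0"
  by (simp add: mdeg_def)

lemma poly_ring_zero [simp]: "0 \<in> poly_ring V"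
  by (simp add: poly_ring_def)

lemma poly_ring_one [simp]: "1 \<in> poly_ring V"
  by (simp add: poly_ring_def)

lemma poly_ring_uminus: "p \<in> poly_ring V \<Longrightarrow> - p \<in> poly_ring V"
  by (simp add: poly_ring_def)

lemma poly_ring_add: "p \<in> poly_ring V \<Longrightarrow> q \<in> poly_ring V \<Longrightarrow> p + q \<in> poly_ring V"
  using Poly_Mapping.keys_add[of p q] by (fastforce simp: poly_ring_def)

lemma poly_ring_mult: "p \<in> poly_ring V \<Longrightarrow> q \<in> poly_ring V \<Longrightarrow> p * q \<in> poly_ring V"
  using keys_mult[of p q] by (fastforce simp: poly_ring_def keys_plus_nat)

lemma poly_ring_const: "single 0 a \<in> poly_ring V"
  by (auto simp: poly_ring_def)

lemma is_ideal_poly_ring: "is_ideal V (poly_ring V)"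
  by (simp add: is_ideal_def poly_ring_add poly_ring_mult)

lemma ideal_subset: "is_ideal V M \<Longrightarrow> p \<in> M \<Longrightarrow> p \<in> poly_ring V"
  by (auto simp: is_ideal_def)

lemma ideal_zero: "is_ideal V M \<Longrightarrow> 0 \<in> M"
  by (auto simp: is_ideal_def)

lemma ideal_add: "is_ideal V M \<Longrightarrow> p \<in> M \<Longrightarrow> q \<in> M \<Longrightarrow> p + q \<in> M"
  by (auto simp: is_ideal_def)

lemma ideal_mult: "is_ideal V M \<Longrightarrow> p \<in> M \<Longrightarrow> r \<in> poly_ring V \<Longrightarrow> r * p \<in> M"
  by (auto simp: is_ideal_def)

lemma ideal_uminus: "is_ideal V M \<Longrightarrow> p \<in> M \<Longrightarrow> - p \<in> M"
  using ideal_mult[of V M p "-1"] by (simp add: poly_ring_uminus)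

lemma ideal_diff: "is_ideal V M \<Longrightarrow> p \<in> M \<Longrightarrow> q \<in> M \<Longrightarrow> p - q \<in> M"
  using ideal_add[of V M p "- q"] ideal_uminus by fastforce

lemma ideal_sum: "is_ideal V M \<Longrightarrow> (\<And>x. x \<in> A \<Longrightarrow> f x \<in> M) \<Longrightarrow> sum f A \<in> M"
  by (induction A rule: infinite_finite_induct) (auto intro: ideal_zero ideal_add)

text \<open>
  Elements of a free module are row vectors, so a matrix acts from the right. The differential
  of a complex and all chain maps and homotopies below are of this form.
\<close>

definition mat_apply ::
  "nat \<Rightarrow> (nat \<Rightarrow> nat \<Rightarrow> ('v, 'k::field) mpoly) \<Rightarrow> nat \<Rightarrow> (nat \<Rightarrow> ('v, 'k) mpoly) \<Rightarrow> nat \<Rightarrow> ('v, 'k) mpoly"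
  where "mat_apply n A m f = (\<lambda>c. if c < m then \<Sum>b<n. f b * A b c else 0)"

text \<open>
  The degree \<open>j\<close> part of the tensor product of \<open>M\<close> with a free module whose basis elements have
  the degrees \<open>dn\<close>.
\<close>

definition graded_part ::
  "('v, 'k::field) mpoly set \<Rightarrow> nat \<Rightarrow> (nat \<Rightarrow> nat) \<Rightarrow> nat \<Rightarrow> (nat \<Rightarrow> ('v, 'k) mpoly) set" where
  "graded_part M n dn j = {f \<in> copies n M. \<forall>b<n. \<forall>m\<in>keys (f b). mdeg m + dn b = j}"

text \<open>
  The matrices of homogeneous maps of degree \<open>0\<close>; such a map preserves every \<open>graded_part\<close>, for
  every ideal \<open>M\<close>.
\<close>

definition graded_matrix ::
  "'v set \<Rightarrow> nat \<Rightarrow> (nat \<Rightarrow> nat) \<Rightarrow> (nat \<Rightarrow> nat \<Rightarrow> ('v, 'k::field) mpoly) \<Rightarrow> nat \<Rightarrow> (nat \<Rightarrow> nat) \<Rightarrow>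
      bool" where
  "graded_matrix V n dn A m dm \<longleftrightarrow> (\<forall>b<n. \<forall>c<m. A b c \<in> poly_ring V \<and>
     (\<forall>x\<in>keys (A b c). mdeg x + dm c = dn b))"

definition module_map :: "((nat \<Rightarrow> ('v, 'k::field) mpoly) \<Rightarrow> nat \<Rightarrow> ('v, 'k) mpoly) \<Rightarrow> bool" where
  "module_map T \<longleftrightarrow> (\<forall>f g. T (f + g) = T f + T g) \<and> (\<forall>r f. T (\<lambda>b. r * f b) = (\<lambda>b. r * T f b))"

definition unit_vector :: "nat \<Rightarrow> nat \<Rightarrow> ('v, 'k::field) mpoly" where
  "unit_vector b = (\<lambda>c. if c = b then 1 else 0)"

lemma module_map_add: "module_map T \<Longrightarrow> T (f + g) = T f + T g"
  by (simp add: module_map_def)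

lemma module_map_mult: "module_map T \<Longrightarrow> T (\<lambda>b. r * f b) = (\<lambda>b. r * T f b)"
  by (simp add: module_map_def)

lemma module_map_zero: "module_map T \<Longrightarrow> T 0 = 0"
  using module_map_mult[of T 0 0] by (simp add: zero_fun_def)

lemma module_map_scale: "module_map T \<Longrightarrow> T (scale a f) = scale a (T f)"
  by (simp add: scale_def module_map_mult)

lemma module_map_diff: "module_map T \<Longrightarrow> T (f - g) = T f - T g"
  by (metis add_diff_cancel diff_add_cancel module_map_add)

lemma module_map_mat_apply: "module_map (mat_apply n A m)"
  by (auto simp: module_map_def mat_apply_def fun_eq_iff distrib_right sum.distrib sum_distrib_left
      mult.assoc)

lemma module_map_comp: "module_map S \<Longrightarrow> module_map T \<Longrightarrow> module_map (\<lambda>f. S (T f))"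
  by (simp add: module_map_def)

lemma module_map_id: "module_map (\<lambda>f. f)"
  by (simp add: module_map_def)

lemma module_map_minus: "module_map S \<Longrightarrow> module_map T \<Longrightarrow> module_map (\<lambda>f. S f - T f)"
  by (auto simp: module_map_def fun_eq_iff algebra_simps)

text \<open>
  A linear map is determined by its values on the unit vectors. This is where freeness of the
  modules in a resolution enters.
\<close>

lemma module_map_expand:
  assumes T: "module_map T" and f: "\<And>b. b \<ge> n \<Longrightarrow> f b = 0"
  shows "T f c = (\<Sum>b<n. f b * T (unit_vector b) c)"
proof -
  have "T (\<lambda>c. if c < m then f c else 0) c = (\<Sum>b<m. f b * T (unit_vector b) c)" for m
  proof (induction m)
    case 0
    then show ?case using module_map_zero[OF T] by (simp add: zero_fun_def)
  next
    case (Suc m)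
    have "(\<lambda>c. if c < Suc m then f c else 0) =
        (\<lambda>c. if c < m then f c else 0) + (\<lambda>c. f m * unit_vector m c)"
      by (auto simp: fun_eq_iff unit_vector_def less_Suc_eq)
    then show ?case using Suc module_map_add[OF T] module_map_mult[OF T, of "f m" "unit_vector m"]
        by simp
  qed
  moreover have "(\<lambda>c. if c < n then f c else 0) = f" using f by (auto simp: fun_eq_iff not_less)
  ultimately show ?thesis by metis
qed

lemma mat_apply_unit_vector: "b < n \<Longrightarrow> mat_apply n A m (unit_vector b) = (\<lambda>c. if c < m then A b c
    else 0)"
  by (auto simp: mat_apply_def unit_vector_def fun_eq_iff if_distrib if_distribR sum.delta cong:
      if_cong)

lemma unit_vector_graded_part: "b < n \<Longrightarrow> unit_vector b \<in> graded_part (poly_ring V) n dn (dn b)"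
  by (auto simp: graded_part_def copies_def unit_vector_def)

lemma graded_part_copies: "f \<in> graded_part M n dn j \<Longrightarrow> f \<in> copies n M"
  by (simp add: graded_part_def)

lemma copies_mono: "is_ideal V M \<Longrightarrow> f \<in> copies n M \<Longrightarrow> f \<in> copies n (poly_ring V)"
  by (auto simp: copies_def ideal_subset)

lemma graded_part_mono: "is_ideal V M \<Longrightarrow> f \<in> graded_part M n dn j \<Longrightarrow> f \<in> graded_part (poly_ring V) n
    dn j"
  by (auto simp: graded_part_def copies_mono)

lemma graded_part_zero: "is_ideal V M \<Longrightarrow> 0 \<in> graded_part M n dn j"
  by (simp add: graded_part_def copies_def ideal_zero)

lemma graded_part_add: "is_ideal V M \<Longrightarrow> f \<in> graded_part M n dn j \<Longrightarrow> g \<in> graded_part M n dn j \<Longrightarrow> f + g \<in>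
    graded_part M n dn j"
  unfolding graded_part_def copies_def
  by (auto simp: ideal_add dest!: subsetD[OF Poly_Mapping.keys_add])

lemma graded_part_diff: "is_ideal V M \<Longrightarrow> f \<in> graded_part M n dn j \<Longrightarrow> g \<in> graded_part M n dn j \<Longrightarrow> f - g
    \<in> graded_part M n dn j"
  unfolding graded_part_def copies_def
  by (auto simp: ideal_diff dest!: subsetD[OF Poly_Mapping.keys_diff])

lemma graded_part_scale:
  assumes "is_ideal V M" "f \<in> graded_part M n dn j"
  shows "scale a f \<in> graded_part M n dn j"
proof -
  have "keys (single 0 a * p) \<subseteq> keys p" for p :: "('a, 'b) mpoly"
    using keys_mult[of "single 0 a" p] by (auto split: if_splits)
  then have "mdeg m + dn b = j" if "b < n" "m \<in> keys (scale a f b)" for m b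
    using assms(2) that unfolding graded_part_def scale_def by blast
  then show ?thesis using assms
    by (auto simp: graded_part_def copies_def scale_def intro!: ideal_mult[OF assms(1)]
        poly_ring_const)
qed

lemma mat_apply_copies:
  assumes "is_ideal V M" "f \<in> copies n M" "graded_matrix V n dn A m dm"
  shows "mat_apply n A m f \<in> copies m M"
proof -
  have "f b * A b c \<in> M" if "b < n" "c < m" for b c
    using ideal_mult[OF assms(1), of "f b" "A b c"] that assms(2,3)
    by (simp add: copies_def graded_matrix_def mult.commute)
  then show ?thesis by (auto simp: copies_def mat_apply_def intro!: ideal_sum[OF assms(1)]
      ideal_zero[OF assms(1)])
qed

lemma keys_sum_subset: "keys (sum f A) \<subseteq> (\<Union>a\<in>A. keys (f a))"
proof (induction A rule: infinite_finite_induct)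
  case (insert x F)
  then show ?case using Poly_Mapping.keys_add[of "f x" "sum f F"] by auto
qed auto

lemma mat_apply_graded_part:
  assumes "is_ideal V M" "f \<in> graded_part M n dn j" "graded_matrix V n dn A m dm"
  shows "mat_apply n A m f \<in> graded_part M m dm j"
proof -
  have "mdeg x + dm c = j" if c: "c < m" and x: "x \<in> keys (\<Sum>b<n. f b * A b c)" for c x
  proof -
    obtain b where b: "b < n" "x \<in> keys (f b * A b c)"
      using x keys_sum_subset[of "\<lambda>b. f b * A b c" "{..<n}"] by blast
    then obtain y z where "x = y + z" "y \<in> keys (f b)" "z \<in> keys (A b c)"
      using keys_mult[of "f b" "A b c"] by blast
    moreover from this have "mdeg y + dn b = j" "mdeg z + dm c = dn b"
      using b(1) c assms(2,3) unfolding graded_part_def graded_matrix_def by blast+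
    ultimately show ?thesis by (simp add: mdeg_add)
  qed
  then show ?thesis using mat_apply_copies[OF assms(1) graded_part_copies[OF assms(2)] assms(3)]
    by (simp add: graded_part_def mat_apply_def)
qed

text \<open>
  Projectivity of a graded free module, in coordinates: a linear map whose values on basis
  elements have homogeneous preimages under \<open>E\<close> factors through \<open>E\<close>.
\<close>

lemma lift_to_matrix:
  assumes T: "module_map T"
    and g: "\<And>b. b < n \<Longrightarrow> \<exists>g\<in>graded_part (poly_ring V) m' dm' (dn b). mat_apply m' E m g = T
        (unit_vector b)"
  shows "\<exists>A. graded_matrix V n dn A m' dm' \<and>
    (\<forall>f \<in> copies n (poly_ring V). mat_apply m' E m (mat_apply n A m' f) = T f)"
proof -
  obtain g where g: "\<And>b. b < n \<Longrightarrow> g b \<in> graded_part (poly_ring V) m' dm' (dn b)"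
    "\<And>b. b < n \<Longrightarrow> mat_apply m' E m (g b) = T (unit_vector b)"
    using g by metis
  have g': "(\<lambda>c. if c < m' then g b c else 0) = g b" if "b < n" for b
    using g(1)[OF that] by (auto simp: graded_part_def copies_def fun_eq_iff)
  have "mat_apply m' E m (mat_apply n g m' f) = T f" if f: "f \<in> copies n (poly_ring V)" for f
  proof
    fix c
    have f0: "\<And>b. b \<ge> n \<Longrightarrow> f b = 0" using f by (simp add: copies_def)
    have "mat_apply m' E m (mat_apply n g m' f) c = (\<Sum>b<n. f b * mat_apply m' E m (mat_apply n g m'
        (unit_vector b)) c)"
      by (rule module_map_expand[OF module_map_comp[OF module_map_mat_apply module_map_mat_apply]
          f0])
    also have "\<dots> = (\<Sum>b<n. f b * T (unit_vector b) c)"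
      by (intro sum.cong) (simp_all add: mat_apply_unit_vector g' g(2))
    also have "\<dots> = T f c" by (rule module_map_expand[OF T f0, symmetric])
    finally show "mat_apply m' E m (mat_apply n g m' f) c = T f c" .
  qed
  moreover have "graded_matrix V n dn g m' dm'"
    using g(1) by (auto simp: graded_matrix_def graded_part_def copies_def)
  ultimately show ?thesis by blast
qed

text \<open>
  With a condition on the degree this is a homogeneous component.
\<close>

definition trunc :: "('a \<Rightarrow> bool) \<Rightarrow> ('a \<Rightarrow>\<^sub>0 'b) \<Rightarrow> 'a \<Rightarrow>\<^sub>0 'b::comm_monoid_add" where
  "trunc P p = (\<Sum>m\<in>{m\<in>keys p. P m}. single m (lookup p m))"

lemma lookup_trunc: "lookup (trunc P p) m = (if P m then lookup p m else 0)"
  by (auto simp: trunc_def lookup_sum lookup_single when_def in_keys_iff)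

lemma keys_trunc: "keys (trunc P p) = {m \<in> keys p. P m}"
  by (auto simp: in_keys_iff lookup_trunc split: if_splits)

lemma trunc_split: "p = trunc P p + trunc (\<lambda>m. \<not> P m) p"
  by (rule poly_mapping_eqI) (simp add: lookup_add lookup_trunc)

lemma trunc_add: "trunc P (p + q) = trunc P p + trunc P q"
  by (rule poly_mapping_eqI) (simp add: lookup_add lookup_trunc)

lemma trunc_sum: "trunc P (sum f A) = (\<Sum>x\<in>A. trunc P (f x))"
  by (rule poly_mapping_eqI) (auto simp: lookup_sum lookup_trunc)

lemma trunc_id: "(\<And>m. m \<in> keys p \<Longrightarrow> P m) \<Longrightarrow> trunc P p = p"
  by (rule poly_mapping_eqI) (auto simp: lookup_trunc in_keys_iff)

lemma trunc_none: "(\<And>m. m \<in> keys p \<Longrightarrow> \<not> P m) \<Longrightarrow> trunc P p = 0"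
  by (rule poly_mapping_eqI) (auto simp: lookup_trunc in_keys_iff)

text \<open>
  Multiplication by a homogeneous polynomial commutes with taking homogeneous components, up to
  the shift of degree.
\<close>

lemma trunc_mult_homogeneous:
  fixes p e :: "('v, 'k::field) mpoly"
  assumes "\<And>x. x \<in> keys e \<Longrightarrow> mdeg x + c = k"
  shows "trunc (\<lambda>m. mdeg m + c = j) (p * e) = trunc (\<lambda>m. mdeg m + k = j) p * e"
proof -
  let ?P = "\<lambda>m. mdeg m + k = j"
  have e: "p * e = trunc ?P p * e + trunc (\<lambda>m. \<not> ?P m) p * e"
    by (metis distrib_right trunc_split)
  have A: "trunc (\<lambda>m. mdeg m + c = j) (trunc ?P p * e) = trunc ?P p * e"
  proof (rule trunc_id)
    fix m assume "m \<in> keys (trunc ?P p * e)"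
    then obtain y z where "m = y + z" "?P y" "z \<in> keys e"
      using keys_mult[of "trunc ?P p" e] by (auto simp: keys_trunc)
    then show "mdeg m + c = j" using assms[of z] by (simp add: mdeg_add)
  qed
  have B: "trunc (\<lambda>m. mdeg m + c = j) (trunc (\<lambda>m. \<not> ?P m) p * e) = 0"
  proof (rule trunc_none)
    fix m assume "m \<in> keys (trunc (\<lambda>m. \<not> ?P m) p * e)"
    then obtain y z where "m = y + z" "\<not> ?P y" "z \<in> keys e"
      using keys_mult[of "trunc (\<lambda>m. \<not> ?P m) p" e] by (auto simp: keys_trunc)
    then show "mdeg m + c \<noteq> j" using assms[of z] by (simp add: mdeg_add)
  qed
  show ?thesis by (subst e) (simp add: trunc_add A B)
qed

text \<open>
  Since the matrix is homogeneous, it maps the component of degree \<open>j\<close> of \<open>x\<close> to that of the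
  image, which is the whole image.
\<close>

lemma homogeneous_preimage:
  assumes E: "graded_matrix V m' dm' E m dm" and x: "x \<in> copies m' (poly_ring V)"
    and y: "mat_apply m' E m x \<in> graded_part (poly_ring V) m dm j"
  shows "\<exists>g\<in>graded_part (poly_ring V) m' dm' j. mat_apply m' E m g = mat_apply m' E m x"
proof -
  define g where "g b = trunc (\<lambda>m. mdeg m + dm' b = j) (x b)" for b
  have "g \<in> graded_part (poly_ring V) m' dm' j"
    using x by (auto simp: graded_part_def copies_def g_def keys_trunc poly_ring_def) (simp add:
        trunc_def)
  moreover have "mat_apply m' E m g c = mat_apply m' E m x c" for c
  proof (cases "c < m")
    case True
    have "mat_apply m' E m x c = trunc (\<lambda>m. mdeg m + dm c = j) (mat_apply m' E m x c)"
      using y True by (intro trunc_id[symmetric]) (auto simp: graded_part_def)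
    also have "\<dots> = (\<Sum>b<m'. trunc (\<lambda>m. mdeg m + dm c = j) (x b * E b c))"
      using True by (simp add: mat_apply_def trunc_sum)
    also have "\<dots> = (\<Sum>b<m'. g b * E b c)"
    proof (intro sum.cong refl)
      fix b assume "b \<in> {..<m'}"
      then show "trunc (\<lambda>m. mdeg m + dm c = j) (x b * E b c) = g b * E b c"
        unfolding g_def by (intro trunc_mult_homogeneous) (use E True in \<open>auto simp:
            graded_matrix_def\<close>)
    qed
    finally show ?thesis using True by (simp add: mat_apply_def)
  qed (simp add: mat_apply_def)
  ultimately show ?thesis by (metis ext)
qed

section \<open>Comparison of graded resolutions\<close>

lemma diff_eq_mat_apply: "diff F i = mat_apply (rk F (Suc i)) (mat F i) (rk F i)"
  by (simp add: fun_eq_iff diff_def mat_apply_def)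

lemma tensor_part_eq: "tensor_part F M i j = graded_part M (rk F i) (gdeg F i) j"
  by (simp add: tensor_part_def graded_part_def)

text \<open>
  In a resolution the outgoing map at position \<open>0\<close> is the augmentation. The cycles of the tensor
  product with an ideal are different there, since they satisfy no condition at position \<open>0\<close>.
\<close>

definition augmented_cycle :: "('v, 'k::field) free_complex \<Rightarrow> nat \<Rightarrow> (nat \<Rightarrow> ('v, 'k) mpoly) \<Rightarrow>
    bool" where
  "augmented_cycle F i f = (case i of 0 \<Rightarrow> augment F f = 0 | Suc l \<Rightarrow> diff F l f = 0)"

lemma module_map_diff_map: "module_map (diff F i)"
  by (simp add: diff_eq_mat_apply module_map_mat_apply)

lemma resolves_graded_matrix: "resolves_field V F \<Longrightarrow> graded_matrix V (rk F (Suc i)) (gdeg F (Suc i))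
    (mat F i) (rk F i) (gdeg F i)"
  by (simp add: resolves_field_def is_graded_def graded_matrix_def)

lemma resolves_diff_zero:
  assumes "resolves_field V F" "f \<in> copies (rk F (Suc i)) (poly_ring V)"
  shows "augmented_cycle F i (diff F i f)"
proof (cases i)
  case 0
  then show ?thesis using assms unfolding resolves_field_def augmented_cycle_def by auto
next
  case (Suc l)
  have "diff F (Suc l) f \<in> diff F (Suc l) ` copies (rk F (l + 2)) (poly_ring V)"
    using assms(2) Suc by simp
  then show ?thesis using assms(1) Suc unfolding resolves_field_def augmented_cycle_def by auto
qed

lemma resolves_exact:
  assumes "resolves_field V F" "f \<in> copies (rk F i) (poly_ring V)" "augmented_cycle F i f"
  shows "\<exists>x\<in>copies (rk F (Suc i)) (poly_ring V). diff F i x = f"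
proof (cases i)
  case 0
  then have "f \<in> diff F 0 ` copies (rk F 1) (poly_ring V)"
    using assms by (simp add: resolves_field_def augmented_cycle_def)
  then show ?thesis using 0 by auto
next
  case (Suc l)
  then have "f \<in> diff F (Suc l) ` copies (rk F (l + 2)) (poly_ring V)"
    using assms by (simp add: resolves_field_def augmented_cycle_def)
  then show ?thesis using Suc by auto
qed

lemma resolves_exact_graded_part:
  assumes "resolves_field V F" "f \<in> graded_part (poly_ring V) (rk F i) (gdeg F i) j"
      "augmented_cycle F i f"
  shows "\<exists>x\<in>graded_part (poly_ring V) (rk F (Suc i)) (gdeg F (Suc i)) j. diff F i x = f"
proof -
  obtain x where x: "x \<in> copies (rk F (Suc i)) (poly_ring V)" "diff F i x = f"
    using resolves_exact[OF assms(1) graded_part_copies[OF assms(2)] assms(3)] by blast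
  show ?thesis
    using homogeneous_preimage[OF resolves_graded_matrix[OF assms(1)] x(1)] x(2) assms(2)
    by (simp add: diff_eq_mat_apply)
qed

text \<open>
  The constant term is multiplicative because a sum of two monomial exponents vanishes only if
  both do.
\<close>

lemma lookup_mult_zero:
  fixes p q :: "('v, 'k::field) mpoly"
  shows "lookup (p * q) 0 = lookup p 0 * lookup q 0"
proof -
  have z: "(0 :: 'v \<Rightarrow>\<^sub>0 nat) = x + y \<longleftrightarrow> x = 0 \<and> y = 0" for x y
  proof
    assume "0 = x + y"
    then have "keys x \<union> keys y = {}"
      by (metis keys_plus_nat keys_zero)
    then show "x = 0 \<and> y = 0" by (simp add: keys_eq_empty)
  qed auto
  have "(\<Sum>b. lookup q b when 0 = a + b) =
        (lookup q 0 when a = 0)" for a :: "'v \<Rightarrow>\<^sub>0 nat"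
    by (cases "a = 0") (simp_all add: z)
  then show ?thesis by (simp add: lookup_mult mult_when)
qed

lemma augment_add: "augment G (f + g) = augment G f + augment G g"
  by (simp add: augment_def lookup_add distrib_right sum.distrib)

lemma augment_diff: "augment G (f - g) = augment G f - augment G g"
  by (metis add_diff_cancel augment_add diff_add_cancel)

lemma augment_zero: "augment G 0 = 0"
  by (simp add: augment_def)

lemma augment_expand:
  assumes T: "module_map T" and f: "\<And>b. b \<ge> n \<Longrightarrow> f b = 0"
  shows "augment G (T f) = (\<Sum>b<n. lookup (f b) 0 * augment G (T (unit_vector b)))"
proof -
  have "augment G (T f) = (\<Sum>c<rk G 0. \<Sum>b<n. lookup (f b) 0 * (lookup (T (unit_vector b) c) 0 * aug G
      c))"
    by (simp add: augment_def module_map_expand[OF T f] lookup_sum lookup_mult_zero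
        sum_distrib_right mult.assoc)
  then show ?thesis by (simp add: augment_def sum.swap[of _ "{..<n}"] sum_distrib_left)
qed

lemma tor_cycles_eq:
  "tor_cycles F M i j = {f \<in> graded_part M (rk F i) (gdeg F i) j. i > 0 \<longrightarrow> diff F (i - 1) f = 0}"
  by (cases i) (auto simp: tor_cycles_def tensor_part_eq)

text \<open>
  The invariant for constructing a chain map one position at a time. That cycles go to cycles is
  what the next step uses; it follows from commutation with the differentials at the previous
  position.
\<close>

definition chain_map_component ::
  "'v set \<Rightarrow> ('v, 'k::field) free_complex \<Rightarrow> ('v, 'k) free_complex \<Rightarrow> nat \<Rightarrow> (nat \<Rightarrow> nat \<Rightarrow> ('v, 'k)
      mpoly) \<Rightarrow> bool"
  where "chain_map_component V F G i A \<longleftrightarrow> graded_matrix V (rk F i) (gdeg F i) A (rk G i) (gdeg G i) \<and>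
    (\<forall>f\<in>copies (rk F i) (poly_ring V). augmented_cycle F i f \<longrightarrow> augmented_cycle G i (mat_apply (rk F
        i) A (rk G i) f)) \<and>
    (i = 0 \<longrightarrow> (\<forall>f\<in>copies (rk F 0) (poly_ring V). augment G (mat_apply (rk F 0) A (rk G 0) f) =
        augment F f))"

text \<open>
  Lift the identity of \<open>K\<close> step by step: the image of a basis element under the differential of
  \<open>F\<close> and the last component of the chain map is a cycle of \<open>G\<close>, so exactness of \<open>G\<close> provides a
  homogeneous preimage.
\<close>

lemma chain_map_exists:
  fixes F G :: "('v, 'k::field) free_complex"
  assumes F: "resolves_field V F" and G: "resolves_field V G"
  obtains A where "\<And>i. graded_matrix V (rk F i) (gdeg F i) (A i) (rk G i) (gdeg G i)"
    and "\<And>f. f \<in> copies (rk F 0) (poly_ring V) \<Longrightarrow>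
        augment G (mat_apply (rk F 0) (A 0) (rk G 0) f) = augment F f"
    and "\<And>i f. f \<in> copies (rk F (Suc i)) (poly_ring V) \<Longrightarrow>
        diff G i (mat_apply (rk F (Suc i)) (A (Suc i)) (rk G (Suc i)) f) = mat_apply (rk F i) (A i)
            (rk G i) (diff F i f)"
proof -
  let ?R = "poly_ring V :: ('v, 'k) mpoly set"
  have I: "is_ideal V ?R" by (rule is_ideal_poly_ring)
  have base: "\<exists>A. chain_map_component V F G 0 A"
  proof -
    have "\<exists>g\<in>graded_part ?R (rk G 0) (gdeg G 0) (gdeg F 0 b). augment G g = aug F b" if b: "b < rk F
        0" for b
    proof (cases "aug F b = 0")
      case True
      then show ?thesis using graded_part_zero[OF I] augment_zero by metis
    next
      case False
      \<comment> \<open>The augmentation sees constant terms only, so the component of degree 0 is enough.\<close>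
      then have d0: "gdeg F 0 b = 0" using F b by (simp add: resolves_field_def is_graded_def)
      have "aug F b \<in> augment G ` copies (rk G 0) ?R"
        using G by (simp add: resolves_field_def)
      then obtain x where x: "x \<in> copies (rk G 0) ?R" "augment G x = aug F b" by auto
      define g where "g c = trunc (\<lambda>m. mdeg m + gdeg G 0 c = 0) (x c)" for c
      have "augment G g = augment G x"
        unfolding augment_def using G
        by (intro sum.cong) (auto simp: g_def lookup_trunc resolves_field_def is_graded_def)
      moreover have "g \<in> graded_part ?R (rk G 0) (gdeg G 0) 0"
        using x(1) by (auto simp: graded_part_def copies_def g_def keys_trunc poly_ring_def) (simp
            add: trunc_def)
      ultimately show ?thesis using x(2) d0 by (intro bexI[of _ g]) simp_all
    qed
    then obtain g where g: "\<And>b. b < rk F 0 \<Longrightarrow> g b \<in> graded_part ?R (rk G 0) (gdeg G 0) (gdeg F 0 b)"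
      "\<And>b. b < rk F 0 \<Longrightarrow> augment G (g b) = aug F b" by metis
    have g': "(\<lambda>c. if c < rk G 0 then g b c else 0) = g b" if "b < rk F 0" for b
      using g(1)[OF that] by (auto simp: graded_part_def copies_def fun_eq_iff)
    have aug: "augment G (mat_apply (rk F 0) g (rk G 0) f) = augment F f" if f: "f \<in> copies (rk F 0)
        ?R" for f
    proof -
      have "augment G (mat_apply (rk F 0) g (rk G 0) f) =
          (\<Sum>b<rk F 0. lookup (f b) 0 * augment G (mat_apply (rk F 0) g (rk G 0) (unit_vector b)))"
        by (rule augment_expand[OF module_map_mat_apply]) (use f in \<open>simp add: copies_def\<close>)
      also have "\<dots> = augment F f"
        unfolding augment_def[of F] by (intro sum.cong) (simp_all add: mat_apply_unit_vector g'
            g(2))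
      finally show ?thesis .
    qed
    moreover have "graded_matrix V (rk F 0) (gdeg F 0) g (rk G 0) (gdeg G 0)"
      using g(1) by (auto simp: graded_matrix_def graded_part_def copies_def)
    ultimately have "chain_map_component V F G 0 g"
      by (simp add: chain_map_component_def augmented_cycle_def)
    then show ?thesis by blast
  qed
  have step: "\<exists>B. chain_map_component V F G (Suc i) B \<and> (\<forall>f \<in> copies (rk F (Suc i)) ?R.
      diff G i (mat_apply (rk F (Suc i)) B (rk G (Suc i)) f) = mat_apply (rk F i) A (rk G i) (diff F
          i f))"
    if A: "chain_map_component V F G i A" for A i
  proof -
    let ?T = "\<lambda>f. mat_apply (rk F i) A (rk G i) (diff F i f)"
    have "\<exists>B. graded_matrix V (rk F (Suc i)) (gdeg F (Suc i)) B (rk G (Suc i)) (gdeg G (Suc i)) \<and>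
      (\<forall>f \<in> copies (rk F (Suc i)) ?R. mat_apply (rk G (Suc i)) (mat G i) (rk G i)
         (mat_apply (rk F (Suc i)) B (rk G (Suc i)) f) = ?T f)"
    proof (rule lift_to_matrix)
      show "module_map ?T" by (rule module_map_comp[OF module_map_mat_apply module_map_diff_map])
      fix b assume b: "b < rk F (Suc i)"
      let ?e = "unit_vector b :: nat \<Rightarrow> ('v, 'k) mpoly"
      have e: "?e \<in> graded_part ?R (rk F (Suc i)) (gdeg F (Suc i)) (gdeg F (Suc i) b)"
        by (rule unit_vector_graded_part[OF b])
      have de: "diff F i ?e \<in> graded_part ?R (rk F i) (gdeg F i) (gdeg F (Suc i) b)"
        unfolding diff_eq_mat_apply by (rule mat_apply_graded_part[OF I e
            resolves_graded_matrix[OF F]])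
      have "?T ?e \<in> graded_part ?R (rk G i) (gdeg G i) (gdeg F (Suc i) b)"
        using A by (intro mat_apply_graded_part[OF I de]) (simp add: chain_map_component_def)
      moreover have "augmented_cycle G i (?T ?e)"
        using A resolves_diff_zero[OF F graded_part_copies[OF e]] graded_part_copies[OF de] by (simp
            add: chain_map_component_def)
      ultimately show "\<exists>g\<in>graded_part ?R (rk G (Suc i)) (gdeg G (Suc i)) (gdeg F (Suc i) b).
          mat_apply (rk G (Suc i)) (mat G i) (rk G i) g = ?T ?e"
        using resolves_exact_graded_part[OF G] by (simp add: diff_eq_mat_apply)
    qed
    then obtain B where B: "graded_matrix V (rk F (Suc i)) (gdeg F (Suc i)) B (rk G (Suc i)) (gdeg G
        (Suc i))"
      "\<And>f. f \<in> copies (rk F (Suc i)) ?R \<Longrightarrow> diff G i (mat_apply (rk F (Suc i)) B (rk G (Suc i)) f) =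
          ?T f"
      by (auto simp: diff_eq_mat_apply)
    then have "chain_map_component V F G (Suc i) B"
      by (simp add: chain_map_component_def augmented_cycle_def
          module_map_zero[OF module_map_mat_apply])
    with B(2) show ?thesis by blast
  qed
  have "\<exists>A. \<forall>i. chain_map_component V F G i (A i) \<and> (\<forall>f \<in> copies (rk F (Suc i)) ?R.
      diff G i (mat_apply (rk F (Suc i)) (A (Suc i)) (rk G (Suc i)) f) = mat_apply (rk F i) (A i)
          (rk G i) (diff F i f))"
    by (rule dependent_nat_choice[where P="chain_map_component V F G" and Q="\<lambda>i A B. \<forall>f \<in> copies (rk
        F (Suc i)) ?R.
      diff G i (mat_apply (rk F (Suc i)) B (rk G (Suc i)) f) = mat_apply (rk F i) A (rk G i) (diff F
          i f)"])
      (rule base, rule step)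
  then obtain A where A: "\<And>i. chain_map_component V F G i (A i)"
    "\<And>i. \<forall>f \<in> copies (rk F (Suc i)) ?R.
      diff G i (mat_apply (rk F (Suc i)) (A (Suc i)) (rk G (Suc i)) f) = mat_apply (rk F i) (A i)
          (rk G i) (diff F i f)"
    by blast
  show thesis
    by (rule that[of A]) (use A in \<open>auto simp: chain_map_component_def\<close>)
qed

text \<open>
  A chain endomorphism that induces \<open>0\<close> on \<open>K\<close> is null-homotopic. Only its consequence on cycles
  is recorded: there the homotopy formula \<open>T = d s + s d\<close> reduces to \<open>T = d s\<close>. In the induction
  step the matrix for \<open>Suc i\<close> is chosen as a lift of \<open>T - s d\<close>, whose values are cycles by the
  statement for \<open>i\<close>.
\<close>

lemma null_homotopy:
  fixes F :: "('v, 'k::field) free_complex"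
  assumes F: "resolves_field V F"
    and T: "\<And>i. module_map (T i)"
    and Tg: "\<And>i j f. f \<in> graded_part (poly_ring V) (rk F i) (gdeg F i) j \<Longrightarrow> T i f \<in> graded_part
        (poly_ring V) (rk F i) (gdeg F i) j"
    and T0: "\<And>f. f \<in> copies (rk F 0) (poly_ring V) \<Longrightarrow> augment F (T 0 f) = 0"
    and Td: "\<And>i f. f \<in> copies (rk F (Suc i)) (poly_ring V) \<Longrightarrow> diff F i (T (Suc i) f) = T i (diff F i
        f)"
  shows "\<exists>s. graded_matrix V (rk F i) (gdeg F i) s (rk F (Suc i)) (gdeg F (Suc i)) \<and>
    (\<forall>f\<in>copies (rk F i) (poly_ring V). (i > 0 \<longrightarrow> diff F (i - 1) f = 0) \<longrightarrow>
       diff F i (mat_apply (rk F i) s (rk F (Suc i)) f) = T i f)"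
proof (induction i)
  case 0
  let ?R = "poly_ring V :: ('v, 'k) mpoly set"
  have "\<exists>s. graded_matrix V (rk F 0) (gdeg F 0) s (rk F (Suc 0)) (gdeg F (Suc 0)) \<and>
    (\<forall>f\<in>copies (rk F 0) ?R. mat_apply (rk F (Suc 0)) (mat F 0) (rk F 0) (mat_apply (rk F 0) s (rk F
        (Suc 0)) f) = T 0 f)"
  proof (rule lift_to_matrix[OF T])
    fix b assume b: "b < rk F 0"
    have e: "unit_vector b \<in> graded_part ?R (rk F 0) (gdeg F 0) (gdeg F 0 b)" by (rule
        unit_vector_graded_part[OF b])
    show "\<exists>g\<in>graded_part ?R (rk F (Suc 0)) (gdeg F (Suc 0)) (gdeg F 0 b).
        mat_apply (rk F (Suc 0)) (mat F 0) (rk F 0) g = T 0 (unit_vector b)"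
      using resolves_exact_graded_part[OF F Tg[OF e]] T0[OF graded_part_copies[OF e]]
      by (simp add: diff_eq_mat_apply augmented_cycle_def)
  qed
  then show ?case by (auto simp: diff_eq_mat_apply)
next
  case (Suc i)
  let ?R = "poly_ring V :: ('v, 'k) mpoly set"
  have I: "is_ideal V ?R" by (rule is_ideal_poly_ring)
  obtain s where pos_sign: "graded_matrix V (rk F i) (gdeg F i) s (rk F (Suc i)) (gdeg F (Suc i))"
    and s: "\<And>f. f \<in> copies (rk F i) ?R \<Longrightarrow> i > 0 \<longrightarrow> diff F (i - 1) f = 0 \<Longrightarrow>
       diff F i (mat_apply (rk F i) s (rk F (Suc i)) f) = T i f"
    using Suc by blast
  let ?U = "\<lambda>f. T (Suc i) f - mat_apply (rk F i) s (rk F (Suc i)) (diff F i f)"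
  have "\<exists>s. graded_matrix V (rk F (Suc i)) (gdeg F (Suc i)) s (rk F (Suc (Suc i))) (gdeg F (Suc (Suc
      i))) \<and>
    (\<forall>f\<in>copies (rk F (Suc i)) ?R. mat_apply (rk F (Suc (Suc i))) (mat F (Suc i)) (rk F (Suc i))
       (mat_apply (rk F (Suc i)) s (rk F (Suc (Suc i))) f) = ?U f)"
  proof (rule lift_to_matrix)
    show "module_map ?U" by (rule module_map_minus[OF T module_map_comp[OF module_map_mat_apply
        module_map_diff_map]])
    fix b assume b: "b < rk F (Suc i)"
    let ?e = "unit_vector b :: nat \<Rightarrow> ('v, 'k) mpoly"
    have e: "?e \<in> graded_part ?R (rk F (Suc i)) (gdeg F (Suc i)) (gdeg F (Suc i) b)" by (rule
        unit_vector_graded_part[OF b])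
    have de: "diff F i ?e \<in> graded_part ?R (rk F i) (gdeg F i) (gdeg F (Suc i) b)"
      unfolding diff_eq_mat_apply by (rule mat_apply_graded_part[OF I e
          resolves_graded_matrix[OF F]])
    have U: "?U ?e \<in> graded_part ?R (rk F (Suc i)) (gdeg F (Suc i)) (gdeg F (Suc i) b)"
      by (rule graded_part_diff[OF I Tg[OF e] mat_apply_graded_part[OF I de pos_sign]])
    have "diff F i (mat_apply (rk F i) s (rk F (Suc i)) (diff F i ?e)) = T i (diff F i ?e)"
      using resolves_diff_zero[OF F graded_part_copies[OF e]]
      by (intro s graded_part_copies[OF de]) (auto simp: augmented_cycle_def split: nat.splits)
    then have "augmented_cycle F (Suc i) (?U ?e)"
      using Td[OF graded_part_copies[OF e]] by (simp add: augmented_cycle_def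
          module_map_diff[OF module_map_diff_map])
    then show "\<exists>g\<in>graded_part ?R (rk F (Suc (Suc i))) (gdeg F (Suc (Suc i))) (gdeg F (Suc i) b).
        mat_apply (rk F (Suc (Suc i))) (mat F (Suc i)) (rk F (Suc i)) g = ?U ?e"
      using resolves_exact_graded_part[OF F U] by (simp add: diff_eq_mat_apply)
  qed
  then obtain s' where s': "graded_matrix V (rk F (Suc i)) (gdeg F (Suc i)) s' (rk F (Suc (Suc i)))
      (gdeg F (Suc (Suc i)))"
    "\<And>f. f \<in> copies (rk F (Suc i)) ?R \<Longrightarrow> diff F (Suc i) (mat_apply (rk F (Suc i)) s' (rk F (Suc (Suc
        i))) f) = ?U f"
    by (auto simp: diff_eq_mat_apply)
  have U: "?U f = T (Suc i) f" if "diff F i f = 0" for f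
    unfolding that module_map_zero[OF module_map_mat_apply] by simp
  show ?case
  proof (intro exI[of _ s'] conjI ballI impI)
    fix f assume f: "f \<in> copies (rk F (Suc i)) ?R" "0 < Suc i \<longrightarrow> diff F (Suc i - 1) f = 0"
    have "diff F i f = 0" using f(2) by (metis diff_Suc_1 zero_less_Suc)
    from trans[OF s'(2)[OF f(1)] U[OF this]]
    show "diff F (Suc i) (mat_apply (rk F (Suc i)) s' (rk F (Suc (Suc i))) f) = T (Suc i) f" .
  qed (rule s'(1))
qed

text \<open>
  The chain map from \<open>F\<close> to \<open>G\<close> is injective on the homology with coefficients in \<open>M\<close>, since
  composing it with a chain map back is homotopic to the identity. All the maps are given by
  matrices with entries in the polynomial ring, so the identities that hold on the free modules
  also hold on the submodules with coordinates in \<open>M\<close>.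
\<close>

lemma tor_indep_mod_le:
  fixes F G :: "('v, 'k::field) free_complex"
  assumes F: "resolves_field V F" and G: "resolves_field V G" and M: "is_ideal V M"
    and n: "indep_mod scale n (tor_cycles F M i j) (tor_boundaries F M i j)"
  shows "indep_mod scale n (tor_cycles G M i j) (tor_boundaries G M i j)"
proof -
  let ?R = "poly_ring V :: ('v, 'k) mpoly set"
  obtain A where Ag: "\<And>i. graded_matrix V (rk F i) (gdeg F i) (A i) (rk G i) (gdeg G i)"
    and A0: "\<And>f. f \<in> copies (rk F 0) ?R \<Longrightarrow> augment G (mat_apply (rk F 0) (A 0) (rk G 0) f) = augment
        F f"
    and Ad: "\<And>i f. f \<in> copies (rk F (Suc i)) ?R \<Longrightarrow>
        diff G i (mat_apply (rk F (Suc i)) (A (Suc i)) (rk G (Suc i)) f) = mat_apply (rk F i) (A i)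
            (rk G i) (diff F i f)"
    using chain_map_exists[OF F G] by blast
  obtain B where Bg: "\<And>i. graded_matrix V (rk G i) (gdeg G i) (B i) (rk F i) (gdeg F i)"
    and B0: "\<And>f. f \<in> copies (rk G 0) ?R \<Longrightarrow> augment F (mat_apply (rk G 0) (B 0) (rk F 0) f) = augment
        G f"
    and Bd: "\<And>i f. f \<in> copies (rk G (Suc i)) ?R \<Longrightarrow>
        diff F i (mat_apply (rk G (Suc i)) (B (Suc i)) (rk F (Suc i)) f) = mat_apply (rk G i) (B i)
            (rk F i) (diff G i f)"
    using chain_map_exists[OF G F] by blast
  have I: "is_ideal V ?R" by (rule is_ideal_poly_ring)
  define a where "a i = mat_apply (rk F i) (A i) (rk G i)" for i
  define b where "b i = mat_apply (rk G i) (B i) (rk F i)" for i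
  define T where "T i f = b i (a i f) - f" for i f
  have ac: "f \<in> copies (rk F i) ?R \<Longrightarrow> a i f \<in> copies (rk G i) ?R" for i f
    unfolding a_def by (rule mat_apply_copies[OF I _ Ag])
  have ag: "is_ideal V N \<Longrightarrow> f \<in> graded_part N (rk F i) (gdeg F i) j \<Longrightarrow> a i f \<in> graded_part N (rk G i)
      (gdeg G i) j" for i f j N
    unfolding a_def by (rule mat_apply_graded_part[OF _ _ Ag])
  have bg: "is_ideal V N \<Longrightarrow> f \<in> graded_part N (rk G i) (gdeg G i) j \<Longrightarrow> b i f \<in> graded_part N (rk F i)
      (gdeg F i) j" for i f j N
    unfolding b_def by (rule mat_apply_graded_part[OF _ _ Bg])
  have "\<exists>s. graded_matrix V (rk F i) (gdeg F i) s (rk F (Suc i)) (gdeg F (Suc i)) \<and>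
    (\<forall>f\<in>copies (rk F i) ?R. (i > 0 \<longrightarrow> diff F (i - 1) f = 0) \<longrightarrow>
       diff F i (mat_apply (rk F i) s (rk F (Suc i)) f) = T i f)"
  proof (rule null_homotopy[OF F])
    show "module_map (T i)" for i
      unfolding T_def a_def b_def by (rule
          module_map_minus[OF module_map_comp[OF module_map_mat_apply module_map_mat_apply]
          module_map_id])
    show "T i f \<in> graded_part ?R (rk F i) (gdeg F i) j" if "f \<in> graded_part ?R (rk F i) (gdeg F i)
        j" for i j f
      unfolding T_def by (rule graded_part_diff[OF I bg[OF I ag[OF I that]] that])
    show "augment F (T 0 f) = 0" if "f \<in> copies (rk F 0) ?R" for f
      using A0[OF that] B0[OF ac[OF that]] by (simp add: T_def augment_diff a_def b_def)
    show "diff F i (T (Suc i) f) = T i (diff F i f)" if "f \<in> copies (rk F (Suc i)) ?R" for i f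
      using Ad[OF that] Bd[OF ac[OF that]] by (simp add: T_def
          module_map_diff[OF module_map_diff_map] a_def b_def)
  qed
  then obtain s where pos_sign: "graded_matrix V (rk F i) (gdeg F i) s (rk F (Suc i)) (gdeg F (Suc
      i))"
    and s: "\<And>f. f\<in>copies (rk F i) ?R \<Longrightarrow> i > 0 \<longrightarrow> diff F (i - 1) f = 0 \<Longrightarrow>
       diff F i (mat_apply (rk F i) s (rk F (Suc i)) f) = T i f" by blast
  have la: "module_map (a i)" for i by (simp add: a_def module_map_mat_apply)
  show ?thesis
  proof (rule indep_mod_transfer[OF n, where L = "a i"])
    show "a i 0 = 0" "a i (x + y) = a i x + a i y" "a i (scale c x) = scale c (a i x)" for x y c
      by (rule module_map_zero[OF la], rule module_map_add[OF la], rule module_map_scale[OF la])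
  next
    fix z assume z: "z \<in> tor_cycles F M i j"
    have zg: "z \<in> graded_part M (rk F i) (gdeg F i) j" and z0: "i > 0 \<longrightarrow> diff F (i - 1) z = 0"
      using z by (auto simp: tor_cycles_eq)
    have zc: "z \<in> copies (rk F i) ?R" by (rule graded_part_copies[OF graded_part_mono[OF M zg]])
    show "a i z \<in> tor_cycles G M i j"
      unfolding tor_cycles_eq
      using ag[OF M zg] Ad[of z "i - 1"] zc z0 la[of "i - 1"] by (auto simp: a_def module_map_zero)
    assume "a i z \<in> tor_boundaries G M i j"
    then obtain y where y: "y \<in> graded_part M (rk G (Suc i)) (gdeg G (Suc i)) j" "a i z = diff G i
        y"
      by (auto simp: tor_boundaries_def tensor_part_eq)
    \<comment> \<open>Carry the primitive back along the second chain map and correct it by the homotopy.\<close>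
    let ?w = "b (Suc i) y - mat_apply (rk F i) s (rk F (Suc i)) z"
    have w: "?w \<in> graded_part M (rk F (Suc i)) (gdeg F (Suc i)) j"
      by (rule graded_part_diff[OF M bg[OF M y(1)] mat_apply_graded_part[OF M zg pos_sign]])
    have "diff F i ?w = diff F i (b (Suc i) y) - T i z"
      using s[OF zc z0] by (simp add: module_map_diff[OF module_map_diff_map])
    also have "diff F i (b (Suc i) y) = b i (a i z)"
      using Bd[OF graded_part_copies[OF graded_part_mono[OF M y(1)]]] y(2) by (simp add: b_def)
    also have "b i (a i z) - T i z = z" by (simp add: T_def)
    finally have "z = diff F i ?w" by (rule sym)
    then show "z \<in> tor_boundaries F M i j"
      using w by (auto simp: tor_boundaries_def tensor_part_eq)
  next
    show "0 \<in> tor_cycles F M i j"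
      by (simp add: tor_cycles_eq graded_part_zero[OF M] module_map_zero[OF module_map_diff_map])
    show "x + y \<in> tor_cycles F M i j" if "x \<in> tor_cycles F M i j" "y \<in> tor_cycles F M i j" for x y
      using that by (simp add: tor_cycles_eq graded_part_add[OF M]
          module_map_add[OF module_map_diff_map])
    show "scale c x \<in> tor_cycles F M i j" if "x \<in> tor_cycles F M i j" for c x
    proof -
      have "diff F (i - 1) (scale c x) = 0" if "diff F (i - 1) x = 0"
        unfolding module_map_scale[OF module_map_diff_map] that by (simp add: scale_def
            zero_fun_def)
      then show ?thesis using that by (auto simp only: tor_cycles_eq graded_part_scale[OF M]
          mem_Collect_eq)
    qed
  qed
qed

section \<open>The Koszul complex\<close>

definition sqfree_monom :: "'v set \<Rightarrow> 'v \<Rightarrow>\<^sub>0 nat" where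
  "sqfree_monom S = (\<Sum>v\<in>S. single v 1)"

lemma lookup_sqfree_monom: "finite S \<Longrightarrow> lookup (sqfree_monom S) v = (if v \<in> S then 1 else 0)"
  by (simp add: sqfree_monom_def lookup_sum lookup_single when_def)

lemma keys_sqfree_monom: "finite S \<Longrightarrow> keys (sqfree_monom S) = S"
  by (auto simp: in_keys_iff lookup_sqfree_monom split: if_splits)

lemma mdeg_sqfree_monom: "finite S \<Longrightarrow> mdeg (sqfree_monom S) = card S"
  by (simp add: mdeg_def keys_sqfree_monom lookup_sqfree_monom)

lemma minus_sqfree_monom_add:
  "finite S \<Longrightarrow> S \<subseteq> keys a \<Longrightarrow> a - sqfree_monom S + sqfree_monom S = a"
  by (rule poly_mapping_eqI) (auto simp: lookup_add lookup_minus lookup_sqfree_monom in_keys_iff)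

lemma lookup_times_single:
  fixes p :: "('v, 'k::field) mpoly"
  shows "lookup (p * single (single v 1) s) m =
    (if v \<in> keys m then lookup p (m - single v 1) * s else 0)"
proof -
  let ?k = "single v (1::nat)"
  have "lookup (p * single ?k s) m =
     (\<Sum>l. lookup p l * (s when m = l + ?k))"
  proof -
    have "(\<Sum>q. lookup (single ?k s) q when m = l + q) = (s when m = l + ?k)" for l
    proof -
      have "(\<lambda>q. lookup (single ?k s) q when m = l + q) =
        (\<lambda>q. (s when m = l + ?k) when q = ?k)"
        by (auto simp: fun_eq_iff lookup_single when_def)
      then have "(\<Sum>q. lookup (single ?k s) q when m = l + q) =
        (\<Sum>q. (s when m = l + ?k) when q = ?k)" by (simp only:)
      then show ?thesis by (simp only: Sum_any_when_equal)
    qed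
    then show ?thesis by (simp only: lookup_mult)
  qed
  also have "\<dots> = (if v \<in> keys m then lookup p (m - ?k) * s else 0)"
  proof (cases "v \<in> keys m")
    case True
    have "m = l + ?k \<longleftrightarrow> l = m - ?k" for l
    proof
      assume "l = m - ?k"
      then show "m = l + ?k" using True
        by (intro poly_mapping_eqI) (auto simp: lookup_add lookup_minus lookup_single when_def
            in_keys_iff)
    qed simp
    then have "(\<lambda>l. lookup p l * (s when m = l + ?k)) =
       (\<lambda>l. lookup p (m - ?k) * s when l = m - ?k)"
      by (auto simp: fun_eq_iff when_def)
    then have "(\<Sum>l. lookup p l * (s when m = l + ?k)) =
       (\<Sum>l. lookup p (m - ?k) * s when l = m - ?k)" by (simp only:)
    then show ?thesis using True by (simp only: Sum_any_when_equal if_True)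
  next
    case False
    have "m \<noteq> l + ?k" for l
      using False by (auto simp: keys_plus_nat)
    then show ?thesis using False by simp
  qed
  finally show ?thesis .
qed

text \<open>
  The squarefree monomial ideals are the case where \<open>N\<close> is closed under supersets; the
  polynomial ring itself is the case where \<open>N\<close> always holds.
\<close>

definition mono_module :: "'v set \<Rightarrow> ('v set \<Rightarrow> bool) \<Rightarrow> ('v, 'k::field) mpoly set" where
  "mono_module V N = {p. \<forall>m\<in>keys p. keys m \<subseteq> V \<and> N (keys m)}"

lemma mono_module_True: "mono_module V (\<lambda>_. True) = poly_ring V"
  by (simp add: mono_module_def poly_ring_def)

text \<open>
  The signs of the Koszul complex need an order of the variables. The numbering \<open>pos\<close> may be
  defined on a larger set than \<open>V\<close>, so the same signs serve for all subsets of \<open>V\<close>.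
\<close>

locale vertex_order =
  fixes V :: "'v set" and pos :: "'v \<Rightarrow> nat"
  assumes finV: "finite V" and inj_pos: "inj_on pos V"
begin

definition pos_sign :: "'v set \<Rightarrow> 'v \<Rightarrow> 'k::field" where
  "pos_sign S v = (-1) ^ card {s\<in>S. pos s < pos v}"

lemma pos_sign_square: "pos_sign S v * pos_sign S v = (1 :: 'k::field)"
  by (simp add: pos_sign_def flip: power_mult_distrib)

lemma pos_sign_square': "pos_sign S v * (pos_sign S v * c) = (c :: 'k::field)"
  by (simp add: pos_sign_square flip: mult.assoc)

lemma pos_sign_insert:
  assumes "finite S" "w \<notin> S"
  shows "pos_sign (insert w S) v = (if pos w < pos v then - pos_sign S v else (pos_sign S v ::
      'k::field))"
proof (cases "pos w < pos v")
  case True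
  then have "{s \<in> insert w S. pos s < pos v} = insert w {s\<in>S. pos s < pos v}" by auto
  then show ?thesis using True assms by (simp add: pos_sign_def)
next
  case False
  then have "{s \<in> insert w S. pos s < pos v} = {s\<in>S. pos s < pos v}" by auto
  then show ?thesis using False by (simp add: pos_sign_def)
qed

text \<open>
  Exactly one of the two insertions changes a sign.
\<close>

lemma pos_sign_anti:
  assumes "finite S" "v \<notin> S" "w \<notin> S" "v \<noteq> w" "v \<in> V" "w \<in> V"
  shows "pos_sign (insert v S) w * pos_sign (insert w S) v = - (pos_sign S v * (pos_sign S w ::
      'k::field))"
proof -
  have "pos v \<noteq> pos w" using assms inj_pos by (auto dest: inj_onD)
  then show ?thesis using assms by (auto simp: pos_sign_insert)
qed

text \<open>
  The Koszul differential in one multidegree \<open>a\<close>: \<open>c S\<close> is the coefficient at \<open>e\<^sub>S\<close> of the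
  monomial with exponent \<open>a - 1\<^sub>S\<close>.
\<close>

definition koszul_bd :: "('v set \<Rightarrow> 'k::field) \<Rightarrow> 'v set \<Rightarrow> 'k" where
  "koszul_bd c S = (\<Sum>v\<in>V - S. pos_sign S v * c (insert v S))"

text \<open>
  Exterior multiplication by \<open>e\<^sub>v\<close> combined with division by \<open>x\<^sub>v\<close>, in one multidegree.
\<close>

definition koszul_htp :: "'v \<Rightarrow> ('v set \<Rightarrow> 'k::field) \<Rightarrow> 'v set \<Rightarrow> 'k" where
  "koszul_htp v c S = (if v \<in> S then pos_sign (S - {v}) v * c (S - {v}) else 0)"

text \<open>
  A contracting homotopy: if \<open>v \<notin> S\<close> only the summand of \<open>v\<close> survives in the first term and the
  second vanishes; if \<open>v \<in> S\<close> the terms other than \<open>c S\<close> cancel in pairs because exchanging two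
  insertions changes the sign.
\<close>

lemma koszul_bd_koszul_htp:
  assumes v: "v \<in> V" and S: "S \<subseteq> V"
  shows "koszul_bd (koszul_htp v c) S + koszul_htp v (koszul_bd c) S = (c S :: 'k::field)"
proof (cases "v \<in> S")
  case False
  have "koszul_bd (koszul_htp v c) S = pos_sign S v * koszul_htp v c (insert v S) + (\<Sum>w\<in>V - S - {v}.
      pos_sign S w * koszul_htp v c (insert w S))"
    unfolding koszul_bd_def using finV v False by (intro sum.remove) auto
  also have "(\<Sum>w\<in>V - S - {v}. pos_sign S w * koszul_htp v c (insert w S)) = 0"
    using False by (intro sum.neutral) (auto simp: koszul_htp_def)
  finally have "koszul_bd (koszul_htp v c) S = pos_sign S v * koszul_htp v c (insert v S)" by simp
  moreover have "pos_sign S v * koszul_htp v c (insert v S) = c S" "koszul_htp v (koszul_bd c) S =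
      0"
    using False by (simp_all add: koszul_htp_def pos_sign_square')
  ultimately show ?thesis by simp
next
  case True
  define S0 where "S0 = S - {v}"
  have S0: "S = insert v S0" "v \<notin> S0" "finite S0" "S0 \<subseteq> V"
    using True S finV finite_subset by (auto simp: S0_def)
  have "koszul_bd (koszul_htp v c) S = (\<Sum>w\<in>V - S. pos_sign S w * (pos_sign (insert w S0) v * c
      (insert w S0)))"
    unfolding koszul_bd_def
  proof (intro sum.cong refl)
    fix w assume w: "w \<in> V - S"
    then have "insert w S - {v} = insert w S0" using S0 by auto
    then show "pos_sign S w * koszul_htp v c (insert w S) = pos_sign S w * (pos_sign (insert w S0) v
        * c (insert w S0))"
      using True by (simp add: koszul_htp_def)
  qed
  also have "\<dots> = (\<Sum>w\<in>V - S. - (pos_sign S0 v * (pos_sign S0 w * c (insert w S0))))"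
  proof (intro sum.cong refl)
    fix w assume w: "w \<in> V - S"
    then have *: "pos_sign S w * pos_sign (insert w S0) v = - (pos_sign S0 v * (pos_sign S0 w ::
        'k))"
      unfolding S0(1) by (intro pos_sign_anti) (use S0 v w in auto)
    then show "pos_sign S w * (pos_sign (insert w S0) v * c (insert w S0)) = - (pos_sign S0 v *
        (pos_sign S0 w * c (insert w S0)))"
      by (simp only: mult.assoc[symmetric] * mult_minus_left)
  qed
  finally have 1: "koszul_bd (koszul_htp v c) S = - (\<Sum>w\<in>V - S. pos_sign S0 v * (pos_sign S0 w * c
      (insert w S0)))"
    by (simp add: sum_negf)
  have VS: "V - S0 = insert v (V - S)" using S0 v by auto
  have "koszul_bd c S0 = pos_sign S0 v * c S + (\<Sum>w\<in>V - S. pos_sign S0 w * c (insert w S0))"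
    unfolding koszul_bd_def VS using finV True S0(1) by (subst sum.insert) auto
  then have "koszul_htp v (koszul_bd c) S = c S + (\<Sum>w\<in>V - S. pos_sign S0 v * (pos_sign S0 w * c
      (insert w S0)))"
    using True by (simp add: koszul_htp_def S0_def[symmetric] distrib_left pos_sign_square'
        sum_distrib_left)
  with 1 show ?thesis by simp
qed

text \<open>
  The summands for \<open>(v, w)\<close> and \<open>(w, v)\<close> cancel. Summing over pairs with \<open>pos v < pos w\<close> avoids
  division by \<open>2\<close>, so that the argument is valid in every characteristic.
\<close>

lemma koszul_bd_koszul_bd:
  assumes S: "S \<subseteq> V"
  shows "koszul_bd (koszul_bd c) S = (0 :: 'k::field)"
proof -
  have finite_subsets_of_card: "finite S" using S finV finite_subset by blast
  define t where "t v w = pos_sign S v * (pos_sign (insert v S) w * c (insert w (insert v S)))"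
      for v w
  define P where "P = {(v, w). v \<in> V - S \<and> w \<in> V - S \<and> pos v < pos w}"
  have finP: "finite P"
    by (rule finite_subset[of _ "V \<times> V"]) (auto simp: P_def finV)
  have "koszul_bd (koszul_bd c) S = (\<Sum>v\<in>V - S. \<Sum>w\<in>V - insert v S. t v w)"
    by (simp add: koszul_bd_def sum_distrib_left t_def)
  also have "\<dots> = (\<Sum>(v, w)\<in>(SIGMA v:V - S. V - insert v S). t v w)"
    using finV by (simp add: sum.Sigma)
  also have "(SIGMA v:V - S. V - insert v S) = P \<union> prod.swap ` P"
  proof -
    have lt: "pos v < pos w \<or> pos w < pos v" if "v \<in> V" "w \<in> V" "v \<noteq> w" for v w
      using that inj_pos by (metis inj_onD linorder_neqE_nat)
    show ?thesis by (auto simp: P_def image_iff) (metis lt)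
  qed
  also have "(\<Sum>(v, w)\<in>P \<union> prod.swap ` P. t v w) = (\<Sum>(v, w)\<in>P. t v w) + (\<Sum>(v, w)\<in>prod.swap ` P. t v
      w)"
    using finP by (intro sum.union_disjoint) (auto simp: P_def)
  also have "(\<Sum>(v, w)\<in>prod.swap ` P. t v w) = (\<Sum>(v, w)\<in>P. t w v)"
    by (subst sum.reindex) (auto simp: case_prod_beta)
  also have "(\<Sum>(v, w)\<in>P. t v w) + (\<Sum>(v, w)\<in>P. t w v) = (\<Sum>(v, w)\<in>P. t v w + t w v)"
    by (simp add: sum.distrib case_prod_beta)
  also have "\<dots> = 0"
  proof (intro sum.neutral ballI)
    fix x assume "x \<in> P"
    then obtain v w where x: "x = (v, w)" "v \<in> V - S" "w \<in> V - S" "pos v < pos w"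
      by (auto simp: P_def)
    then have "pos_sign (insert v S) w = - (pos_sign S w :: 'k)" "pos_sign (insert w S) v =
        (pos_sign S v :: 'k)"
      using finite_subsets_of_card by (simp_all add: pos_sign_insert)
    then show "(case x of (v, w) \<Rightarrow> t v w + t w v) = 0"
      by (simp add: x(1) t_def insert_commute algebra_simps)
  qed
  finally show ?thesis .
qed

definition num_subsets :: "nat \<Rightarrow> nat" where "num_subsets i = card {S. S \<subseteq> V \<and> card S = i}"

text \<open>
  The basis of the Koszul module at position \<open>i\<close> consists of the \<open>i\<close>-element subsets; they are
  enumerated since the free modules have bases indexed by numbers.
\<close>

definition nth_subset :: "nat \<Rightarrow> nat \<Rightarrow> 'v set" where
  "nth_subset i = (SOME e. bij_betw e {..<num_subsets i} {S. S \<subseteq> V \<and> card S = i})"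

definition subset_index :: "nat \<Rightarrow> 'v set \<Rightarrow> nat" where
  "subset_index i = the_inv_into {..<num_subsets i} (nth_subset i)"

lemma finite_subsets_of_card: "finite {S. S \<subseteq> V \<and> card S = i}"
  using finV by (auto intro: finite_subset[of _ "Pow V"])

lemma nth_subset_bij: "bij_betw (nth_subset i) {..<num_subsets i} {S. S \<subseteq> V \<and> card S = i}"
proof -
  have "\<exists>e. bij_betw e {..<num_subsets i} {S. S \<subseteq> V \<and> card S = i}"
    using ex_bij_betw_nat_finite[OF finite_subsets_of_card[of i]] by (simp add: num_subsets_def
        lessThan_atLeast0)
  then show ?thesis unfolding nth_subset_def by (rule someI_ex)
qed

lemma nth_subset_sub: "b < num_subsets i \<Longrightarrow> nth_subset i b \<subseteq> V" and nth_subset_card: "b < num_subsets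
    i \<Longrightarrow> card (nth_subset i b) = i"
  using nth_subset_bij[of i] by (auto simp: bij_betw_def)

lemma nth_subset_fin: "b < num_subsets i \<Longrightarrow> finite (nth_subset i b)"
  using nth_subset_sub finV finite_subset by blast

lemma subset_index_less: "S \<subseteq> V \<Longrightarrow> card S = i \<Longrightarrow> subset_index i S < num_subsets i"
  and nth_subset_subset_index: "S \<subseteq> V \<Longrightarrow> card S = i \<Longrightarrow> nth_subset i (subset_index i S) = S"
  using nth_subset_bij[of i] unfolding subset_index_def bij_betw_def
  by (metis (mono_tags, lifting) lessThan_iff mem_Collect_eq order_refl the_inv_into_into
      f_the_inv_into_f)+

lemma subset_index_nth_subset: "b < num_subsets i \<Longrightarrow> subset_index i (nth_subset i b) = b"
  using nth_subset_bij[of i] unfolding subset_index_def bij_betw_def by (simp add: the_inv_into_f_f)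

definition koszul :: "('v, 'k::field) free_complex" where
  "koszul = \<lparr> rk = num_subsets, gdeg = (\<lambda>i b. i),
     mat = (\<lambda>i b c. \<Sum>v\<in>V. if v \<notin> nth_subset i c \<and> insert v (nth_subset i c) = nth_subset (Suc i) b
        then single (single v 1) (pos_sign (nth_subset i c) v) else 0),
     aug = (\<lambda>b. 1) \<rparr>"

lemma koszul_simps [simp]: "rk koszul = num_subsets" "gdeg koszul i b = i" "aug koszul b = 1"
  by (simp_all add: koszul_def)

text \<open>
  Coordinates indexed by multidegrees and subsets instead of basis numbers and exponents.
\<close>

definition kcoeff :: "nat \<Rightarrow> (nat \<Rightarrow> ('v, 'k::field) mpoly) \<Rightarrow> ('v \<Rightarrow>\<^sub>0 nat) \<Rightarrow> 'v set \<Rightarrow> 'k" where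
  "kcoeff i f a S = (if S \<subseteq> V \<and> card S = i \<and> S \<subseteq> keys a
     then lookup (f (subset_index i S)) (a - sqfree_monom S) else 0)"

lemma koszul_graded: "is_graded V (koszul :: ('v, 'k::field) free_complex)"
proof -
  have k: "\<exists>v\<in>V. m = single v 1"
    if m: "m \<in> keys (mat koszul i b c :: ('v, 'k) mpoly)" for m i b c
  proof -
    define g where "g v = (if v \<notin> nth_subset i c \<and> insert v (nth_subset i c) = nth_subset (Suc i) b
        then single (single v 1) (pos_sign (nth_subset i c) v) else (0 :: ('v, 'k) mpoly))" for v
    have "mat koszul i b c = sum g V" by (simp add: koszul_def g_def)
    then obtain v where "v \<in> V" "m \<in> keys (g v)"
      using m keys_sum_subset[of g V] by auto
    then show ?thesis by (auto simp: g_def split: if_splits)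
  qed
  have "keys m \<subseteq> V \<and> (\<forall>i. mdeg m + i = Suc i)"
    if "m \<in> keys (mat koszul i b c :: ('v, 'k) mpoly)" for m i b c
    using k[OF that] by (auto simp: mdeg_def)
  then show ?thesis unfolding is_graded_def poly_ring_def koszul_simps mem_Collect_eq by blast
qed

text \<open>
  In these coordinates the differential acts on every multidegree separately.
\<close>

lemma kcoeff_diff:
  assumes S: "S \<subseteq> V"
  shows "kcoeff i (diff koszul i f) a S = koszul_bd (kcoeff (Suc i) f a) S"
proof (cases "card S = i \<and> S \<subseteq> keys a")
  case False
  have "kcoeff (Suc i) f a (insert v S) = 0" if "v \<in> V - S" for v
    using that False S finV finite_subset[of S V] by (auto simp: kcoeff_def)
  then have "koszul_bd (kcoeff (Suc i) f a) S = 0" by (simp add: koszul_bd_def)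
  then show ?thesis using False by (auto simp: kcoeff_def)
next
  case True
  have finite_subsets_of_card: "finite S" using S finV finite_subset by blast
  define c where "c = subset_index i S"
  have c: "c < num_subsets i" "nth_subset i c = S" using True S by (simp_all add: c_def
      subset_index_less nth_subset_subset_index)
  have "diff koszul i f c = (\<Sum>b<num_subsets (Suc i). \<Sum>v\<in>V. if v \<notin> S \<and> insert v S = nth_subset (Suc
      i) b
        then f b * single (single v 1) (pos_sign S v) else 0)"
    by (simp add: diff_def koszul_def c sum_distrib_left if_distrib cong: if_cong)
  also have "\<dots> = (\<Sum>v\<in>V. \<Sum>b<num_subsets (Suc i). if v \<notin> S \<and> insert v S = nth_subset (Suc i) b
        then f b * single (single v 1) (pos_sign S v) else 0)"
    by (rule sum.swap)
  also have "\<dots> = (\<Sum>v\<in>V - S. f (subset_index (Suc i) (insert v S)) * single (single v 1) (pos_sign S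
      v))"
  proof -
    have 1: "(\<Sum>b<num_subsets (Suc i). if v \<notin> S \<and> insert v S = nth_subset (Suc i) b
        then f b * single (single v 1) (pos_sign S v) else 0) =
       (if v \<in> V - S then f (subset_index (Suc i) (insert v S)) * single (single v 1) (pos_sign S v)
           else 0)"
      if v: "v \<in> V" for v
    proof (cases "v \<in> S")
      case False
      have T: "insert v S \<subseteq> V" "card (insert v S) = Suc i" using v S True finite_subsets_of_card
          False by auto
      have "insert v S = nth_subset (Suc i) b \<longleftrightarrow> b = subset_index (Suc i) (insert v S)" if "b <
          num_subsets (Suc i)" for b
        using that T subset_index_nth_subset nth_subset_subset_index by metis
      then have "(\<Sum>b<num_subsets (Suc i). if v \<notin> S \<and> insert v S = nth_subset (Suc i) b
        then f b * single (single v 1) (pos_sign S v) else 0) =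
        (\<Sum>b<num_subsets (Suc i). if b = subset_index (Suc i) (insert v S)
        then f b * single (single v 1) (pos_sign S v) else 0)"
        using False by (intro sum.cong) auto
      also have "\<dots> = f (subset_index (Suc i) (insert v S)) * single (single v 1) (pos_sign S v)"
        using subset_index_less[OF T] by simp
      finally show ?thesis using False v by simp
    qed simp
    have "(\<Sum>v\<in>V. \<Sum>b<num_subsets (Suc i). if v \<notin> S \<and> insert v S = nth_subset (Suc i) b
        then f b * single (single v 1) (pos_sign S v) else 0) =
      (\<Sum>v\<in>V. if v \<in> V - S then f (subset_index (Suc i) (insert v S)) * single (single v 1) (pos_sign
          S v) else 0)"
      by (intro sum.cong refl 1)
    also have "\<dots> = (\<Sum>v\<in>V - S. f (subset_index (Suc i) (insert v S)) * single (single v 1) (pos_sign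
        S v))"
      by (rule sum.mono_neutral_cong_right) (use finV in auto)
    finally show ?thesis .
  qed
  finally have d: "diff koszul i f c = (\<Sum>v\<in>V - S. f (subset_index (Suc i) (insert v S)) * single
      (single v 1) (pos_sign S v))" .
  have "kcoeff i (diff koszul i f) a S = (\<Sum>v\<in>V - S. lookup
     (f (subset_index (Suc i) (insert v S)) * single (single v 1) (pos_sign S v)) (a - sqfree_monom
         S))"
    using True S by (simp add: kcoeff_def d flip: c_def) (simp add: lookup_sum)
  also have "\<dots> = koszul_bd (kcoeff (Suc i) f a) S"
    unfolding koszul_bd_def
  proof (intro sum.cong refl)
    fix v assume v: "v \<in> V - S"
    have "v \<in> keys (a - sqfree_monom S) \<longleftrightarrow> insert v S \<subseteq> keys a"
      using v finite_subsets_of_card True by (auto simp: in_keys_iff lookup_minus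
          lookup_sqfree_monom)
    moreover have "a - sqfree_monom S - single v 1 = a - sqfree_monom (insert v S)"
      using v finite_subsets_of_card by (simp add: sqfree_monom_def diff_diff_add add.commute)
    ultimately show "lookup
     (f (subset_index (Suc i) (insert v S)) * single (single v 1) (pos_sign S v)) (a - sqfree_monom
         S) =
      pos_sign S v * kcoeff (Suc i) f a (insert v S)"
      unfolding lookup_times_single using v S True finite_subsets_of_card by (simp add: kcoeff_def)
  qed
  finally show ?thesis .
qed

lemma kcoeff_zero_of_not: "\<not> (S \<subseteq> V \<and> card S = i \<and> S \<subseteq> keys a) \<Longrightarrow> kcoeff i f a S = 0"
  by (auto simp: kcoeff_def)

lemma lookup_eq_kcoeff:
  assumes "b < num_subsets i"
  shows "lookup (f b) m = kcoeff i f (m + sqfree_monom (nth_subset i b)) (nth_subset i b)"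
  using assms nth_subset_sub[OF assms] nth_subset_card[OF assms] nth_subset_fin[OF assms]
  by (simp add: kcoeff_def subset_index_nth_subset keys_plus_nat keys_sqfree_monom)

lemma kcoeff_inject:
  assumes f: "f \<in> copies (num_subsets i) M" and g: "g \<in> copies (num_subsets i) M'"
    and eq: "\<And>a S. S \<subseteq> V \<Longrightarrow> kcoeff i f a S = kcoeff i g a S"
  shows "f = g"
proof
  fix b
  show "f b = g b"
  proof (cases "b < num_subsets i")
    case True
    then show ?thesis by (intro poly_mapping_eqI) (simp add: lookup_eq_kcoeff eq nth_subset_sub)
  next
    case False
    then show ?thesis using f g by (simp add: copies_def)
  qed
qed

text \<open>
  At position \<open>0\<close> there is no outgoing differential, but \<open>koszul_bd\<close> vanishes too, as no
  nonempty set has \<open>0\<close> elements.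
\<close>

lemma cycle_koszul_bd_zero:
  assumes "i > 0 \<longrightarrow> diff koszul (i - 1) f = 0" "S \<subseteq> V"
  shows "koszul_bd (kcoeff i f a) S = 0"
proof (cases i)
  case 0
  have "kcoeff i f a (insert v S) = 0" for v
    using 0 assms(2) finV finite_subset[of "insert v S" V] by (auto simp: kcoeff_def)
  then show ?thesis by (simp add: koszul_bd_def)
next
  case (Suc l)
  have "koszul_bd (kcoeff (Suc l) f a) S = kcoeff l (diff koszul l f) a S"
    by (rule kcoeff_diff[OF assms(2), symmetric])
  also have "diff koszul l f = 0" using assms(1) Suc by simp
  also have "kcoeff l 0 a S = 0" by (simp add: kcoeff_def)
  finally show ?thesis using Suc by simp
qed

lemma mono_module_kcoeff:
  assumes "f \<in> copies (num_subsets i) (mono_module V N)" "kcoeff i f a S \<noteq> 0"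
  shows "S \<subseteq> V" "card S = i" "S \<subseteq> keys a" "keys a \<subseteq> V"
    "N (keys (a - sqfree_monom S))"
proof -
  show S: "S \<subseteq> V" "card S = i" "S \<subseteq> keys a"
    using assms(2) by (auto simp: kcoeff_def split: if_splits)
  have "a - sqfree_monom S \<in> keys (f (subset_index i S))"
    using assms(2) by (auto simp: kcoeff_def in_keys_iff split: if_splits)
  then have *: "keys (a - sqfree_monom S) \<subseteq> V \<and> N (keys (a - sqfree_monom S))"
    using assms(1) subset_index_less[OF S(1,2)] by (auto simp: copies_def mono_module_def)
  then show "N (keys (a - sqfree_monom S))" by simp
  have fS: "finite S" using S finV finite_subset by blast
  have "keys a = keys (a - sqfree_monom S + sqfree_monom S)"
    using minus_sqfree_monom_add[OF fS S(3)] by simp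
  then show "keys a \<subseteq> V" using * S(1) fS by (simp add: keys_plus_nat keys_sqfree_monom)
qed

lemma finite_kcoeff_support:
  "finite {a. \<exists>S. kcoeff i f a S \<noteq> 0}"
proof (rule finite_subset)
  show "{a. \<exists>S. kcoeff i f a S \<noteq> 0} \<subseteq>
    (\<Union>b<num_subsets i. (\<lambda>m. m + sqfree_monom (nth_subset i b)) ` keys (f b))"
  proof safe
    fix a S assume c: "kcoeff i f a S \<noteq> 0"
    then have S: "S \<subseteq> V" "card S = i" "S \<subseteq> keys a"
      by (auto simp: kcoeff_def split: if_splits)
    have "a - sqfree_monom S \<in> keys (f (subset_index i S))"
      using c by (auto simp: kcoeff_def in_keys_iff split: if_splits)
    moreover have "a = (a - sqfree_monom S) + sqfree_monom (nth_subset i (subset_index i S))"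
      using S finV finite_subset[of S V] by (simp add: nth_subset_subset_index
          minus_sqfree_monom_add)
    ultimately show "a \<in> (\<Union>b<num_subsets i. (\<lambda>m. m + sqfree_monom (nth_subset i b)) ` keys (f b))"
      using subset_index_less[OF S(1,2)] by blast
  qed
qed simp

text \<open>
  The inverse of \<open>kcoeff\<close>. It is meaningful only for coefficient functions of finite support.
\<close>

definition from_kcoeff :: "nat \<Rightarrow> (('v \<Rightarrow>\<^sub>0 nat) \<Rightarrow> 'v set \<Rightarrow> 'k::field) \<Rightarrow> nat \<Rightarrow> ('v, 'k) mpoly" where
  "from_kcoeff i c b = (if b < num_subsets i then Abs_poly_mapping (\<lambda>m. c (m + sqfree_monom
      (nth_subset i b)) (nth_subset i b)) else 0)"

lemma lookup_from_kcoeff: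
  assumes fin: "finite {a. \<exists>S. c a S \<noteq> 0}" and b: "b < num_subsets i"
  shows "lookup (from_kcoeff i c b) m = c (m + sqfree_monom (nth_subset i b)) (nth_subset i b)"
proof -
  have "finite ((\<lambda>m. m + sqfree_monom (nth_subset i b)) -` {a. \<exists>S. c a S \<noteq> 0})"
    by (rule finite_vimageI[OF fin]) (simp add: inj_on_def)
  then have "finite {m. c (m + sqfree_monom (nth_subset i b)) (nth_subset i b) \<noteq> 0}"
    by (rule finite_subset[rotated]) auto
  then show ?thesis using b by (simp add: from_kcoeff_def)
qed

lemma kcoeff_from_kcoeff:
  assumes fin: "finite {a. \<exists>S. c a S \<noteq> 0}"
  shows "kcoeff i (from_kcoeff i c) a S = (if S \<subseteq> V \<and> card S = i \<and> S \<subseteq> keys a then c a S else 0)"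
  using finite_subset[OF _ finV, of S]
  by (auto simp: kcoeff_def lookup_from_kcoeff[OF fin] subset_index_less nth_subset_subset_index
      minus_sqfree_monom_add)

lemma from_kcoeff_mono_module:
  assumes fin: "finite {a. \<exists>S. c a S \<noteq> 0}"
    and N: "\<And>a S. S \<subseteq> V \<Longrightarrow> card S = i \<Longrightarrow> S \<subseteq> keys a \<Longrightarrow> c a S \<noteq> 0 \<Longrightarrow>
       keys a \<subseteq> V \<and> N (keys (a - sqfree_monom S))"
  shows "from_kcoeff i c \<in> copies (num_subsets i) (mono_module V N)"
proof -
  have "keys m \<subseteq> V \<and> N (keys m)"
    if b: "b < num_subsets i" and m: "m \<in> keys (from_kcoeff i c b)" for b m
    using N[OF nth_subset_sub[OF b] nth_subset_card[OF b], of "m + sqfree_monom (nth_subset i b)"] m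
        nth_subset_fin[OF b]
    by (auto simp: in_keys_iff[of m] lookup_from_kcoeff[OF fin b] keys_plus_nat keys_sqfree_monom)
  then show ?thesis by (auto simp: copies_def mono_module_def) (simp add: from_kcoeff_def)
qed

lemma from_kcoeff_graded_part:
  assumes fin: "finite {a. \<exists>S. c a S \<noteq> 0}"
    and N: "from_kcoeff i c \<in> copies (num_subsets i) M"
    and d: "\<And>a S. c a S \<noteq> 0 \<Longrightarrow> mdeg a = j"
  shows "from_kcoeff i c \<in> graded_part M (num_subsets i) (\<lambda>b. i) j"
proof -
  have "mdeg m + i = j" if b: "b < num_subsets i" and m: "m \<in> keys (from_kcoeff i c b)" for b m
    using d[of "m + sqfree_monom (nth_subset i b)" "nth_subset i b"] m nth_subset_fin[OF b]
        nth_subset_card[OF b]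
    by (auto simp: in_keys_iff[of m] lookup_from_kcoeff[OF fin b] mdeg_add mdeg_sqfree_monom)
  then show ?thesis using N by (simp add: graded_part_def)
qed

lemma graded_part_kcoeff_degree:
  assumes f: "f \<in> graded_part M (num_subsets i) (\<lambda>b. i) j" and c: "kcoeff i f a S \<noteq> 0"
  shows "mdeg a = j"
proof -
  have S: "S \<subseteq> V" "card S = i" "S \<subseteq> keys a"
    using c by (auto simp: kcoeff_def split: if_splits)
  have fS: "finite S" using S finV finite_subset by blast
  have "a - sqfree_monom S \<in> keys (f (subset_index i S))"
    using c by (auto simp: kcoeff_def in_keys_iff split: if_splits)
  then have "mdeg (a - sqfree_monom S) + i = j"
    using f subset_index_less[OF S(1,2)] by (auto simp: graded_part_def)
  then show ?thesis
    using mdeg_add[of "a - sqfree_monom S" "sqfree_monom S"] minus_sqfree_monom_add[OF fS S(3)] S(2)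
        fS by (simp add: mdeg_sqfree_monom)
qed

text \<open>
  The contraction in direction \<open>v a\<close>, applied in the multidegrees \<open>a \<in> D\<close> only, shows that the
  part of a cycle in these multidegrees is a boundary. It divides the coefficient monomials by a
  variable, which keeps them in the ideal if there is no restriction on supports or if this
  variable has exponent at least \<open>2\<close> in the multidegree. The first case gives exactness of the
  Koszul complex, the second one the reduction to squarefree multidegrees.
\<close>

lemma koszul_homotopy:
  fixes f :: "nat \<Rightarrow> ('v, 'k::field) mpoly"
  assumes f: "f \<in> copies (num_subsets i) (mono_module V N)"
    and cyc: "i > 0 \<longrightarrow> diff koszul (i - 1) f = 0"
    and v: "\<And>a. a \<in> D \<Longrightarrow> v a \<in> keys a"
    and N: "(\<forall>A. N A) \<or> (\<forall>a\<in>D. lookup a (v a) \<ge> 2)"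
  shows "\<exists>g. g \<in> copies (num_subsets (Suc i)) (mono_module V N) \<and>
    (\<forall>a. \<forall>S\<subseteq>V. kcoeff i (diff koszul i g) a S = (if a \<in> D then kcoeff i f a S else 0)) \<and>
    (\<forall>j. f \<in> graded_part (mono_module V N) (num_subsets i) (\<lambda>b. i) j \<longrightarrow>
           g \<in> graded_part (mono_module V N) (num_subsets (Suc i)) (\<lambda>b. Suc i) j)"
proof -
  define c where "c a S = (if a \<in> D then koszul_htp (v a) (kcoeff i f a) S else 0)" for a S
  define g where "g = from_kcoeff (Suc i) c"
  have cD: "a \<in> D \<and> v a \<in> S \<and> kcoeff i f a (S - {v a}) \<noteq> 0" if "c a S \<noteq> 0" for a S
    using that by (auto simp: c_def koszul_htp_def split: if_splits)
  have fin: "finite {a. \<exists>S. c a S \<noteq> 0}"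
    by (rule finite_subset[OF _ finite_kcoeff_support[of i f]]) (use cD in auto)
  have gm: "g \<in> copies (num_subsets (Suc i)) (mono_module V N)"
    unfolding g_def
  proof (rule from_kcoeff_mono_module[OF fin])
    fix a S assume S: "S \<subseteq> V" "S \<subseteq> keys a" and c: "c a S \<noteq> 0"
    have fS: "finite S" using S finV finite_subset by blast
    note * = mono_module_kcoeff[OF f conjunct2[OF conjunct2[OF cD[OF c]]]]
    have "N (keys (a - sqfree_monom S))"
    proof (cases "\<forall>A. N A")
      case False
      then have "lookup a (v a) \<ge> 2" using N cD[OF c] by blast
      then have "keys (a - sqfree_monom S) = keys (a - sqfree_monom (S - {v a}))"
        using fS by (auto simp: in_keys_iff lookup_minus lookup_sqfree_monom split: if_splits)
      then show ?thesis using *(5) by simp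
    qed simp
    then show "keys a \<subseteq> V \<and> N (keys (a - sqfree_monom S))" using *(4) by simp
  qed
  have "kcoeff i (diff koszul i g) a S = (if a \<in> D then kcoeff i f a S else 0)" if S: "S \<subseteq> V" for a
      S
  proof (cases "a \<in> D \<and> v a \<in> V")
    case True
    have "kcoeff (Suc i) g a T = koszul_htp (v a) (kcoeff i f a) T" if T: "T \<subseteq> V" for T
    proof -
      have "koszul_htp (v a) (kcoeff i f a) T = 0" if "\<not> (card T = Suc i \<and> T \<subseteq> keys a)"
      proof (rule ccontr)
        assume "koszul_htp (v a) (kcoeff i f a) T \<noteq> 0"
        then have "v a \<in> T" "card (T - {v a}) = i" "T - {v a} \<subseteq> keys a"
          by (auto simp: koszul_htp_def kcoeff_def split: if_splits)
        moreover have "finite T" using T finV finite_subset by blast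
        ultimately show False using that v[of a] True card_Suc_Diff1[of T "v a"] by auto
      qed
      then show ?thesis using True T by (auto simp: g_def kcoeff_from_kcoeff[OF fin] c_def)
    qed
    then have "kcoeff i (diff koszul i g) a S = koszul_bd (koszul_htp (v a) (kcoeff i f a)) S"
      using S True unfolding kcoeff_diff[OF S] koszul_bd_def by (intro sum.cong) auto
    also have "\<dots> = kcoeff i f a S - koszul_htp (v a) (koszul_bd (kcoeff i f a)) S"
      using koszul_bd_koszul_htp[OF _ S, of "v a" "kcoeff i f a"] True by (simp add: algebra_simps)
    also have "koszul_htp (v a) (koszul_bd (kcoeff i f a)) S = 0"
      using cycle_koszul_bd_zero[OF cyc, of "S - {v a}" a] S by (auto simp: koszul_htp_def)
    finally show ?thesis using True by simp
  next
    case False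
    have "kcoeff i f a S = 0" if "a \<in> D" "v a \<notin> V"
      using that v[of a] mono_module_kcoeff(4)[OF f, of a S] by blast
    moreover have "kcoeff (Suc i) g a T = 0" for T
      using False v[of a] mono_module_kcoeff(3,4)[OF gm, of a T] cD[of a T]
      by (auto simp: g_def kcoeff_from_kcoeff[OF fin])
    ultimately show ?thesis using False by (auto simp: kcoeff_diff[OF S] koszul_bd_def)
  qed
  moreover have "g \<in> graded_part (mono_module V N) (num_subsets (Suc i)) (\<lambda>b. Suc i) j"
    if j: "f \<in> graded_part (mono_module V N) (num_subsets i) (\<lambda>b. i) j" for j
    unfolding g_def
    by (rule from_kcoeff_graded_part[OF fin gm[unfolded g_def]]) (rule
        graded_part_kcoeff_degree[OF j], use cD in blast)
  ultimately show ?thesis using gm by (intro exI[of _ g] conjI allI impI)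
qed

end

section \<open>Betti numbers from any resolution\<close>

lemma sum_fun_apply: "(\<Sum>x\<in>A. f x) c = (\<Sum>x\<in>A. f x c)"
  for f :: "'a \<Rightarrow> 'b \<Rightarrow> 'c::comm_monoid_add"
  by (induction A rule: infinite_finite_induct) auto

lemma finite_monomials_le:
  assumes "finite V"
  shows "finite {m :: 'v \<Rightarrow>\<^sub>0 nat. keys m \<subseteq> V \<and> mdeg m \<le> j}"
proof (rule finite_imageD[where f = lookup])
  have "lookup m v \<le> mdeg m" for m :: "'v \<Rightarrow>\<^sub>0 nat" and v
    unfolding mdeg_def by (cases "v \<in> keys m") (auto intro: member_le_sum simp: in_keys_iff)
  then show "finite (lookup ` {m :: 'v \<Rightarrow>\<^sub>0 nat. keys m \<subseteq> V \<and> mdeg m \<le> j})"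
    by (intro finite_subset[OF _ finite_set_of_finite_funs[OF assms finite_atMost[of j], of 0]])
      (auto simp: in_keys_iff intro: order_trans)
  show "inj_on lookup {m :: 'v \<Rightarrow>\<^sub>0 nat. keys m \<subseteq> V \<and> mdeg m \<le> j}"
    by (auto simp: inj_on_def)
qed

text \<open>
  There are finitely many monomials of bounded degree in finitely many variables.
\<close>

lemma graded_part_finite_span:
  fixes M :: "('v, 'k::field) mpoly set"
  assumes V: "finite V" and M: "is_ideal V M"
  obtains A where "finite A" "graded_part M n dn j \<subseteq> module.span scale A"
proof -
  interpret vector_space "scale :: 'k \<Rightarrow> (nat \<Rightarrow> ('v, 'k) mpoly) \<Rightarrow> nat \<Rightarrow> ('v, 'k) mpoly"
    by (rule vector_space_scale)
  define e :: "nat \<Rightarrow> ('v \<Rightarrow>\<^sub>0 nat) \<Rightarrow> nat \<Rightarrow> ('v, 'k) mpoly"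
    where "e b m = (\<lambda>c. if c = b then single m 1 else 0)" for b m
  define A where "A = (\<lambda>(b, m). e b m) ` ({..<n} \<times> {m. keys m \<subseteq> V \<and> mdeg m \<le> j})"
  have "graded_part M n dn j \<subseteq> span A"
  proof
    fix f assume f: "f \<in> graded_part M n dn j"
    have eA: "e b m \<in> A" if "b < n" "m \<in> keys (f b)" for b m
    proof -
      have "f b \<in> poly_ring V" using f that(1) ideal_subset[OF M] by (auto simp: graded_part_def
          copies_def)
      then have "keys m \<subseteq> V" using that(2) by (auto simp: poly_ring_def)
      moreover have "mdeg m + dn b = j" using f that by (auto simp: graded_part_def)
      ultimately show ?thesis using that(1) unfolding A_def by auto
    qed
    have "f = (\<Sum>b<n. \<Sum>m\<in>keys (f b). scale (lookup (f b) m) (e b m))"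
    proof
      fix c
      have "(\<Sum>b<n. \<Sum>m\<in>keys (f b). scale (lookup (f b) m) (e b m)) c =
        (\<Sum>b<n. if b = c then \<Sum>m\<in>keys (f b). single m (lookup (f b) m) else 0)"
        unfolding sum_fun_apply by (intro sum.cong) (auto simp: scale_def e_def mult_single)
      also have "\<dots> = (if c < n then trunc (\<lambda>_. True) (f c) else 0)"
        by (simp add: trunc_def)
      also have "\<dots> = f c"
        using f by (auto simp: trunc_id graded_part_def copies_def)
      finally show "f c = (\<Sum>b<n. \<Sum>m\<in>keys (f b). scale (lookup (f b) m) (e b m)) c"
        by simp
    qed
    also have "\<dots> \<in> span A"
      by (intro span_sum span_scale span_base eA) auto
    finally show "f \<in> span A" .
  qed
  moreover have "finite A" unfolding A_def using finite_monomials_le[OF V] by blast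
  ultimately show thesis using that by blast
qed

lemma tor_dim_indep_mod:
  fixes M :: "('v, 'k::field) mpoly set"
  assumes V: "finite V" and M: "is_ideal V M" and F: "resolves_field V F"
  shows "n \<le> tor_dim F M i j \<longleftrightarrow> indep_mod scale n (tor_cycles F M i j) (tor_boundaries F M i j)"
proof -
  interpret vs: vector_space "scale :: 'k \<Rightarrow> (nat \<Rightarrow> ('v, 'k) mpoly) \<Rightarrow> nat \<Rightarrow> ('v, 'k) mpoly"
    by (rule vector_space_scale)
  obtain A where A: "finite A" "graded_part M (rk F i) (gdeg F i) j \<subseteq> vs.span A"
    using graded_part_finite_span[OF V M] .
  have s0: "diff F (i - 1) (scale c x) = 0" if "diff F (i - 1) x = 0" for c x
    unfolding module_map_scale[OF module_map_diff_map] that by (simp add: scale_def zero_fun_def)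
  have Z: "vs.subspace (tor_cycles F M i j)"
    unfolding vs.subspace_def tor_cycles_eq
    using s0 by (auto simp only: mem_Collect_eq graded_part_zero[OF M] graded_part_add[OF M]
        graded_part_scale[OF M]
        module_map_zero[OF module_map_diff_map] module_map_add[OF module_map_diff_map] add_0)
  have B: "vs.subspace (tor_boundaries F M i j)"
    unfolding vs.subspace_def tor_boundaries_def tensor_part_eq
  proof (intro conjI ballI allI)
    show "0 \<in> diff F i ` graded_part M (rk F (Suc i)) (gdeg F (Suc i)) j"
      using graded_part_zero[OF M] module_map_zero[OF module_map_diff_map] by (metis imageI)
  next
    fix x y assume "x \<in> diff F i ` graded_part M (rk F (Suc i)) (gdeg F (Suc i)) j"
      "y \<in> diff F i ` graded_part M (rk F (Suc i)) (gdeg F (Suc i)) j"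
    then show "x + y \<in> diff F i ` graded_part M (rk F (Suc i)) (gdeg F (Suc i)) j"
      by (auto simp only: module_map_add[OF module_map_diff_map, symmetric] intro!: imageI
          graded_part_add[OF M])
  next
    fix c x assume "x \<in> diff F i ` graded_part M (rk F (Suc i)) (gdeg F (Suc i)) j"
    then show "scale c x \<in> diff F i ` graded_part M (rk F (Suc i)) (gdeg F (Suc i)) j"
      by (auto simp only: module_map_scale[OF module_map_diff_map, symmetric] intro!: imageI
          graded_part_scale[OF M])
  qed
  have BZ: "tor_boundaries F M i j \<subseteq> tor_cycles F M i j"
  proof
    fix y assume "y \<in> tor_boundaries F M i j"
    then obtain x where x: "x \<in> graded_part M (rk F (Suc i)) (gdeg F (Suc i)) j" "y = diff F i x"
      by (auto simp: tor_boundaries_def tensor_part_eq)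
    have "diff F i x \<in> graded_part M (rk F i) (gdeg F i) j"
      unfolding diff_eq_mat_apply by (rule mat_apply_graded_part[OF M x(1)
          resolves_graded_matrix[OF F]])
    moreover have "augmented_cycle F i (diff F i x)"
      by (rule resolves_diff_zero[OF F graded_part_copies[OF graded_part_mono[OF M x(1)]]])
    then have "i > 0 \<longrightarrow> diff F (i - 1) (diff F i x) = 0"
      by (cases i) (simp_all add: augmented_cycle_def)
    ultimately show "y \<in> tor_cycles F M i j" using x(2) by (simp only: tor_cycles_eq mem_Collect_eq)
  qed
  have "tor_cycles F M i j \<subseteq> vs.span A" using A(2) by (auto simp: tor_cycles_eq)
  from vs.indep_mod_iff_dim[OF Z B BZ A(1) this, of n] show ?thesis
    by (simp add: tor_dim_def kdim_def)
qed

lemma betti_indep_mod: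
  fixes M :: "('v, 'k::field) mpoly set"
  assumes V: "finite V" and M: "is_ideal V M" and F: "resolves_field V F"
  shows "n \<le> betti V M i j \<longleftrightarrow> indep_mod scale n (tor_cycles F M i j) (tor_boundaries F M i j)"
proof -
  define G :: "('v, 'k) free_complex" where "G = (SOME F. resolves_field V F)"
  have G: "resolves_field V G" unfolding G_def using F by (rule someI)
  show ?thesis
    using tor_dim_indep_mod[OF V M G] tor_indep_mod_le[OF F G M] tor_indep_mod_le[OF G F M]
    unfolding betti_def G_def[symmetric] by blast
qed

context vertex_order
begin

lemma koszul_gdeg: "gdeg koszul i = (\<lambda>b. i)"
  by (simp add: fun_eq_iff)

lemma koszul_graded_matrix: "graded_matrix V (num_subsets (Suc i)) (gdeg koszul (Suc i)) (mat koszul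
    i) (num_subsets i) (gdeg koszul i)"
  using koszul_graded unfolding is_graded_def graded_matrix_def koszul_simps by blast

lemma koszul_diff_copies:
  assumes "is_ideal V M" "f \<in> copies (num_subsets (Suc i)) M"
  shows "diff koszul i f \<in> copies (num_subsets i) M"
  using mat_apply_copies[OF assms koszul_graded_matrix] by (simp add: diff_eq_mat_apply)

lemma num_subsets_zero: "num_subsets 0 = 1" and nth_subset_zero: "nth_subset 0 0 = {}"
proof -
  have "{S. S \<subseteq> V \<and> card S = 0} = {{}}"
    using finV finite_subset by (auto simp: card_eq_0_iff)
  then show "num_subsets 0 = 1" by (simp add: num_subsets_def)
  then show "nth_subset 0 0 = {}"
    using nth_subset_card[of 0 0] nth_subset_fin[of 0 0] by simp
qed

lemma koszul_augment: "augment koszul f = kcoeff 0 f 0 {}"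
  using lookup_eq_kcoeff[of 0 0 f 0] by (simp add: augment_def num_subsets_zero nth_subset_zero
      sqfree_monom_def)

lemma koszul_diff_diff: 
  assumes "f \<in> copies (num_subsets (Suc (Suc i))) (poly_ring V)"
  shows "diff koszul i (diff koszul (Suc i) f) = 0"
proof (rule kcoeff_inject[where i = i])
  show "diff koszul i (diff koszul (Suc i) f) \<in> copies (num_subsets i) (poly_ring V)"
    by (intro koszul_diff_copies is_ideal_poly_ring assms)
  show "0 \<in> copies (num_subsets i) (poly_ring V)" by (simp add: copies_def)
  fix a S assume S: "S \<subseteq> V"
  have "kcoeff i (diff koszul i (diff koszul (Suc i) f)) a S = koszul_bd (kcoeff (Suc i) (diff
      koszul (Suc i) f) a) S"
    by (rule kcoeff_diff[OF S])
  also have "\<dots> = koszul_bd (koszul_bd (kcoeff (Suc (Suc i)) f a)) S"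
    unfolding koszul_bd_def[of "kcoeff (Suc i) (diff koszul (Suc i) f) a"]
        koszul_bd_def[of "koszul_bd (kcoeff (Suc (Suc i)) f a)"]
    using S by (intro sum.cong) (auto simp: kcoeff_diff)
  finally show "kcoeff i (diff koszul i (diff koszul (Suc i) f)) a S = kcoeff i 0 a S"
    using S by (simp add: koszul_bd_koszul_bd kcoeff_def)
qed

text \<open>
  In multidegree \<open>0\<close> only \<open>S = {}\<close> is possible; the condition on the augmentation takes care of
  it. Every other multidegree involves some variable, which gives a contraction.
\<close>

lemma koszul_exact:
  fixes f :: "nat \<Rightarrow> ('v, 'k::field) mpoly"
  assumes f: "f \<in> copies (num_subsets i) (poly_ring V)"
    and cyc: "i > 0 \<longrightarrow> diff koszul (i - 1) f = 0" and aug: "i = 0 \<longrightarrow> augment koszul f = 0"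
  shows "f \<in> diff koszul i ` copies (num_subsets (Suc i)) (poly_ring V)"
proof -
  define v where "v a = (SOME v. v \<in> keys a)" for a :: "'v \<Rightarrow>\<^sub>0 nat"
  have v: "v a \<in> keys a" if "a \<in> - {0}" for a
    unfolding v_def using that by (intro someI_ex[of "\<lambda>v. v \<in> keys a"]) (simp add: ex_in_conv)
  obtain g where g: "g \<in> copies (num_subsets (Suc i)) (poly_ring V)"
    "\<And>a S. S \<subseteq> V \<Longrightarrow> kcoeff i (diff koszul i g) a S = (if a \<in> - {0} then kcoeff i f a S else 0)"
    using koszul_homotopy[where N = "\<lambda>_. True" and D = "- {0}" and v = v, unfolded mono_module_True,
        OF f cyc v]
    by auto
  have "diff koszul i g = f"
  proof (rule kcoeff_inject[OF koszul_diff_copies[OF is_ideal_poly_ring g(1)] f])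
    fix a S assume S: "S \<subseteq> V"
    have "kcoeff i f 0 S = 0"
      using aug by (cases "S = {}"; cases i) (simp_all add: kcoeff_zero_of_not koszul_augment)
    then show "kcoeff i (diff koszul i g) a S = kcoeff i f a S" using g(2)[OF S, of a] by auto
  qed
  then show ?thesis using g(1) by blast
qed

lemma koszul_resolves: "resolves_field V (koszul :: ('v, 'k::field) free_complex)"
  unfolding resolves_field_def koszul_simps
proof (intro conjI allI)
  let ?R = "poly_ring V :: ('v, 'k) mpoly set"
  have I: "is_ideal V ?R" by (rule is_ideal_poly_ring)
  show "is_graded V (koszul :: ('v, 'k) free_complex)" by (rule koszul_graded)
  show "augment koszul ` copies (num_subsets 0) ?R = UNIV"
  proof (intro set_eqI iffI UNIV_I)
    fix x :: 'k
    have "augment koszul (\<lambda>b. if b = 0 then single 0 x else 0) = x"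
      by (simp add: augment_def num_subsets_zero)
    moreover have "(\<lambda>b. if b = 0 then single 0 x else 0) \<in> copies (num_subsets 0) ?R"
      by (simp add: copies_def num_subsets_zero poly_ring_const)
    ultimately show "x \<in> augment koszul ` copies (num_subsets 0) ?R" by (rule image_eqI[OF sym])
  qed
  show "diff koszul 0 ` copies (num_subsets 1) ?R = {f \<in> copies (num_subsets 0) ?R. augment koszul f
      = 0}"
  proof (intro set_eqI iffI)
    fix f assume "f \<in> diff koszul 0 ` copies (num_subsets 1) ?R"
    then obtain g where g: "g \<in> copies (num_subsets 1) ?R" "f = diff koszul 0 g" by blast
    have "kcoeff (Suc 0) g 0 {v} = 0" for v by (simp add: kcoeff_def)
    then have "augment koszul f = 0"
      by (simp add: g(2) koszul_augment kcoeff_diff koszul_bd_def)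
    then show "f \<in> {f \<in> copies (num_subsets 0) ?R. augment koszul f = 0}"
      using koszul_diff_copies[OF I, of g 0] g by simp
  qed (use koszul_exact[of _ 0] in auto)
  show "diff koszul (Suc i) ` copies (num_subsets (i + 2)) ?R = {f \<in> copies (num_subsets (i + 1))
      ?R. diff koszul i f = 0}" for i
    using koszul_exact[of _ "Suc i"] koszul_diff_copies[OF I, of _ "Suc i"] koszul_diff_diff[of _ i]
    by (auto simp only: add_2_eq_Suc' Suc_eq_plus1[symmetric] diff_Suc_1 mem_Collect_eq)
qed

section \<open>Squarefree multidegrees and simplicial cochains\<close>

text \<open>
  A family, indexed by \<open>W\<close>, of functions on the subsets \<open>U\<close> of \<open>W\<close> that satisfy \<open>N\<close>. It encodes
  the squarefree part of the Koszul complex with coefficients in \<open>mono_module X N\<close>: the pair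
  \<open>(W, U)\<close> stands for the multidegree \<open>1\<^sub>W\<close>, the basis element for \<open>W - U\<close> and the coefficient
  monomial with support \<open>U\<close>. The size of \<open>U\<close> is \<open>j - i\<close>, expressed without a subtraction that
  could be truncated.
\<close>

definition cochains :: "'v set \<Rightarrow> ('v set \<Rightarrow> bool) \<Rightarrow> nat \<Rightarrow> nat \<Rightarrow> ('v set \<Rightarrow> 'v set \<Rightarrow> 'k::field)
    set" where
  "cochains X N i j = {f. \<forall>W U. f W U \<noteq> 0 \<longrightarrow>
     U \<subseteq> W \<and> W \<subseteq> X \<and> card W = j \<and> card (W - U) = i \<and> N U}"

lemma cochainsD:
  assumes "f \<in> cochains X N i j" "f W U \<noteq> 0"
  shows "U \<subseteq> W \<and> W \<subseteq> X \<and> card W = j \<and> card (W - U) = i \<and> N U"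
  using assms by (simp add: cochains_def)

lemma cochainsI:
  assumes "\<And>W U. f W U \<noteq> 0 \<Longrightarrow> U \<subseteq> W \<and> W \<subseteq> X \<and> card W = j \<and> card (W - U) = i \<and> N U"
  shows "f \<in> cochains X N i j"
  unfolding cochains_def using assms by (intro CollectI allI impI)

text \<open>
  The simplicial coboundary, with functions on \<open>n\<close>-sets in place of \<open>(n - 1)\<close>-dimensional
  cochains.
\<close>

definition cobd :: "('v set \<Rightarrow> 'k::field) \<Rightarrow> 'v set \<Rightarrow> 'k" where
  "cobd f U = (\<Sum>v\<in>U. pos_sign U v * f (U - {v}))"

text \<open>
  The coboundary of a family. It is cut off because \<open>cobd (f W)\<close> need not vanish at sets that
  are not contained in \<open>W\<close>.
\<close>

definition delta :: "('v set \<Rightarrow> 'v set \<Rightarrow> 'k::field) \<Rightarrow> 'v set \<Rightarrow> 'v set \<Rightarrow> 'k" where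
  "delta f W U = (if U \<subseteq> W then cobd (f W) U else 0)"

text \<open>
  The Koszul signs refer to positions in \<open>W - U\<close>, those of the coboundary to positions in \<open>U\<close>.
  Their product refers to positions in \<open>W\<close>; \<open>resign\<close> absorbs it, and the resulting coboundary
  does not depend on \<open>W\<close>.
\<close>

definition resign :: "'v set \<Rightarrow> 'v set \<Rightarrow> 'k::field" where
  "resign W U = (\<Prod>s\<in>U. pos_sign W s)"

definition scale_fun :: "'k::field \<Rightarrow> ('v set \<Rightarrow> 'v set \<Rightarrow> 'k) \<Rightarrow> 'v set \<Rightarrow> 'v set \<Rightarrow> 'k" where
  "scale_fun k f = (\<lambda>W U. k * f W U)"

definition sqfree_part :: "nat \<Rightarrow> (nat \<Rightarrow> ('v, 'k::field) mpoly) \<Rightarrow> 'v set \<Rightarrow> 'v set \<Rightarrow> 'k" where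
  "sqfree_part i f W U = (if U \<subseteq> W \<and> W \<subseteq> V then resign W U * kcoeff i f (sqfree_monom W) (W - U)
      else 0)"

text \<open>
  The Koszul chain with prescribed squarefree part and no components in other multidegrees; a
  multidegree is squarefree if it is determined by its support.
\<close>

definition sqfree_lift :: "nat \<Rightarrow> ('v set \<Rightarrow> 'v set \<Rightarrow> 'k::field) \<Rightarrow> nat \<Rightarrow> ('v, 'k) mpoly" where
  "sqfree_lift i f = from_kcoeff i (\<lambda>a S. let W = keys a in
     if W \<subseteq> V \<and> a = sqfree_monom W \<and> S \<subseteq> W then resign W (W - S) * f W (W - S) else 0)"

lemma resign_square: "resign W U * resign W U = (1 :: 'k::field)"
  by (simp add: resign_def pos_sign_square flip: prod.distrib)

lemma resign_square': "resign W U * (resign W U * c) = (c :: 'k::field)"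
  by (simp add: resign_square flip: mult.assoc)

lemma resign_nonzero: "resign W U \<noteq> (0 :: 'k::field)"
  using resign_square[of W U, where ?'k = 'k] by auto

lemma pos_sign_split:
  assumes "finite W" "U \<subseteq> W"
  shows "pos_sign W v = pos_sign U v * (pos_sign (W - U) v :: 'k::field)"
proof -
  have "finite U" using assms finite_subset by blast
  have "{s\<in>W. pos s < pos v} = {s\<in>U. pos s < pos v} \<union> {s\<in>W - U. pos s < pos v}" using assms by auto
  moreover have "card ({s\<in>U. pos s < pos v} \<union> {s\<in>W - U. pos s < pos v}) =
      card {s\<in>U. pos s < pos v} + card {s\<in>W - U. pos s < pos v}"
    using assms \<open>finite U\<close> by (intro card_Un_disjoint) auto
  ultimately show ?thesis by (simp add: pos_sign_def power_add)
qed

lemma resign_remove: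
  assumes W: "finite W" "U \<subseteq> W" and v: "v \<in> U"
  shows "resign W U * pos_sign (W - U) v = resign W (U - {v}) * (pos_sign U v :: 'k::field)"
proof -
  have "resign W U = pos_sign W v * (resign W (U - {v}) :: 'k)"
    unfolding resign_def using W v finite_subset by (intro prod.remove) auto
  then show ?thesis
    using pos_sign_square[of "W - U" v, where ?'k = 'k] by (simp add: pos_sign_split[OF W]
        algebra_simps)
qed

lemma cobd_cong:
  assumes "\<And>v. v \<in> U \<Longrightarrow> f (U - {v}) = g (U - {v})"
  shows "cobd f U = cobd g U"
  unfolding cobd_def using assms by (intro sum.cong) auto

text \<open>
  Passing to complements in \<open>W\<close> turns the Koszul differential into the coboundary.
\<close>

lemma koszul_bd_complement:
  assumes W: "U \<subseteq> W" "W \<subseteq> V" and c: "\<And>S. \<not> S \<subseteq> W \<Longrightarrow> c S = 0"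
  shows "resign W U * koszul_bd c (W - U) = (cobd (\<lambda>U. resign W U * c (W - U)) U :: 'k::field)"
proof -
  have fW: "finite W" using W(2) finV finite_subset by blast
  have c': "S \<subseteq> W" if "c S \<noteq> 0" for S
    using c that by blast
  have "koszul_bd c (W - U) = (\<Sum>v\<in>U. pos_sign (W - U) v * c (insert v (W - U)))"
    unfolding koszul_bd_def using finV W c' by (intro sum.mono_neutral_right) auto
  then have "resign W U * koszul_bd c (W - U) = (\<Sum>v\<in>U. resign W U * pos_sign (W - U) v * c (insert v
      (W - U)))"
    by (simp add: sum_distrib_left mult.assoc)
  also have "\<dots> = (\<Sum>v\<in>U. pos_sign U v * (resign W (U - {v}) * c (W - (U - {v}))))"
  proof (intro sum.cong refl)
    fix v assume v: "v \<in> U"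
    have "insert v (W - U) = W - (U - {v})" using v W by auto
    then show "resign W U * pos_sign (W - U) v * c (insert v (W - U)) = pos_sign U v * (resign W (U
        - {v}) * c (W - (U - {v})))"
      unfolding resign_remove[OF fW W(1) v] by (simp add: algebra_simps)
  qed
  finally show ?thesis by (simp add: cobd_def)
qed

lemma delta_sqfree_part:
  assumes W: "U \<subseteq> W" "W \<subseteq> V"
  shows "delta (sqfree_part i f) W U = resign W U * koszul_bd (kcoeff i f (sqfree_monom W)) (W - U)"
proof -
  have "finite W" using W(2) finV finite_subset by blast
  then have "resign W U * koszul_bd (kcoeff i f (sqfree_monom W)) (W - U) =
      cobd (\<lambda>U. resign W U * kcoeff i f (sqfree_monom W) (W - U)) U"
    by (intro koszul_bd_complement[OF W]) (auto simp: kcoeff_def keys_sqfree_monom)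
  also have "\<dots> = cobd (sqfree_part i f W) U"
    by (rule cobd_cong) (use W in \<open>auto simp: sqfree_part_def\<close>)
  finally show ?thesis using W by (simp add: delta_def)
qed

lemma cobd_transport:
  fixes f :: "'v set \<Rightarrow> 'k::field"
  assumes U: "U \<subseteq> V"
  shows "cobd f U = resign V U * koszul_bd (\<lambda>S. if S \<subseteq> V then resign V (V - S) * f (V - S) else 0)
      (V - U)"
proof -
  have "cobd f U = cobd (\<lambda>U. resign V U * (if V - U \<subseteq> V then resign V (V - (V - U)) * f (V - (V -
      U)) else 0)) U"
  proof (rule cobd_cong)
    fix v assume "v \<in> U"
    have "V - (V - (U - {v})) = U - {v}" using U by auto
    then show "f (U - {v}) = resign V (U - {v}) * (if V - (U - {v}) \<subseteq> V
      then resign V (V - (V - (U - {v}))) * f (V - (V - (U - {v}))) else 0)"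
      by (simp add: resign_square')
  qed
  then show ?thesis by (subst koszul_bd_complement[OF U order_refl]) auto
qed

lemma koszul_bd_cong:
  assumes "\<And>v. v \<in> V - S \<Longrightarrow> f (insert v S) = g (insert v S)"
  shows "koszul_bd f S = koszul_bd g S"
  unfolding koszul_bd_def using assms by (intro sum.cong) auto

lemma cobd_cobd:
  fixes f :: "'v set \<Rightarrow> 'k::field"
  assumes U: "U \<subseteq> V"
  shows "cobd (cobd f) U = 0"
proof -
  define c where "c = (\<lambda>S. if S \<subseteq> V then resign V (V - S) * f (V - S) else 0)"
  have "koszul_bd (\<lambda>S. if S \<subseteq> V then resign V (V - S) * cobd f (V - S) else 0) (V - U) = koszul_bd
      (koszul_bd c) (V - U)"
  proof (rule koszul_bd_cong)
    fix v assume v: "v \<in> V - (V - U)"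
    define S where "S = insert v (V - U)"
    have "S \<subseteq> V" "V - (V - S) = S" using v by (auto simp: S_def)
    then show "(if S \<subseteq> V then resign V (V - S) * cobd f (V - S) else 0) = koszul_bd c S"
      using cobd_transport[of "V - S" f] by (simp add: resign_square' c_def)
  qed
  then show ?thesis using cobd_transport[OF U, of "cobd f"] by (simp add: koszul_bd_koszul_bd)
qed

text \<open>
  The simplex on a nonempty set is acyclic, by the Koszul contraction in direction \<open>v\<close> after
  passing to complements. The second conclusion describes the support of the primitive and
  thereby bounds the sizes of the sets on which it is nonzero.
\<close>

lemma cobd_acyclic:
  fixes f :: "'v set \<Rightarrow> 'k::field"
  assumes v: "v \<in> V" and f: "\<And>U. U \<subseteq> V \<Longrightarrow> cobd f U = 0"
  shows "\<exists>g. (\<forall>U\<subseteq>V. cobd g U = f U) \<and>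
    (\<forall>U. g U \<noteq> 0 \<longrightarrow> U \<subseteq> V \<and> v \<in> V - U \<and> f (insert v U) \<noteq> 0)"
proof -
  define c where "c = (\<lambda>S. if S \<subseteq> V then resign V (V - S) * f (V - S) else 0)"
  define g where "g U = (if U \<subseteq> V then resign V U * koszul_htp v c (V - U) else 0)" for U
  have bd0: "koszul_bd c S = 0" if "S \<subseteq> V" for S
  proof -
    have "V - (V - S) = S" using that by auto
    then have "0 = resign V (V - S) * koszul_bd c S"
      using cobd_transport[of "V - S" f] f[of "V - S"] by (simp add: c_def)
    then show ?thesis using resign_nonzero[of V "V - S", where ?'k = 'k] by simp
  qed
  have "cobd g U = f U" if U: "U \<subseteq> V" for U
  proof -
    have "koszul_bd (\<lambda>S. if S \<subseteq> V then resign V (V - S) * g (V - S) else 0) (V - U) = koszul_bd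
        (koszul_htp v c) (V - U)"
    proof (rule koszul_bd_cong)
      fix w assume w: "w \<in> V - (V - U)"
      define S where "S = insert w (V - U)"
      have "S \<subseteq> V" "V - (V - S) = S" using w by (auto simp: S_def)
      then show "(if S \<subseteq> V then resign V (V - S) * g (V - S) else 0) = koszul_htp v c S"
        by (simp add: resign_square' g_def)
    qed
    also have "\<dots> = c (V - U)"
    proof -
      have "koszul_bd c (V - U - {v}) = 0" by (rule bd0) auto
      then show ?thesis using koszul_bd_koszul_htp[OF v, of "V - U" c] by (simp add: koszul_htp_def
          split: if_splits)
    qed
    finally have "cobd g U = resign V U * c (V - U)" by (simp add: cobd_transport[OF U, of g])
    moreover have "V - (V - U) = U" using U by auto
    ultimately show ?thesis by (simp add: c_def resign_square')
  qed
  moreover have "U \<subseteq> V \<and> v \<in> V - U \<and> f (insert v U) \<noteq> 0" if "g U \<noteq> 0" for U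
  proof -
    have U: "U \<subseteq> V" "v \<in> V - U" "c (V - U - {v}) \<noteq> 0"
      using that by (auto simp: g_def koszul_htp_def split: if_splits)
    have "V - (V - U - {v}) = insert v U" using U by auto
    then show ?thesis using U by (auto simp: c_def split: if_splits)
  qed
  ultimately show ?thesis by blast
qed

lemma sqfree_part_diff: "sqfree_part i (diff koszul i g) = delta (sqfree_part (Suc i) g)"
proof (intro ext)
  fix W U
  show "sqfree_part i (diff koszul i g) W U = delta (sqfree_part (Suc i) g) W U"
  proof (cases "U \<subseteq> W \<and> W \<subseteq> V")
    case True
    then have "W - U \<subseteq> V" by auto
    then show ?thesis using True by (simp add: delta_sqfree_part) (simp add: sqfree_part_def
        kcoeff_diff)
  qed (auto simp: sqfree_part_def delta_def cobd_def intro!: sum.neutral)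
qed

lemma sqfree_part_cycle:
  assumes "i > 0 \<longrightarrow> diff koszul (i - 1) f = 0"
  shows "delta (sqfree_part i f) = 0"
proof (intro ext)
  fix W U
  show "delta (sqfree_part i f) W U = 0 W U"
  proof (cases "U \<subseteq> W \<and> W \<subseteq> V")
    case True
    then have "W - U \<subseteq> V" by auto
    then show ?thesis using True by (simp add: delta_sqfree_part cycle_koszul_bd_zero[OF assms])
  qed (auto simp: sqfree_part_def delta_def cobd_def intro!: sum.neutral)
qed

lemma sqfree_part_add: "sqfree_part i (f + g) = sqfree_part i f + sqfree_part i g"
  by (auto simp: sqfree_part_def kcoeff_def fun_eq_iff lookup_add distrib_left)

lemma sqfree_part_zero: "sqfree_part i 0 = 0"
  by (auto simp: sqfree_part_def kcoeff_def fun_eq_iff)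

lemma lookup_const_mult:
  "lookup (single 0 c * p) m = c * lookup (p :: ('v, 'k::field) mpoly) m"
proof -
  have "lookup (single 0 c * p) m =
     (\<Sum>l. (c * (\<Sum>q. lookup p q when m = l + q)) when l = 0)"
    unfolding lookup_mult by (rule arg_cong[of _ _ Sum_any]) (auto simp: fun_eq_iff lookup_single
        when_def)
  also have "\<dots> = c * (\<Sum>q. lookup p q when m = 0 + q)"
    by (rule Sum_any_when_equal)
  finally show ?thesis by simp
qed

lemma sqfree_part_scale: "sqfree_part i (scale c f) = scale_fun c (sqfree_part i f)"
  by (auto simp: sqfree_part_def kcoeff_def fun_eq_iff scale_def scale_fun_def lookup_const_mult)

lemma sqfree_lift_finite:
  "finite {a. \<exists>S. (let W = keys a in
     if W \<subseteq> V \<and> a = sqfree_monom W \<and> S \<subseteq> W then resign W (W - S) * f W (W - S) else 0) \<noteq> (0 ::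
         'k::field)}"
  by (rule finite_subset[of _ "sqfree_monom ` Pow V"]) (use finV in \<open>auto simp: Let_def split:
      if_splits\<close>)

lemma kcoeff_sqfree_lift:
  "kcoeff i (sqfree_lift i f) a S = (let W = keys a in
     if W \<subseteq> V \<and> a = sqfree_monom W \<and> S \<subseteq> W \<and> card S = i then resign W (W - S) * f W (W - S) else 0)"
  unfolding sqfree_lift_def kcoeff_from_kcoeff[OF sqfree_lift_finite] by (auto simp: Let_def)

lemma sqfree_part_sqfree_lift:
  assumes "f \<in> cochains V N i j"
  shows "sqfree_part i (sqfree_lift i f) = f"
proof (intro ext)
  fix W U
  show "sqfree_part i (sqfree_lift i f) W U = f W U"
  proof (cases "U \<subseteq> W \<and> W \<subseteq> V")
    case True
    then have "finite W" "W - (W - U) = U" using finV finite_subset by auto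
    then show ?thesis using True assms
      by (auto simp: sqfree_part_def kcoeff_sqfree_lift Let_def keys_sqfree_monom resign_square'
          cochains_def)
  next
    case False
    then have "f W U = 0" using cochainsD[OF assms] by blast
    then show ?thesis using False by (auto simp: sqfree_part_def)
  qed
qed

lemma lookup_sqfree_lift:
  assumes "b < num_subsets i"
  shows "lookup (sqfree_lift i f b) m =
    (let a = m + sqfree_monom (nth_subset i b); W = keys a in
     if W \<subseteq> V \<and> a = sqfree_monom W then resign W (W - nth_subset i b) * f W (W - nth_subset i b)
         else 0)"
  using assms nth_subset_fin[OF assms]
  unfolding sqfree_lift_def by (subst lookup_from_kcoeff[OF sqfree_lift_finite]) (auto simp: Let_def
      keys_plus_nat keys_sqfree_monom)

lemma sqfree_lift_outside: "\<not> b < num_subsets i \<Longrightarrow> sqfree_lift i f b = 0"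
  by (simp add: sqfree_lift_def from_kcoeff_def)

lemma sqfree_lift_add: "sqfree_lift i (f + g) = sqfree_lift i f + sqfree_lift i g"
proof
  fix b
  show "sqfree_lift i (f + g) b = (sqfree_lift i f + sqfree_lift i g) b"
    by (cases "b < num_subsets i"; intro poly_mapping_eqI)
      (auto simp: lookup_add lookup_sqfree_lift sqfree_lift_outside Let_def distrib_left)
qed

lemma sqfree_lift_zero: "sqfree_lift i 0 = 0"
proof
  fix b
  show "sqfree_lift i 0 b = 0 b"
    by (cases "b < num_subsets i"; intro poly_mapping_eqI) (auto simp: lookup_sqfree_lift
        sqfree_lift_outside Let_def)
qed

lemma sqfree_lift_scale: "sqfree_lift i (scale_fun c f) = scale c (sqfree_lift i f)"
proof
  fix b
  show "sqfree_lift i (scale_fun c f) b = scale c (sqfree_lift i f) b"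
    by (cases "b < num_subsets i"; intro poly_mapping_eqI)
      (auto simp: lookup_sqfree_lift sqfree_lift_outside Let_def scale_def scale_fun_def
          lookup_const_mult)
qed

lemma sqfree_lift_graded_part:
  assumes f: "f \<in> cochains V N i j"
  shows "sqfree_lift i f \<in> graded_part (mono_module V N) (num_subsets i) (\<lambda>b. i) j"
  unfolding sqfree_lift_def
proof (rule from_kcoeff_graded_part[OF sqfree_lift_finite
    from_kcoeff_mono_module[OF sqfree_lift_finite]])
  fix a S assume *: "(let W = keys a in
     if W \<subseteq> V \<and> a = sqfree_monom W \<and> S \<subseteq> W then resign W (W - S) * f W (W - S) else 0) \<noteq> 0"
  define W where "W = keys a"
  have W: "W \<subseteq> V" "a = sqfree_monom W" "S \<subseteq> W" "f W (W - S) \<noteq> 0"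
    using * by (auto simp: Let_def W_def split: if_splits)
  have fW: "finite W" "finite S"
    using finite_subset[OF W(1) finV] finite_subset[OF W(3)] by simp_all
  show "mdeg a = j" using W f fW by (auto simp: cochains_def mdeg_sqfree_monom)
  have "keys (a - sqfree_monom S) = W - S"
    using fW W by (auto simp: in_keys_iff lookup_minus lookup_sqfree_monom split: if_splits)
  then show "keys a \<subseteq> V \<and> N (keys (a - sqfree_monom S))"
    using W(1,4) f by (auto simp: cochains_def W_def[symmetric])
qed

lemma sqfree_part_cochains:
  assumes "f \<in> graded_part (mono_module V N) (num_subsets i) (\<lambda>b. i) j"
  shows "sqfree_part i f \<in> cochains V N i j"
  unfolding cochains_def
proof (intro CollectI allI impI)
  fix W U assume "sqfree_part i f W U \<noteq> 0"
  then have W: "U \<subseteq> W" "W \<subseteq> V" and c: "kcoeff i f (sqfree_monom W) (W - U) \<noteq> 0"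
    by (auto simp: sqfree_part_def split: if_splits)
  have fW: "finite W" "finite (W - U)" using finite_subset[OF W(2) finV] by simp_all
  have "keys (sqfree_monom W - sqfree_monom (W - U)) = U"
    using fW W by (auto simp: in_keys_iff lookup_minus lookup_sqfree_monom split: if_splits)
  then show "U \<subseteq> W \<and> W \<subseteq> V \<and> card W = j \<and> card (W - U) = i \<and> N U"
    using W mono_module_kcoeff[OF graded_part_copies[OF assms] c] graded_part_kcoeff_degree[OF assms
        c] fW
    by (simp add: mdeg_sqfree_monom)
qed

definition cocycles :: "'v set \<Rightarrow> ('v set \<Rightarrow> bool) \<Rightarrow> nat \<Rightarrow> nat \<Rightarrow> ('v set \<Rightarrow> 'v set \<Rightarrow> 'k::field)
    set" where
  "cocycles X N i j = {f \<in> cochains X N i j. delta f = 0}"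

lemma delta_add: "delta (f + g) = delta f + delta g"
  by (auto simp: delta_def cobd_def fun_eq_iff distrib_left sum.distrib)

lemma delta_zero: "delta 0 = 0"
  by (auto simp: delta_def cobd_def fun_eq_iff)

lemma delta_scale: "delta (scale_fun c f) = scale_fun c (delta f)"
  by (auto simp: delta_def cobd_def fun_eq_iff scale_fun_def sum_distrib_left algebra_simps)

lemma cochains_zero: "0 \<in> cochains X N i j"
  by (simp add: cochains_def)

lemma cochains_add: "f \<in> cochains X N i j \<Longrightarrow> g \<in> cochains X N i j \<Longrightarrow> f + g \<in> cochains X N i j"
proof -
  assume f: "f \<in> cochains X N i j" and g: "g \<in> cochains X N i j"
  show "f + g \<in> cochains X N i j"
  proof (rule cochainsI)
    fix W U assume "(f + g) W U \<noteq> 0"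
    then consider "f W U \<noteq> 0" | "g W U \<noteq> 0" by (cases "f W U = 0") auto
    then show "U \<subseteq> W \<and> W \<subseteq> X \<and> card W = j \<and> card (W - U) = i \<and> N U"
      using cochainsD[OF f] cochainsD[OF g] by cases simp_all
  qed
qed

lemma cochains_scale: "f \<in> cochains X N i j \<Longrightarrow> scale_fun c f \<in> cochains X N i j"
  by (rule cochainsI) (auto simp: scale_fun_def dest: cochainsD)

text \<open>
  The rest of the cycle, after subtracting the boundary of the lifted primitive, has no
  component of squarefree multidegree, so the contraction in a direction of exponent at least
  \<open>2\<close> applies.
\<close>

lemma sqfree_part_boundary_imp_boundary:
  fixes z :: "nat \<Rightarrow> ('v, 'k::field) mpoly"
  assumes M: "is_ideal V (mono_module V N :: ('v, 'k) mpoly set)"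
    and z: "z \<in> graded_part (mono_module V N) (num_subsets i) (\<lambda>b. i) j"
    and cyc: "i > 0 \<longrightarrow> diff koszul (i - 1) z = 0"
    and b: "sqfree_part i z = delta \<phi>" "\<phi> \<in> cochains V N (Suc i) j"
  shows "\<exists>g\<in>graded_part (mono_module V N) (num_subsets (Suc i)) (\<lambda>b. Suc i) j. z = diff koszul i g"
proof -
  define h where "h = sqfree_lift (Suc i) \<phi>"
  have h: "h \<in> graded_part (mono_module V N) (num_subsets (Suc i)) (\<lambda>b. Suc i) j"
    unfolding h_def by (rule sqfree_lift_graded_part[OF b(2)])
  have dh: "diff koszul i h \<in> graded_part (mono_module V N) (num_subsets i) (\<lambda>b. i) j"
    using mat_apply_graded_part[OF M _ koszul_graded_matrix, of h i j] h by (simp add: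
        diff_eq_mat_apply koszul_gdeg)
  define z' where "z' = z - diff koszul i h"
  have z': "z' \<in> graded_part (mono_module V N) (num_subsets i) (\<lambda>b. i) j"
    unfolding z'_def by (rule graded_part_diff[OF M z dh])
  have "sqfree_part i z' + sqfree_part i (diff koszul i h) = sqfree_part i z"
    unfolding sqfree_part_add[symmetric] by (simp add: z'_def)
  then have sq0: "sqfree_part i z' = 0"
    using b sqfree_part_sqfree_lift[OF b(2)] by (simp add: sqfree_part_diff h_def)
  have cyc': "i > 0 \<longrightarrow> diff koszul (i - 1) z' = 0"
  proof
    assume "i > 0"
    then obtain l where l: "i = Suc l" by (cases i) auto
    have "diff koszul l (diff koszul (Suc l) h) = 0"
      by (rule koszul_diff_diff) (use graded_part_copies[OF graded_part_mono[OF M h]] l in simp)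
    then show "diff koszul (i - 1) z' = 0"
      using cyc l by (simp add: z'_def module_map_diff[OF module_map_diff_map])
  qed
  define D where "D = {a :: 'v \<Rightarrow>\<^sub>0 nat. \<exists>v. lookup a v \<ge> 2}"
  define w where "w a = (SOME v. lookup a v \<ge> 2)" for a :: "'v \<Rightarrow>\<^sub>0 nat"
  have w: "lookup a (w a) \<ge> 2" if "a \<in> D" for a
    using that unfolding D_def w_def mem_Collect_eq by (rule someI_ex)
  have wk: "w a \<in> keys a" if "a \<in> D" for a
    using w[OF that] by (auto simp: in_keys_iff)
  obtain g where g: "g \<in> copies (num_subsets (Suc i)) (mono_module V N)"
    "\<And>a S. S \<subseteq> V \<Longrightarrow> kcoeff i (diff koszul i g) a S = (if a \<in> D then kcoeff i z' a S else 0)"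
    "g \<in> graded_part (mono_module V N) (num_subsets (Suc i)) (\<lambda>b. Suc i) j"
    using koszul_homotopy[where D = D and v = w, OF graded_part_copies[OF z'] cyc' wk] w z' by auto
  have "diff koszul i g = z'"
  proof (rule kcoeff_inject[OF koszul_diff_copies[OF M g(1)] graded_part_copies[OF z']])
    fix a :: "'v \<Rightarrow>\<^sub>0 nat" and S assume S: "S \<subseteq> V"
    have "kcoeff i z' a S = 0" if "a \<notin> D"
    proof (rule ccontr)
      assume c: "kcoeff i z' a S \<noteq> 0"
      note * = mono_module_kcoeff[OF graded_part_copies[OF z'] c]
      define W where "W = keys a"
      have a: "a = sqfree_monom W"
      proof (rule poly_mapping_eqI)
        fix v
        have "lookup a v < 2" using that by (auto simp: D_def not_le)
        then show "lookup a v = lookup (sqfree_monom W) v"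
          by (auto simp: lookup_sqfree_monom W_def in_keys_iff)
      qed
      have "S \<subseteq> W" "W \<subseteq> V" using *(3,4) by (simp_all add: W_def)
      then have "sqfree_part i z' W (W - S) = resign W (W - S) * kcoeff i z' a S"
        using a[symmetric] by (simp add: sqfree_part_def double_diff)
      moreover have "resign W (W - S) \<noteq> (0 :: 'k)"
        by (rule resign_nonzero)
      ultimately show False using sq0 c by simp
    qed
    then show "kcoeff i (diff koszul i g) a S = kcoeff i z' a S" using g(2)[OF S] by auto
  qed
  then have "z = diff koszul i (g + h)"
    unfolding module_map_add[OF module_map_diff_map] by (simp add: z'_def)
  moreover have "g + h \<in> graded_part (mono_module V N) (num_subsets (Suc i)) (\<lambda>b. Suc i) j"
    by (rule graded_part_add[OF M g(3) h])
  ultimately show ?thesis by blast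
qed

lemma sqfree_lift_cycle:
  assumes M: "is_ideal V (mono_module V N :: ('v, 'k::field) mpoly set)"
    and z: "z \<in> cocycles V N (Suc l) j"
  shows "diff koszul l (sqfree_lift (Suc l) z :: nat \<Rightarrow> ('v, 'k) mpoly) = 0"
proof (rule kcoeff_inject[where i = l])
  have zc: "z \<in> cochains V N (Suc l) j" and dz: "delta z = 0" using z by (auto simp: cocycles_def)
  show "diff koszul l (sqfree_lift (Suc l) z) \<in> copies (num_subsets l) (mono_module V N)"
    by (rule koszul_diff_copies[OF M graded_part_copies[OF sqfree_lift_graded_part[OF zc]]])
  show "0 \<in> copies (num_subsets l) (UNIV :: ('v, 'k) mpoly set)" by (simp add: copies_def)
  fix a :: "'v \<Rightarrow>\<^sub>0 nat" and S assume S: "S \<subseteq> V"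
  define W where "W = keys a"
  have "kcoeff l (diff koszul l (sqfree_lift (Suc l) z)) a S = 0"
  proof (cases "W \<subseteq> V \<and> a = sqfree_monom W \<and> S \<subseteq> W")
    case True
    then have WS: "W - (W - S) = S" by auto
    have "0 = delta (sqfree_part (Suc l) (sqfree_lift (Suc l) z)) W (W - S)"
      using sqfree_part_sqfree_lift[OF zc] dz by simp
    also have "\<dots> = resign W (W - S) * koszul_bd (kcoeff (Suc l) (sqfree_lift (Suc l) z) a) S"
      using True WS by (subst delta_sqfree_part) auto
    finally have "koszul_bd (kcoeff (Suc l) (sqfree_lift (Suc l) z) a) S = 0"
      using resign_square'[of W "W - S"] by (metis mult_zero_right)
    then show ?thesis by (simp add: kcoeff_diff[OF S])
  next
    case False
    have "kcoeff (Suc l) (sqfree_lift (Suc l) z) a (insert v S) = 0" for v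
      using False by (auto simp: kcoeff_sqfree_lift Let_def W_def)
    then show ?thesis by (simp add: kcoeff_diff[OF S] koszul_bd_def)
  qed
  then show "kcoeff l (diff koszul l (sqfree_lift (Suc l) z)) a S = kcoeff l 0 a S" by (simp add:
      kcoeff_def)
qed

text \<open>
  Taking the squarefree part and lifting it back are inverse to each other on homology.
\<close>

lemma betti_cochains:
  assumes M: "is_ideal V (mono_module V N :: ('v, 'k::field) mpoly set)"
  shows "n \<le> betti V (mono_module V N :: ('v, 'k) mpoly set) i j \<longleftrightarrow>
    indep_mod (scale_fun :: 'k \<Rightarrow> _) n (cocycles V N i j) (delta ` cochains V N (Suc i) j)"
proof -
  let ?M = "mono_module V N :: ('v, 'k) mpoly set"
  have Z: "tor_cycles koszul ?M i j = {f \<in> graded_part ?M (num_subsets i) (\<lambda>b. i) j. i > 0 \<longrightarrow> diff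
      koszul (i - 1) f = 0}"
    by (simp only: tor_cycles_eq koszul_simps koszul_gdeg)
  have B: "tor_boundaries koszul ?M i j = diff koszul i ` graded_part ?M (num_subsets (Suc i)) (\<lambda>b.
      Suc i) j"
    by (simp only: tor_boundaries_def tensor_part_eq koszul_simps koszul_gdeg)
  have "indep_mod (scale_fun :: 'k \<Rightarrow> _) n (cocycles V N i j) (delta ` cochains V N (Suc i) j)"
    if n: "indep_mod scale n (tor_cycles koszul ?M i j) (tor_boundaries koszul ?M i j)"
  proof (rule indep_mod_transfer[OF n, where L = "sqfree_part i", OF sqfree_part_zero
      sqfree_part_add sqfree_part_scale])
    fix z assume z: "z \<in> tor_cycles koszul ?M i j"
    then show "sqfree_part i z \<in> cocycles V N i j"
      using sqfree_part_cochains[of z N i j] sqfree_part_cycle[of i z] by (auto simp only: Z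
          cocycles_def mem_Collect_eq)
    assume "sqfree_part i z \<in> delta ` cochains V N (Suc i) j"
    then show "z \<in> tor_boundaries koszul ?M i j"
      using sqfree_part_boundary_imp_boundary[OF M, of z i j] z unfolding B Z by blast
  next
    have s0: "diff koszul (i - 1) (scale c x) = 0" if "diff koszul (i - 1) x = 0" for c x
      unfolding module_map_scale[OF module_map_diff_map] that by (simp add: scale_def zero_fun_def)
    show "0 \<in> tor_cycles koszul ?M i j"
      by (simp only: Z mem_Collect_eq graded_part_zero[OF M] module_map_zero[OF module_map_diff_map]
          simp_thms)
    show "x + y \<in> tor_cycles koszul ?M i j" if "x \<in> tor_cycles koszul ?M i j" "y \<in> tor_cycles koszul
        ?M i j" for x y
      using that by (auto simp only: Z mem_Collect_eq graded_part_add[OF M]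
          module_map_add[OF module_map_diff_map] add_0)
    show "scale c x \<in> tor_cycles koszul ?M i j" if "x \<in> tor_cycles koszul ?M i j" for c x
      using that s0 by (auto simp only: Z mem_Collect_eq graded_part_scale[OF M])
  qed
  moreover have "indep_mod scale n (tor_cycles koszul ?M i j) (tor_boundaries koszul ?M i j)"
    if n: "indep_mod (scale_fun :: 'k \<Rightarrow> _) n (cocycles V N i j) (delta ` cochains V N (Suc i) j)"
  proof (rule indep_mod_transfer[OF n, where L = "sqfree_lift i", OF sqfree_lift_zero
      sqfree_lift_add sqfree_lift_scale])
    fix z :: "'v set \<Rightarrow> 'v set \<Rightarrow> 'k" assume z: "z \<in> cocycles V N i j"
    then have zc: "z \<in> cochains V N i j" by (simp add: cocycles_def)
    have "diff koszul (i - 1) (sqfree_lift i z :: nat \<Rightarrow> ('v, 'k) mpoly) = 0" if "i > 0"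
      using sqfree_lift_cycle[OF M, of z "i - 1" j] z that by simp
    then show "sqfree_lift i z \<in> tor_cycles koszul ?M i j"
      using sqfree_lift_graded_part[OF zc] by (auto simp only: Z mem_Collect_eq)
    assume "sqfree_lift i z \<in> tor_boundaries koszul ?M i j"
    then obtain g where g: "g \<in> graded_part ?M (num_subsets (Suc i)) (\<lambda>b. Suc i) j" "sqfree_lift i z
        = diff koszul i g"
      unfolding B by blast
    have "z = delta (sqfree_part (Suc i) g)"
      using sqfree_part_sqfree_lift[OF zc] g(2) by (simp add: sqfree_part_diff)
    then show "z \<in> delta ` cochains V N (Suc i) j" using sqfree_part_cochains[OF g(1)] by blast
  next
    show "0 \<in> cocycles V N i j" by (simp only: cocycles_def mem_Collect_eq cochains_zero delta_zero
        simp_thms)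
    show "x + y \<in> cocycles V N i j" if "x \<in> cocycles V N i j" "y \<in> cocycles V N i j"
      for x y :: "'v set \<Rightarrow> 'v set \<Rightarrow> 'k"
      using that by (simp only: cocycles_def mem_Collect_eq cochains_add delta_add add_0 simp_thms)
    show "scale_fun c x \<in> cocycles V N i j" if "x \<in> cocycles V N i j" for c and x :: "'v set \<Rightarrow> 'v
        set \<Rightarrow> 'k"
    proof -
      have "delta (scale_fun c x) = 0" using that by (simp add: cocycles_def delta_scale) (simp add:
          scale_fun_def fun_eq_iff)
      then show ?thesis using that by (simp only: cocycles_def mem_Collect_eq cochains_scale
          simp_thms)
    qed
  qed
  ultimately show ?thesis
    using betti_indep_mod[OF finV M koszul_resolves] by blast
qed

end

section \<open>Circuit ideals as spans of monomials\<close>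

lemma prod_var: "finite T \<Longrightarrow> (\<Prod>v\<in>T. var v) = (single (sqfree_monom T) 1 :: ('v, 'k::field) mpoly)"
  by (induction T rule: finite_induct) (simp_all add: var_def sqfree_monom_def mult_single)

lemma is_ideal_mono_module:
  assumes N: "\<And>A B. N A \<Longrightarrow> A \<subseteq> B \<Longrightarrow> N B"
  shows "is_ideal V (mono_module V N :: ('v, 'k::field) mpoly set)"
  unfolding is_ideal_def
proof (intro conjI ballI subsetI)
  fix p :: "('v, 'k) mpoly" assume p: "p \<in> mono_module V N"
  then show "p \<in> poly_ring V" by (auto simp: mono_module_def poly_ring_def)
  fix q :: "('v, 'k) mpoly" assume "q \<in> mono_module V N"
  then show "p + q \<in> mono_module V N"
    using p by (auto simp: mono_module_def dest!: subsetD[OF Poly_Mapping.keys_add])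
next
  fix r p :: "('v, 'k) mpoly" assume r: "r \<in> poly_ring V" and p: "p \<in> mono_module V N"
  have "keys m \<subseteq> V \<and> N (keys m)" if m: "m \<in> keys (r * p)" for m
  proof -
    obtain a b where "m = a + b" "a \<in> keys r" "b \<in> keys p"
      using keys_mult[of r p] m by blast
    then show ?thesis using r p N[of "keys b" "keys m"]
      by (auto simp: mono_module_def poly_ring_def keys_plus_nat)
  qed
  then show "r * p \<in> mono_module V N" by (simp add: mono_module_def)
qed (simp add: mono_module_def)

lemma circuit_ideal_eq:
  assumes V: "finite V"
  shows "circuit_ideal d V C = (mono_module V (\<lambda>U. \<exists>T\<in>clutter_complement d V C. T \<subseteq> U) ::
      ('v, 'k::field) mpoly set)"
    (is "_ = mono_module V ?N")
proof
  let ?G = "(\<lambda>T. \<Prod>v\<in>T. var v :: ('v, 'k) mpoly) ` clutter_complement d V C"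
  have fT: "finite T \<and> T \<subseteq> V" if "T \<in> clutter_complement d V C" for T
    using that V finite_subset by (auto simp: clutter_complement_def)
  show "circuit_ideal d V C \<subseteq> (mono_module V ?N :: ('v, 'k) mpoly set)"
    unfolding circuit_ideal_def
  proof (rule hull_minimal)
    show "is_ideal V (mono_module V ?N :: ('v, 'k) mpoly set)" by (rule is_ideal_mono_module) blast
    show "?G \<subseteq> mono_module V ?N"
    proof (rule image_subsetI)
      fix T assume T: "T \<in> clutter_complement d V C"
      then show "(\<Prod>v\<in>T. var v :: ('v, 'k) mpoly) \<in> mono_module V ?N"
        using fT[OF T] by (auto simp: mono_module_def prod_var keys_sqfree_monom)
    qed
  qed
  show "mono_module V ?N \<subseteq> (circuit_ideal d V C :: ('v, 'k) mpoly set)"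
    unfolding circuit_ideal_def hull_def
  proof (intro subsetI InterI, clarify)
    fix p :: "('v, 'k) mpoly" and J assume p: "p \<in> mono_module V ?N" and J: "is_ideal V J" and G:
        "?G \<subseteq> J"
    have "single m c \<in> J" if m: "m \<in> keys p" for m c
    proof -
      obtain T where T: "T \<in> clutter_complement d V C" "T \<subseteq> keys m" "keys m \<subseteq> V"
        using p m by (auto simp: mono_module_def)
      have "single (sqfree_monom T) 1 \<in> J"
        using G T(1) prod_var[of T, where ?'k = 'k] fT[OF T(1)] by (metis (no_types, lifting) imageI
            subsetD)
      moreover have "single (m - sqfree_monom T) c \<in> poly_ring V"
        using T(3) by (auto simp: poly_ring_def in_keys_iff lookup_minus)
      ultimately have "single (m - sqfree_monom T) c * single (sqfree_monom T) 1 \<in> J"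
        by (rule ideal_mult[OF J])
      then show ?thesis using minus_sqfree_monom_add[of T m] T fT by (simp add: mult_single)
    qed
    then have "trunc (\<lambda>_. True) p \<in> J" unfolding trunc_def by (intro ideal_sum[OF J]) auto
    then show "p \<in> J" by (simp add: trunc_id)
  qed
qed

text \<open>
  The complement of \<open>C\<close> indexes the generators.
\<close>

lemma circuit_ideal_nonzero:
  assumes V: "finite V"
  shows "circuit_ideal d V C \<noteq> ({0} :: ('v, 'k::field) mpoly set) \<longleftrightarrow> clutter_complement d V C \<noteq> {}"
proof
  assume n: "circuit_ideal d V C \<noteq> ({0} :: ('v, 'k::field) mpoly set)"
  show "clutter_complement d V C \<noteq> {}"
  proof
    assume "clutter_complement d V C = {}"
    then have "circuit_ideal d V C = ({0} :: ('v, 'k) mpoly set)"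
      unfolding circuit_ideal_eq[OF V] by (auto simp: mono_module_def ex_in_conv)
    with n show False ..
  qed
next
  assume "clutter_complement d V C \<noteq> {}"
  then obtain T where T: "T \<in> clutter_complement d V C" by blast
  then have "finite T" "T \<subseteq> V" using V finite_subset by (auto simp: clutter_complement_def)
  then have "single (sqfree_monom T) 1 \<in> (circuit_ideal d V C :: ('v, 'k) mpoly set)"
    unfolding circuit_ideal_eq[OF V] using T by (auto simp: mono_module_def keys_sqfree_monom)
  moreover have "single (sqfree_monom T) 1 \<noteq> (0 :: ('v, 'k) mpoly)"
    by (metis lookup_single_eq lookup_zero zero_neq_one)
  ultimately show "circuit_ideal d V C \<noteq> ({0} :: ('v, 'k) mpoly set)" by blast
qed

abbreviation nonclique :: "nat \<Rightarrow> 'v set set \<Rightarrow> 'v set \<Rightarrow> bool" where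
  "nonclique d C \<equiv> \<lambda>U. \<not> is_clique d C U"

lemma is_clique_mono: "is_clique d C U \<Longrightarrow> U' \<subseteq> U \<Longrightarrow> is_clique d C U'"
  by (auto simp: is_clique_def)

text \<open>
  The hypotheses on \<open>pA\<close> and \<open>pB\<close> say that \<open>Z\<close> modulo \<open>B\<close> maps onto the direct sum of the two
  other quotients: each class of \<open>Z1\<close> has a preimage that vanishes in the second summand, and
  symmetrically.
\<close>

lemma (in vector_space) indep_mod_direct_sum:
  assumes n1: "indep_mod scale n1 Z1 B1" and n2: "indep_mod scale n2 Z2 B2"
    and B1: "subspace B1" and B2: "subspace B2"
    and pA: "module_hom scale scale pA" and pB: "module_hom scale scale pB"
    and B: "\<And>b. b \<in> B \<Longrightarrow> pA b \<in> B1 \<and> pB b \<in> B2"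
    and Z1: "\<And>z. z \<in> Z1 \<Longrightarrow> \<exists>z'\<in>Z. pA z' - z \<in> B1 \<and> pB z' \<in> B2"
    and Z2: "\<And>z. z \<in> Z2 \<Longrightarrow> \<exists>z'\<in>Z. pA z' \<in> B1 \<and> pB z' - z \<in> B2"
  shows "indep_mod scale (n1 + n2) Z B"
proof -
  obtain g1 where g1: "\<And>i. i < n1 \<Longrightarrow> g1 i \<in> Z1"
    "\<And>a i. (\<Sum>i<n1. scale (a i) (g1 i)) \<in> B1 \<Longrightarrow> i < n1 \<Longrightarrow> a i = 0"
    using n1 unfolding indep_mod_def by blast
  obtain g2 where g2: "\<And>i. i < n2 \<Longrightarrow> g2 i \<in> Z2"
    "\<And>a i. (\<Sum>i<n2. scale (a i) (g2 i)) \<in> B2 \<Longrightarrow> i < n2 \<Longrightarrow> a i = 0"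
    using n2 unfolding indep_mod_def by blast
  obtain G1 where G1: "\<And>i. i < n1 \<Longrightarrow> G1 i \<in> Z \<and> pA (G1 i) - g1 i \<in> B1 \<and> pB (G1 i) \<in> B2"
    using bchoice[of "{..<n1}" "\<lambda>i y. y \<in> Z \<and> pA y - g1 i \<in> B1 \<and> pB y \<in> B2"] Z1 g1(1) by blast
  obtain G2 where G2: "\<And>i. i < n2 \<Longrightarrow> G2 i \<in> Z \<and> pA (G2 i) \<in> B1 \<and> pB (G2 i) - g2 i \<in> B2"
    using bchoice[of "{..<n2}" "\<lambda>i y. y \<in> Z \<and> pA y \<in> B1 \<and> pB y - g2 i \<in> B2"] Z2 g2(1) by blast
  define G where "G i = (if i < n1 then G1 i else G2 (i - n1))" for i
  show ?thesis
  proof (rule indep_modI[of "n1 + n2" G])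
    show "G i \<in> Z" if "i < n1 + n2" for i using that G1 G2 by (auto simp: G_def)
  next
    fix a i assume s: "(\<Sum>i<n1 + n2. scale (a i) (G i)) \<in> B" and i: "i < n1 + n2"
    have split: "(\<Sum>i<n1 + n2. scale (a i) (G i)) =
        (\<Sum>i<n1. scale (a i) (G1 i)) + (\<Sum>i<n2. scale (a (n1 + i)) (G2 i))"
    proof -
      have "(\<Sum>i<n1 + n2. scale (a i) (G i)) =
          (\<Sum>i<n1. scale (a i) (G i)) + (\<Sum>i<n2. scale (a (n1 + i)) (G (n1 + i)))"
        by (induction n2) (simp_all add: add.assoc)
      then show ?thesis by (simp add: G_def)
    qed
    have img: "p (\<Sum>i<n1 + n2. scale (a i) (G i)) =
        (\<Sum>i<n1. scale (a i) (p (G1 i))) + (\<Sum>i<n2. scale (a (n1 + i)) (p (G2 i)))"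
      if "module_hom scale scale p" for p
      unfolding split module_hom.add[OF that] module_hom.sum[OF that] module_hom.scale[OF that] ..
    have "(\<Sum>i<n1. scale (a i) (pA (G1 i))) + (\<Sum>i<n2. scale (a (n1 + i)) (pA (G2 i))) \<in> B1"
      using B[OF s] img[OF pA] by simp
    moreover have "(\<Sum>i<n2. scale (a (n1 + i)) (pA (G2 i))) \<in> B1"
      using G2 by (intro subspace_sum[OF B1] subspace_scale[OF B1]) auto
    ultimately have x1: "(\<Sum>i<n1. scale (a i) (pA (G1 i))) \<in> B1"
      using subspace_diff[OF B1] by fastforce
    have y1: "(\<Sum>i<n1. scale (a i) (pA (G1 i) - g1 i)) \<in> B1"
      using G1 by (intro subspace_sum[OF B1] subspace_scale[OF B1]) auto
    have "(\<Sum>i<n1. scale (a i) (g1 i)) =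
      (\<Sum>i<n1. scale (a i) (pA (G1 i))) - (\<Sum>i<n1. scale (a i) (pA (G1 i) - g1 i))"
      by (simp add: scale_right_diff_distrib sum_subtractf)
    then have "(\<Sum>i<n1. scale (a i) (g1 i)) \<in> B1" using subspace_diff[OF B1 x1 y1] by (simp only:)
    then have a1: "a k = 0" if "k < n1" for k using g1(2) that by blast
    have "(\<Sum>i<n1. scale (a i) (pB (G1 i))) + (\<Sum>i<n2. scale (a (n1 + i)) (pB (G2 i))) \<in> B2"
      using B[OF s] img[OF pB] by simp
    moreover have "(\<Sum>i<n1. scale (a i) (pB (G1 i))) \<in> B2"
      using G1 by (intro subspace_sum[OF B2] subspace_scale[OF B2]) auto
    ultimately have x2: "(\<Sum>i<n2. scale (a (n1 + i)) (pB (G2 i))) \<in> B2"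
      using subspace_diff[OF B2] by fastforce
    have y2: "(\<Sum>i<n2. scale (a (n1 + i)) (pB (G2 i) - g2 i)) \<in> B2"
      using G2 by (intro subspace_sum[OF B2] subspace_scale[OF B2]) auto
    have "(\<Sum>i<n2. scale (a (n1 + i)) (g2 i)) =
      (\<Sum>i<n2. scale (a (n1 + i)) (pB (G2 i))) - (\<Sum>i<n2. scale (a (n1 + i)) (pB (G2 i) - g2 i))"
      by (simp add: scale_right_diff_distrib sum_subtractf)
    then have "(\<Sum>i<n2. scale (a (n1 + i)) (g2 i)) \<in> B2" using subspace_diff[OF B2 x2 y2] by (simp
        only:)
    then have a2: "a (n1 + k) = 0" if "k < n2" for k using g2(2)[of "\<lambda>k. a (n1 + k)"] that by blast
    show "a i = 0" using a1[of i] a2[of "i - n1"] i by (cases "i < n1") auto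
  qed
qed

section \<open>Cliques in a decomposable clutter\<close>

text \<open>
  Cliques with fewer than \<open>d\<close> elements are excluded: all such sets are cliques, and they need
  not lie in one of the two vertex sets.
\<close>

definition splits :: "nat \<Rightarrow> 'v set \<Rightarrow> 'v set set \<Rightarrow> 'v set \<Rightarrow> 'v set set \<Rightarrow> 'v set \<Rightarrow> 'v set set \<Rightarrow>
    bool" where
  "splits d V C V1 C1 V2 C2 \<longleftrightarrow> (\<forall>U\<subseteq>V. d \<le> card U \<and> is_clique d C U \<longrightarrow>
     (U \<subseteq> V1 \<and> is_clique d C1 U) \<or> (U \<subseteq> V2 \<and> is_clique d C2 U))"

text \<open>
  In terms of clique complexes: the intersection of two faces with at least \<open>d\<close> vertices has
  dimension less than \<open>d - 2\<close>. In particular, no set with \<open>d\<close> or more vertices is a clique of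
  both.
\<close>

definition no_common_face :: "nat \<Rightarrow> 'v set set \<Rightarrow> 'v set set \<Rightarrow> bool" where
  "no_common_face d C1 C2 \<longleftrightarrow> (\<forall>T1 T2 e. finite T1 \<and> finite T2 \<and> d \<le> card T1 \<and> d \<le> card T2 \<and>
     is_clique d C1 T1 \<and> is_clique d C2 T2 \<and> e \<subseteq> T1 \<and> e \<subseteq> T2 \<longrightarrow> Suc (card e) < d)"

lemma decompositionD:
  assumes "decomposition d V C V1 C1 V2 C2"
  shows "finite V" "\<And>T. T \<in> C \<Longrightarrow> T \<subseteq> V \<and> card T = d" "V = V1 \<union> V2" "C = C1 \<union> C2"
    "C1 \<noteq> C" "C2 \<noteq> C" "uniform_clutter d V1 C1" "uniform_clutter d V2 C2"
proof -
  have u: "uniform_clutter d V C" "C1 \<subset> C" "C2 \<subset> C"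
    and "uniform_clutter d V1 C1" "uniform_clutter d V2 C2" "V = V1 \<union> V2" "C = C1 \<union> C2"
    using assms unfolding decomposition_def by - (elim conjE, assumption)+
  then show "uniform_clutter d V1 C1" "uniform_clutter d V2 C2" "V = V1 \<union> V2" "C = C1 \<union> C2"
    by - assumption+
  show "T \<subseteq> V \<and> card T = d" if "T \<in> C" for T
    using u that by (auto simp: uniform_clutter_def)
  show "finite V" "C1 \<noteq> C" "C2 \<noteq> C" using u by (auto simp: uniform_clutter_def)
qed

lemma decomposition_cases:
  assumes "decomposition d V C V1 C1 V2 C2"
  obtains (clique) "is_clique d C (V1 \<inter> V2)" "C1 = induced_subclutter C V1" "C2 = induced_subclutter
      C V2"
  | (disjoint) "submaximal_circuits d C1 \<inter> submaximal_circuits d C2 = {}"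
proof -
  have "(is_clique d C (V1 \<inter> V2) \<and> C1 = induced_subclutter C V1 \<and> C2 = induced_subclutter C V2) \<or>
      submaximal_circuits d C1 \<inter> submaximal_circuits d C2 = {}"
    using assms unfolding decomposition_def by (elim conjE)
  then show thesis
    by (elim disjE conjE) (erule (2) clique, erule disjoint)
qed

text \<open>
  For \<open>d = 0\<close> the empty set would be the only possible circuit, and a set with at most one
  element is not the union of two proper subsets.
\<close>

lemma decomposition_pos:
  assumes "decomposition d V C V1 C1 V2 C2"
  shows "d > 0"
proof (rule ccontr)
  assume "\<not> d > 0"
  have "T = {}" if "T \<in> C" for T
    using decompositionD(2)[OF assms that] finite_subset[OF _ decompositionD(1)[OF assms], of T]
      \<open>\<not> d > 0\<close> by auto
  then have "C \<subseteq> {{}}" by blast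
  then show False using decompositionD(4-6)[OF assms] by blast
qed

lemma decomposition_sym:
  "decomposition d V C V1 C1 V2 C2 \<Longrightarrow> decomposition d V C V2 C2 V1 C1"
  unfolding decomposition_def by (auto simp: Int_commute Un_commute)

lemma clique_subset_vertices:
  assumes u: "uniform_clutter d V1 C1" and d: "d > 0" and U: "finite U" "d \<le> card U" "is_clique d C1
      U"
  shows "U \<subseteq> V1"
proof
  fix x assume x: "x \<in> U"
  have "d - 1 \<le> card (U - {x})" using U x by simp
  then obtain e where e: "e \<subseteq> U - {x}" "card e = d - 1" "finite e"
    by (meson obtain_subset_with_card_n)
  have "insert x e \<subseteq> U" "card (insert x e) = d" using e x d by (auto simp: card_insert_if)
  then have "insert x e \<in> C1" using U(3) by (simp add: is_clique_def)
  then show "x \<in> V1" using u by (auto simp: uniform_clutter_def)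
qed

lemma clique_subset_submaximal:
  assumes T: "finite T" "d \<le> card T" "is_clique d C T" and e: "e \<subseteq> T" "Suc (card e) = d"
  shows "e \<in> submaximal_circuits d C"
proof -
  have fe: "finite e" using e(1) T(1) finite_subset by blast
  have "card e < card T" using T e by simp
  then obtain x where x: "x \<in> T" "x \<notin> e" using e(1) by (metis order_less_irrefl subsetI
      subset_antisym)
  have "insert x e \<subseteq> T" "card (insert x e) = d" using x e fe by auto
  then have "insert x e \<in> C" using T(3) by (simp add: is_clique_def)
  then show ?thesis using fe e(2) by (auto simp: submaximal_circuits_def)
qed

lemma disjoint_submaximal_no_common_face:
  assumes "submaximal_circuits d C1 \<inter> submaximal_circuits d C2 = {}" and d: "d > 0"
  shows "no_common_face d C1 C2"
  unfolding no_common_face_def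
proof (intro allI impI, rule ccontr)
  fix T1 T2 e
  assume *: "finite T1 \<and> finite T2 \<and> d \<le> card T1 \<and> d \<le> card T2 \<and>
     is_clique d C1 T1 \<and> is_clique d C2 T2 \<and> e \<subseteq> T1 \<and> e \<subseteq> T2" and "\<not> Suc (card e) < d"
  then have "d - 1 \<le> card e" by simp
  then obtain e' where e': "e' \<subseteq> e" "card e' = d - 1" by (meson obtain_subset_with_card_n)
  have "e' \<in> submaximal_circuits d C1" "e' \<in> submaximal_circuits d C2"
    using * e' d clique_subset_submaximal[of T1 d C1 e'] clique_subset_submaximal[of T2 d C2 e']
        by auto
  then show False using assms(1) by blast
qed

text \<open>
  Any two \<open>d\<close>-subsets of \<open>U\<close> are joined by exchanging one element at a time. Consecutive ones
  share a submaximal circuit, hence belong to the same piece.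
\<close>

lemma disjoint_submaximal_clique:
  assumes disj: "submaximal_circuits d (C1 :: 'v set set) \<inter> submaximal_circuits d C2 = {}"
    and C: "C = C1 \<union> C2" and U: "finite U" "is_clique d C U"
    and T0: "T0 \<subseteq> U" "card T0 = d" "T0 \<in> C1"
  shows "is_clique d C1 U"
  unfolding is_clique_def
proof (intro allI impI)
  fix T assume "T \<subseteq> U \<and> card T = d"
  then show "T \<in> C1"
  proof (induction "card (T - T0)" arbitrary: T)
    case 0
    have fT: "finite T" "finite T0" using 0 U T0 finite_subset by blast+
    have "T \<subseteq> T0" using 0 fT by auto
    then have "T = T0" using card_subset_eq[OF fT(2), of T] 0 T0 by simp
    then show ?case using T0 by simp
  next
    case (Suc k)
    have fT: "finite T" "finite T0" using Suc.prems U T0 finite_subset by blast+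
    have "T - T0 \<noteq> {}" using Suc.hyps(2) by (intro notI) simp
    then obtain t where t: "t \<in> T" "t \<notin> T0" by blast
    have "\<not> T0 \<subseteq> T" using card_subset_eq[OF fT(1), of T0] t Suc.prems T0 by auto
    then obtain s where s: "s \<in> T0" "s \<notin> T" by blast
    define e where "e = T - {t}"
    have e: "finite e" "Suc (card e) = d" "e \<subseteq> T" "s \<notin> e"
      using t s fT Suc.prems card_Suc_Diff1[of T t] by (auto simp: e_def)
    have "insert s e - T0 = (T - T0) - {t}" using t s by (auto simp: e_def)
    then have "card (insert s e - T0) = k" using t Suc.hyps(2) fT by simp
    moreover have "insert s e \<subseteq> U \<and> card (insert s e) = d" using e s T0 Suc.prems by auto
    ultimately have "insert s e \<in> C1" using Suc.hyps(1) by blast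
    then have "e \<in> submaximal_circuits d C1" using e by (auto simp: submaximal_circuits_def)
    then have "e \<notin> submaximal_circuits d C2" using disj by blast
    then have "T \<notin> C2" using e by (auto simp: submaximal_circuits_def)
    moreover have "T \<in> C" using U(2) Suc.prems by (simp add: is_clique_def)
    ultimately show ?case using C by blast
  qed
qed

text \<open>
  If the pieces are glued along a clique, a clique with vertices \<open>a \<notin> V1\<close> and \<open>b \<notin> V2\<close> would
  have a circuit containing both, which lies in neither piece. This needs \<open>d \<ge> 2\<close>: two isolated
  points, each being a circuit of one piece for \<open>d = 1\<close>, form a clique of their union.
\<close>

lemma decomposition_splits:
  assumes dec: "decomposition d V C V1 C1 V2 C2"
    and d: "d \<ge> 2 \<or> submaximal_circuits d C1 \<inter> submaximal_circuits d C2 = {}"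
  shows "splits d V C V1 C1 V2 C2"
  unfolding splits_def
proof (intro allI impI)
  fix U assume UV: "U \<subseteq> V" and U: "d \<le> card U \<and> is_clique d C U"
  have fU: "finite U" by (rule finite_subset[OF UV decompositionD(1)[OF dec]])
  have pos: "d > 0" by (rule decomposition_pos[OF dec])
  show "(U \<subseteq> V1 \<and> is_clique d C1 U) \<or> (U \<subseteq> V2 \<and> is_clique d C2 U)"
  proof (cases "submaximal_circuits d C1 \<inter> submaximal_circuits d C2 = {}")
    case True
    obtain T0 where T0: "T0 \<subseteq> U" "card T0 = d" using U by (meson obtain_subset_with_card_n)
    then have "T0 \<in> C" using U by (simp add: is_clique_def)
    then consider "T0 \<in> C1" | "T0 \<in> C2" using decompositionD(4)[OF dec] by blast
    then have "is_clique d C1 U \<or> is_clique d C2 U"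
    proof cases
      case 1
      then show ?thesis
        using disjoint_submaximal_clique[OF True decompositionD(4)[OF dec] fU _ T0] U by blast
    next
      case 2
      have "submaximal_circuits d C2 \<inter> submaximal_circuits d C1 = {}" "C = C2 \<union> C1"
        using True decompositionD(4)[OF dec] by blast+
      then show ?thesis
        using disjoint_submaximal_clique[OF _ _ fU _ T0, of C2 C1 C] U 2 by blast
    qed
    then show ?thesis
      using clique_subset_vertices[OF decompositionD(7)[OF dec] pos fU]
        clique_subset_vertices[OF decompositionD(8)[OF dec] pos fU] U by blast
  next
    case False
    then have d2: "d \<ge> 2" using d by blast
    from dec have induced: "C1 = induced_subclutter C V1" "C2 = induced_subclutter C V2"
      by (cases rule: decomposition_cases; use False in blast)+
    have "U \<subseteq> V1 \<or> U \<subseteq> V2"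
    proof (rule ccontr)
      assume "\<not> ?thesis"
      then obtain a b where ab: "a \<in> U" "a \<notin> V1" "b \<in> U" "b \<notin> V2" by blast
      have "a \<noteq> b" using ab UV decompositionD(3)[OF dec] by blast
      then have "d - 2 \<le> card (U - {a, b})" using U ab fU by (simp add: card_Diff_subset
          numeral_2_eq_2 diff_le_mono)
      then obtain e where e: "e \<subseteq> U - {a, b}" "card e = d - 2" "finite e"
        by (meson obtain_subset_with_card_n)
      have "{a, b} \<union> e \<subseteq> U" "card ({a, b} \<union> e) = d"
        using e ab d2 \<open>a \<noteq> b\<close> by (auto simp: card_insert_if)
      then have "{a, b} \<union> e \<in> C" using U by (simp only: is_clique_def)
      then have "{a, b} \<union> e \<in> C1 \<or> {a, b} \<union> e \<in> C2" using decompositionD(4)[OF dec] by blast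
      then have "{a, b} \<union> e \<subseteq> V1 \<or> {a, b} \<union> e \<subseteq> V2"
        using decompositionD(7,8)[OF dec] unfolding uniform_clutter_def by metis
      then show False using ab by blast
    qed
    then show ?thesis using U induced by (auto simp: is_clique_def induced_subclutter_def)
  qed
qed

context vertex_order
begin

lemma vertex_order_subset: "X \<subseteq> V \<Longrightarrow> vertex_order X pos"
  using finV inj_pos by unfold_locales (auto intro: finite_subset inj_on_subset)

lemma vector_space_scale_fun: "vector_space (scale_fun :: 'k::field \<Rightarrow> _)"
  by unfold_locales (auto simp: scale_fun_def fun_eq_iff algebra_simps)

lemma betti_circuit_ideal:
  assumes X: "X \<subseteq> V"
  shows "n \<le> betti X (circuit_ideal d X C :: ('v, 'k::field) mpoly set) i j \<longleftrightarrow>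
    indep_mod (scale_fun :: 'k \<Rightarrow> _) n (cocycles X (nonclique d C) i j)
      (delta ` cochains X (nonclique d C) (Suc i) j)"
proof -
  interpret X: vertex_order X pos by (rule vertex_order_subset[OF X])
  let ?N = "\<lambda>U. \<exists>T\<in>clutter_complement d X C. T \<subseteq> U"
  have I: "is_ideal X (mono_module X ?N :: ('v, 'k) mpoly set)"
    by (rule is_ideal_mono_module) blast
  have eq: "(cochains X ?N i j :: ('v set \<Rightarrow> 'v set \<Rightarrow> 'k) set) =
    cochains X (nonclique d C) i j" for i j
  proof -
    have "?N U \<longleftrightarrow> \<not> is_clique d C U" if "U \<subseteq> X" for U
      using that unfolding clutter_complement_def is_clique_def by auto
    then show ?thesis unfolding cochains_def by (metis (no_types, lifting) order_trans)
  qed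
  then show ?thesis
    using X.betti_cochains[OF I, of n i j] unfolding circuit_ideal_eq[OF X.finV] cocycles_def
        by simp
qed

lemma subspace_coboundaries:
  "module.subspace (scale_fun :: 'k::field \<Rightarrow> _) (delta ` cochains X N i j)"
proof -
  interpret vs: vector_space "scale_fun :: 'k \<Rightarrow> ('v set \<Rightarrow> 'v set \<Rightarrow> 'k) \<Rightarrow> _" by (rule
      vector_space_scale_fun)
  show ?thesis
    unfolding vs.subspace_def
  proof (intro conjI ballI allI)
    show "0 \<in> delta ` cochains X N i j" by (rule image_eqI[of _ _ 0]) (rule delta_zero[symmetric],
        rule cochains_zero)
    show "x + y \<in> delta ` cochains X N i j"
      if "x \<in> delta ` cochains X N i j" "y \<in> delta ` cochains X N i j" for x y
      using that by (auto simp only: delta_add[symmetric] intro!: imageI cochains_add)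
    show "scale_fun c x \<in> delta ` cochains X N i j" if "x \<in> delta ` cochains X N i j" for c x
      using that by (auto simp only: delta_scale[symmetric] intro!: imageI cochains_scale)
  qed
qed

definition restrict_to :: "'v set \<Rightarrow> ('v set \<Rightarrow> 'v set \<Rightarrow> 'k::field) \<Rightarrow> 'v set \<Rightarrow> 'v set \<Rightarrow> 'k" where
  "restrict_to X f W U = (if W \<subseteq> X then f W U else 0)"

text \<open>
  The coboundary does not change \<open>W\<close>, so restricting the range of \<open>W\<close> is a chain map.
\<close>

lemma restrict_to_delta: "restrict_to X (delta f) = delta (restrict_to X f)"
  by (auto simp: restrict_to_def delta_def cobd_def fun_eq_iff)

lemma restrict_to_module_hom: "module_hom (scale_fun :: 'k::field \<Rightarrow> _) scale_fun (restrict_to X)"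
proof -
  interpret vs: vector_space "scale_fun :: 'k \<Rightarrow> ('v set \<Rightarrow> 'v set \<Rightarrow> 'k) \<Rightarrow> _" by (rule
      vector_space_scale_fun)
  show ?thesis by unfold_locales (auto simp: restrict_to_def scale_fun_def fun_eq_iff)
qed

lemma restrict_to_cochains:
  assumes "f \<in> cochains V N i j" "X \<subseteq> V" "\<And>U. U \<subseteq> X \<Longrightarrow> N U \<Longrightarrow> N' U"
  shows "restrict_to X f \<in> cochains X N' i j"
proof (rule cochainsI)
  fix W U assume "restrict_to X f W U \<noteq> 0"
  then have "W \<subseteq> X" "f W U \<noteq> 0" by (auto simp: restrict_to_def split: if_splits)
  with cochainsD[OF assms(1), of W U] assms(3)[of U]
  show "U \<subseteq> W \<and> W \<subseteq> X \<and> card W = j \<and> card (W - U) = i \<and> N' U" by blast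
qed

text \<open>
  Vanishing of the relative cohomology in degree \<open>u\<close> for one fixed \<open>W\<close>. The cochains are bound
  in the definition, so their field has to be given by a type argument.
\<close>

definition rel_acyclic :: "'k::field itself \<Rightarrow> ('v set \<Rightarrow> bool) \<Rightarrow> 'v set \<Rightarrow> nat \<Rightarrow> bool" where
  "rel_acyclic K N W u \<longleftrightarrow> (\<forall>z :: 'v set \<Rightarrow> 'k.
     (\<forall>U. z U \<noteq> 0 \<longrightarrow> U \<subseteq> W \<and> card U = u \<and> N U) \<and> (\<forall>U\<subseteq>W. cobd z U = 0) \<longrightarrow>
     (\<exists>y. (\<forall>U. y U \<noteq> 0 \<longrightarrow> U \<subseteq> W \<and> Suc (card U) = u \<and> N U) \<and> (\<forall>U\<subseteq>W. cobd y U = z U)))"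

lemma betti_zero_iff:
  assumes X: "X \<subseteq> V"
  shows "betti X (circuit_ideal d X C :: ('v, 'k::field) mpoly set) i j = 0 \<longleftrightarrow>
    (cocycles X (nonclique d C) i j :: ('v set \<Rightarrow> 'v set \<Rightarrow> 'k) set)
      \<subseteq> delta ` cochains X (nonclique d C) (Suc i) j"
    (is "_ \<longleftrightarrow> ?Z \<subseteq> ?B")
proof -
  interpret vs: vector_space "scale_fun :: 'k \<Rightarrow> ('v set \<Rightarrow> 'v set \<Rightarrow> 'k) \<Rightarrow> _" by (rule
      vector_space_scale_fun)
  have B: "vs.subspace ?B" by (rule subspace_coboundaries)
  have "indep_mod (scale_fun :: 'k \<Rightarrow> _) 1 ?Z ?B \<longleftrightarrow> \<not> ?Z \<subseteq> ?B"
  proof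
    assume "indep_mod (scale_fun :: 'k \<Rightarrow> _) 1 ?Z ?B"
    then obtain g where g: "g 0 \<in> ?Z" "\<And>a :: nat \<Rightarrow> 'k. scale_fun (a 0) (g 0) \<in> ?B \<Longrightarrow> a 0 = 0"
      unfolding indep_mod_def by (auto simp: One_nat_def)
    have "g 0 \<notin> ?B" using g(2)[of "\<lambda>_. 1"] by auto
    then show "\<not> ?Z \<subseteq> ?B" using g(1) by blast
  next
    assume "\<not> ?Z \<subseteq> ?B"
    then obtain z where z: "z \<in> ?Z" "z \<notin> ?B" by blast
    show "indep_mod (scale_fun :: 'k \<Rightarrow> _) 1 ?Z ?B"
    proof (rule indep_modI[of 1 "\<lambda>_. z"])
      fix a :: "nat \<Rightarrow> 'k" and k assume "(\<Sum>i<1. scale_fun (a i) z) \<in> ?B" "k < (1 :: nat)"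
      then have b: "scale_fun (a 0) z \<in> ?B" "k = 0" by (simp_all add: One_nat_def)
      show "a k = 0"
      proof (rule ccontr)
        assume "a k \<noteq> 0"
        then have "z = scale_fun (inverse (a 0)) (scale_fun (a 0) z)" using b(2) by simp
        then have "z \<in> ?B" using vs.subspace_scale[OF B b(1)] by metis
        then show False using z(2) by blast
      qed
    qed (use z in simp)
  qed
  then show ?thesis using betti_circuit_ideal[OF X, of 1 d C i j, where ?'k = 'k] by auto
qed

text \<open>
  The cohomology of families is the product over \<open>W\<close> of the cohomologies for fixed \<open>W\<close>.
\<close>

lemma betti_zero_rel_acyclic:
  assumes X: "X \<subseteq> V"
  shows "betti X (circuit_ideal d X C :: ('v, 'k::field) mpoly set) i (i + u) = 0 \<longleftrightarrow>
    (\<forall>W\<subseteq>X. card W = i + u \<longrightarrow> rel_acyclic TYPE('k) (nonclique d C) W u)"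
    (is "_ \<longleftrightarrow> ?R")
proof -
  let ?N = "nonclique d C"
  have size: "card (W - U) = l \<longleftrightarrow> l + card U = card W" if "U \<subseteq> W" "W \<subseteq> X" for W U l
  proof -
    have "finite W" using that X finV finite_subset by (meson order_trans)
    then show ?thesis using that card_Diff_subset[of U W] card_mono[of W U] finite_subset[of U W]
        by auto
  qed
  show ?thesis
    unfolding betti_zero_iff[OF X]
  proof
    assume Z: "(cocycles X ?N i (i + u) :: ('v set \<Rightarrow> 'v set \<Rightarrow> 'k) set) \<subseteq> delta ` cochains X ?N (Suc
        i) (i + u)"
    show ?R
      unfolding rel_acyclic_def
    proof (intro allI impI, elim conjE)
      fix W and z :: "'v set \<Rightarrow> 'k"
      assume W: "W \<subseteq> X" "card W = i + u"
        and z: "\<forall>U. z U \<noteq> 0 \<longrightarrow> U \<subseteq> W \<and> card U = u \<and> ?N U" "\<forall>U\<subseteq>W. cobd z U = 0"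
      define f where "f W' U = (if W' = W then z U else 0)" for W' U
      have "f \<in> cochains X ?N i (i + u)"
        by (rule cochainsI) (use z(1) W size in \<open>auto simp: f_def split: if_splits\<close>)
      moreover have "delta f = 0"
      proof (intro ext)
        fix W' U show "delta f W' U = 0 W' U"
          using z(2) by (cases "W' = W") (auto simp: delta_def f_def cobd_def)
      qed
      ultimately have "f \<in> cocycles X ?N i (i + u)" by (simp only: cocycles_def mem_Collect_eq)
      then obtain c where c: "c \<in> cochains X ?N (Suc i) (i + u)" "f = delta c" using Z by blast
      have "\<forall>U. c W U \<noteq> 0 \<longrightarrow> U \<subseteq> W \<and> Suc (card U) = u \<and> ?N U"
      proof (intro allI impI)
        fix U assume "c W U \<noteq> 0"
        from cochainsD[OF c(1) this] size[of U W "Suc i"]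
        show "U \<subseteq> W \<and> Suc (card U) = u \<and> ?N U" by auto
      qed
      moreover have "\<forall>U\<subseteq>W. cobd (c W) U = z U"
      proof (intro allI impI)
        fix U assume "U \<subseteq> W"
        then have "cobd (c W) U = delta c W U" by (simp add: delta_def)
        also have "\<dots> = z U" unfolding c(2)[symmetric] by (simp add: f_def)
        finally show "cobd (c W) U = z U" .
      qed
      ultimately show "\<exists>y. (\<forall>U. y U \<noteq> 0 \<longrightarrow> U \<subseteq> W \<and> Suc (card U) = u \<and> ?N U) \<and> (\<forall>U\<subseteq>W. cobd y U = z U)"
        by (intro exI[of _ "c W"] conjI)
    qed
  next
    assume R: ?R
    show "(cocycles X ?N i (i + u) :: ('v set \<Rightarrow> 'v set \<Rightarrow> 'k) set) \<subseteq> delta ` cochains X ?N (Suc i) (i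
        + u)"
    proof
      fix z :: "'v set \<Rightarrow> 'v set \<Rightarrow> 'k" assume "z \<in> cocycles X ?N i (i + u)"
      then have zc: "z \<in> cochains X ?N i (i + u)" and dz: "delta z = 0" by (auto simp: cocycles_def)
      have "\<exists>y. (\<forall>U. y U \<noteq> 0 \<longrightarrow> U \<subseteq> W \<and> Suc (card U) = u \<and> ?N U) \<and> (\<forall>U\<subseteq>W. cobd y U = z W U)"
        if W: "W \<subseteq> X" "card W = i + u" for W
      proof -
        have "\<forall>U. z W U \<noteq> 0 \<longrightarrow> U \<subseteq> W \<and> card U = u \<and> ?N U"
        proof (intro allI impI)
          fix U assume "z W U \<noteq> 0"
          from cochainsD[OF zc this] size[of U W i] show "U \<subseteq> W \<and> card U = u \<and> ?N U" by auto
        qed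
        moreover have "\<forall>U\<subseteq>W. cobd (z W) U = 0"
        proof (intro allI impI)
          fix U assume "U \<subseteq> W"
          then have "cobd (z W) U = delta z W U" by (simp add: delta_def)
          then show "cobd (z W) U = 0" unfolding dz by simp
        qed
        ultimately show ?thesis using R W unfolding rel_acyclic_def by blast
      qed
      then obtain y where y: "\<And>W U. W \<subseteq> X \<Longrightarrow> card W = i + u \<Longrightarrow> y W U \<noteq> 0 \<Longrightarrow> U \<subseteq> W \<and> Suc (card U) = u \<and>
          ?N U"
        "\<And>W U. W \<subseteq> X \<Longrightarrow> card W = i + u \<Longrightarrow> U \<subseteq> W \<Longrightarrow> cobd (y W) U = z W U"
        by metis
      define c where "c W U = (if W \<subseteq> X \<and> card W = i + u then y W U else 0)" for W U
      have "c \<in> cochains X ?N (Suc i) (i + u)"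
      proof (rule cochainsI)
        fix W U assume "c W U \<noteq> 0"
        then have W: "W \<subseteq> X" "card W = i + u" "y W U \<noteq> 0" by (auto simp: c_def split: if_splits)
        from y(1)[OF this] size[of U W "Suc i"] W
        show "U \<subseteq> W \<and> W \<subseteq> X \<and> card W = i + u \<and> card (W - U) = Suc i \<and> ?N U" by auto
      qed
      moreover have "z = delta c"
      proof (intro ext)
        fix W U
        show "z W U = delta c W U"
        proof (cases "W \<subseteq> X \<and> card W = i + u \<and> U \<subseteq> W")
          case True
          then have "delta c W U = cobd (y W) U" by (simp add: delta_def c_def cobd_def)
          then show ?thesis using y(2) True by simp
        next
          case False
          then have "z W U = 0" using cochainsD[OF zc, of W U] by blast
          moreover have "c W U' = 0 \<or> \<not> U \<subseteq> W" for U' using False unfolding c_def by (cases "W \<subseteq> X \<and>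
              card W = i + u") auto
          then have "delta c W U = 0" by (auto simp: delta_def cobd_def intro!: sum.neutral)
          ultimately show ?thesis by simp
        qed
      qed
      ultimately show "z \<in> delta ` cochains X ?N (Suc i) (i + u)" by blast
    qed
  qed
qed

end

context vertex_order
begin

section \<open>Gluing primitives of cochains\<close>

text \<open>
  For fixed \<open>W\<close>, a relative cocycle \<open>z\<close> is the coboundary of a cochain \<open>w\<close> on the whole simplex
  on \<open>W\<close>. Then \<open>w\<close> restricts to a cocycle on the cliques, and \<open>z\<close> is a relative coboundary if
  and only if this restriction is a coboundary of the clique complex. This is the connecting
  isomorphism of the pair; the lemmas below produce primitives of \<open>w\<close> on the cliques of each
  piece and glue them.
\<close>

lemma cobd_diff: "cobd (\<lambda>U. f U - g U) U = cobd f U - (cobd g U :: 'k::field)"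
  by (simp add: cobd_def right_diff_distrib sum_subtractf)

lemma cobd_eq_zero: "(\<And>v. v \<in> U \<Longrightarrow> f (U - {v}) = 0) \<Longrightarrow> cobd f U = (0 :: 'k::field)"
  by (simp add: cobd_def)

lemma cobd_nonzero:
  assumes "cobd f U \<noteq> (0 :: 'k::field)"
  obtains v where "v \<in> U" "f (U - {v}) \<noteq> 0"
  using assms cobd_eq_zero[of U f] by blast

lemma cobd_acyclic_on:
  fixes f :: "'v set \<Rightarrow> 'k::field"
  assumes W: "W \<subseteq> V" "W \<noteq> {}" and f: "\<And>U. U \<subseteq> W \<Longrightarrow> cobd f U = 0"
    and n: "\<And>U. U \<subseteq> W \<Longrightarrow> f U \<noteq> 0 \<Longrightarrow> card U = n"
  obtains g where "\<And>U. U \<subseteq> W \<Longrightarrow> cobd g U = f U"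
    and "\<And>U. g U \<noteq> 0 \<Longrightarrow> U \<subseteq> W \<and> Suc (card U) = n"
proof -
  interpret W: vertex_order W pos by (rule vertex_order_subset[OF W(1)])
  obtain v where v: "v \<in> W" using W(2) by blast
  obtain g where g: "\<And>U. U \<subseteq> W \<Longrightarrow> cobd g U = f U"
    "\<And>U. g U \<noteq> 0 \<Longrightarrow> U \<subseteq> W \<and> v \<in> W - U \<and> f (insert v U) \<noteq> 0"
    using W.cobd_acyclic[OF v f] by blast
  have "U \<subseteq> W \<and> Suc (card U) = n" if "g U \<noteq> 0" for U
  proof -
    have *: "U \<subseteq> W" "v \<notin> U" "f (insert v U) \<noteq> 0" using g(2)[OF that] by auto
    have "card (insert v U) = n" using * v by (intro n) auto
    then show ?thesis using * finite_subset[OF *(1) W.finV] by simp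
  qed
  then show thesis using g(1) that by blast
qed

lemma rel_acyclicD:
  fixes z :: "'v set \<Rightarrow> 'k::field"
  assumes "rel_acyclic TYPE('k) N W u"
    and "\<And>U. z U \<noteq> 0 \<Longrightarrow> U \<subseteq> W \<and> card U = u \<and> N U" "\<And>U. U \<subseteq> W \<Longrightarrow> cobd z U = 0"
  shows "\<exists>y. (\<forall>U. y U \<noteq> 0 \<longrightarrow> U \<subseteq> W \<and> Suc (card U) = u \<and> N U) \<and> (\<forall>U\<subseteq>W. cobd y U = z U)"
  by (rule mp[OF spec[OF assms(1)[unfolded rel_acyclic_def], of z]]) (use assms(2,3) in blast)

text \<open>
  Cut \<open>w\<close> off outside the cliques of the piece. The coboundary \<open>z1\<close> of the result is supported
  off these cliques, because \<open>z\<close> is supported off the larger set of cliques of \<open>C\<close>. So \<open>z1\<close> is a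
  relative cocycle of the piece and has a relative primitive \<open>y1\<close>, and \<open>w1 - y1\<close> is a cocycle of
  the full simplex that agrees with \<open>w\<close> on the cliques of the piece.
\<close>

lemma primitive_on_piece:
  fixes z w :: "'v set \<Rightarrow> 'k::field"
  assumes W: "W \<subseteq> V" and W1: "W1 \<subseteq> W"
    and ac: "rel_acyclic TYPE('k) (nonclique d C1) W1 (Suc n)" and n: "n > 0"
    and cl: "\<And>U. U \<subseteq> W1 \<Longrightarrow> is_clique d C1 U \<Longrightarrow> is_clique d C U"
    and z: "\<And>U. z U \<noteq> 0 \<Longrightarrow> \<not> is_clique d C U"
    and w: "\<And>U. U \<subseteq> W \<Longrightarrow> cobd w U = z U" "\<And>U. w U \<noteq> 0 \<Longrightarrow> card U = n"
  obtains g where "\<And>U. g U \<noteq> 0 \<Longrightarrow> U \<subseteq> W1 \<and> Suc (card U) = n"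
    and "\<And>U. U \<subseteq> W1 \<Longrightarrow> is_clique d C1 U \<Longrightarrow> card U = n \<Longrightarrow> cobd g U = w U"
proof -
  have W1V: "W1 \<subseteq> V" using W W1 by blast
  have fin: "finite U" if "U \<subseteq> W1" for U using finite_subset[OF that] finite_subset[OF W1V finV]
      by blast
  define w1 where "w1 U = (if U \<subseteq> W1 \<and> is_clique d C1 U then w U else 0)" for U
  define z1 where "z1 U = (if U \<subseteq> W1 then cobd w1 U else 0)" for U
  have z1: "U \<subseteq> W1 \<and> card U = Suc n \<and> \<not> is_clique d C1 U" if nz: "z1 U \<noteq> 0" for U
  proof -
    have U: "U \<subseteq> W1" and c: "cobd w1 U \<noteq> 0" using nz by (auto simp: z1_def split: if_splits)
    obtain v where v: "v \<in> U" "w1 (U - {v}) \<noteq> 0" using cobd_nonzero[OF c] .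
    then have "w (U - {v}) \<noteq> 0" by (auto simp: w1_def split: if_splits)
    from w(2)[OF this] have "card (U - {v}) = n" .
    then have "card U = Suc n" using card_Suc_Diff1[OF fin[OF U] v(1)] by simp
    moreover have False if cU: "is_clique d C1 U"
    proof -
      have "cobd w1 U = cobd w U"
      proof (rule cobd_cong)
        fix v assume "v \<in> U"
        have "is_clique d C1 (U - {v})" by (rule is_clique_mono[OF cU]) auto
        then show "w1 (U - {v}) = w (U - {v})" using U by (auto simp: w1_def)
      qed
      also have "\<dots> = z U" using w(1) U W1 by blast
      also have "z U = 0" using z cl[OF U cU] by blast
      finally show False using c by simp
    qed
    ultimately show ?thesis using U by blast
  qed
  have dz1: "cobd z1 U = 0" if U: "U \<subseteq> W1" for U
  proof -
    have "cobd z1 U = cobd (cobd w1) U"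
      by (rule cobd_cong) (use U in \<open>auto simp: z1_def\<close>)
    then show ?thesis using cobd_cobd U W1V by (metis order_trans)
  qed
  obtain y1 where y1: "\<And>U. y1 U \<noteq> 0 \<Longrightarrow> U \<subseteq> W1 \<and> Suc (card U) = Suc n \<and> \<not> is_clique d C1 U"
    "\<And>U. U \<subseteq> W1 \<Longrightarrow> cobd y1 U = z1 U"
    using rel_acyclicD[OF ac z1 dz1] by blast
  show thesis
  proof (cases "W1 = {}")
    case True
    show thesis by (rule that[of "\<lambda>_. 0"]) (use True n in auto)
  next
    case False
    obtain g where g: "\<And>U. U \<subseteq> W1 \<Longrightarrow> cobd g U = w1 U - y1 U"
      "\<And>U. g U \<noteq> 0 \<Longrightarrow> U \<subseteq> W1 \<and> Suc (card U) = n"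
    proof (rule cobd_acyclic_on[OF W1V False, where f = "\<lambda>U. w1 U - y1 U" and n = n])
      show "cobd (\<lambda>U. w1 U - y1 U) U = 0" if "U \<subseteq> W1" for U
        using y1(2)[OF that] that by (simp add: cobd_diff z1_def)
      show "card U = n" if "w1 U - y1 U \<noteq> 0" for U
        using that y1(1)[of U] w(2)[of U] by (cases "y1 U = 0") (auto simp: w1_def split: if_splits)
    qed blast
    have "cobd g U = w U" if "U \<subseteq> W1" "is_clique d C1 U" for U
      using g(1)[OF that(1)] y1(1)[of U] that by (auto simp: w1_def)
    then show thesis by (intro that[of g] g(2))
  qed
qed

text \<open>
  Mayer-Vietoris for the cliques with \<open>n \<ge> d\<close> elements. If the submaximal circuits are disjoint,
  the two primitives live on disjoint sets of faces and are put together directly. If the pieces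
  are glued along a clique, the primitives differ by a cocycle on the simplex on \<open>W \<inter> V1 \<inter> V2\<close>,
  which is a coboundary and can be subtracted from one of them. For \<open>d = 1\<close> the clique complex
  is itself a simplex.
\<close>

lemma glue_primitives:
  fixes w g1 g2 :: "'v set \<Rightarrow> 'k::field"
  assumes dec: "decomposition d V C V1 C1 V2 C2" and W: "W \<subseteq> V" and n: "n \<ge> d"
    and w: "\<And>U. U \<subseteq> W \<Longrightarrow> is_clique d C U \<Longrightarrow> cobd w U = 0" "\<And>U. w U \<noteq> 0 \<Longrightarrow> card U = n"
    and g1: "\<And>U. g1 U \<noteq> 0 \<Longrightarrow> U \<subseteq> W \<inter> V1 \<and> Suc (card U) = n"
      "\<And>U. U \<subseteq> W \<inter> V1 \<Longrightarrow> is_clique d C1 U \<Longrightarrow> card U = n \<Longrightarrow> cobd g1 U = w U"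
    and g2: "\<And>U. g2 U \<noteq> 0 \<Longrightarrow> U \<subseteq> W \<inter> V2 \<and> Suc (card U) = n"
      "\<And>U. U \<subseteq> W \<inter> V2 \<Longrightarrow> is_clique d C2 U \<Longrightarrow> card U = n \<Longrightarrow> cobd g2 U = w U"
  obtains g where "\<And>U. U \<subseteq> W \<Longrightarrow> is_clique d C U \<Longrightarrow> card U = n \<Longrightarrow> cobd g U = w U"
proof -
  have pos: "d > 0" by (rule decomposition_pos[OF dec])
  have fin: "finite U" if "U \<subseteq> W" for U using finite_subset[OF that] finite_subset[OF W finV]
      by blast
  from dec show thesis
  proof (cases rule: decomposition_cases)
    case disjoint
    have ncf: "no_common_face d C1 C2" by (rule disjoint_submaximal_no_common_face[OF disjoint pos])
    have sp: "splits d V C V1 C1 V2 C2" by (rule decomposition_splits[OF dec]) (use disjoint in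
        blast)
    define g where "g U = (if \<exists>T\<subseteq>W. U \<subseteq> T \<and> is_clique d C1 T \<and> card T = n then g1 U else g2 U)"
        for U
    show thesis
    proof (rule that[of g])
      fix U assume U: "U \<subseteq> W" "is_clique d C U" "card U = n"
      have "(U \<subseteq> V1 \<and> is_clique d C1 U) \<or> (U \<subseteq> V2 \<and> is_clique d C2 U)"
        using sp U W n unfolding splits_def by (meson order_trans)
      then consider "U \<subseteq> W \<inter> V1" "is_clique d C1 U" | "U \<subseteq> W \<inter> V2" "is_clique d C2 U" using U
          by blast
      then show "cobd g U = w U"
      proof cases
        case 1
        have "g (U - {v}) = g1 (U - {v})" for v
          unfolding g_def using U 1(2) by (intro if_P exI[of _ U]) auto
        then show ?thesis using g1(2)[OF 1 U(3)] cobd_cong[of U g g1] by simp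
      next
        case 2
        have "g (U - {v}) = g2 (U - {v})" if v: "v \<in> U" for v
        proof -
          have "False" if T: "T \<subseteq> W" "U - {v} \<subseteq> T" "is_clique d C1 T" "card T = n" for T
          proof -
            have "Suc (card (U - {v})) < d"
              using ncf T 2(2) U n fin[OF T(1)] fin[OF U(1)] unfolding no_common_face_def
              by (metis Diff_subset)
            then show False using card_Suc_Diff1[OF fin[OF U(1)] v] U(3) n by simp
          qed
          then show ?thesis unfolding g_def by (intro if_not_P) blast
        qed
        then show ?thesis using g2(2)[OF 2 U(3)] cobd_cong[of U g g2] by simp
      qed
    qed
  next
    case clique
    show thesis
    proof (cases "d \<ge> 2")
      case False
      then have d1: "d = 1" using pos by simp
      \<comment> \<open>The cliques in \<open>W\<close> are exactly the subsets of \<open>A\<close>.\<close>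
      define A where "A = {x \<in> W. {x} \<in> C}"
      have cA: "is_clique d C U \<longleftrightarrow> U \<subseteq> A" if "U \<subseteq> W" for U
        using that by (auto simp: is_clique_def d1 A_def card_1_singleton_iff)
      show thesis
      proof (cases "A = {}")
        case True
        show thesis by (rule that[of g1]) (use cA True n d1 in auto)
      next
        case False
        have "A \<subseteq> W" by (auto simp: A_def)
        then have w0: "cobd w U = 0" if "U \<subseteq> A" for U
          using w(1)[of U] cA[of U] that by blast
        obtain g where "\<And>U. U \<subseteq> A \<Longrightarrow> cobd g U = w U"
          using cobd_acyclic_on[OF order_trans[OF \<open>A \<subseteq> W\<close> W] False w0 w(2)] by metis
        then show thesis using that[of g] cA by blast
      qed
    next
      case d2: True
      have sp: "splits d V C V1 C1 V2 C2" by (rule decomposition_splits[OF dec]) (use d2 in blast)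
      define X where "X = W \<inter> V1 \<inter> V2"
      have XW: "X \<subseteq> W" "X \<subseteq> V" using W by (auto simp: X_def)
      define k where "k U = g1 U - g2 U" for U
      have cX: "is_clique d C1 U" "is_clique d C2 U" if "U \<subseteq> X" for U
        using that clique unfolding is_clique_def induced_subclutter_def X_def by blast+
      have "\<exists>h. \<forall>U\<subseteq>X. cobd h U = k U"
      proof (cases "X = {}")
        case True
        \<comment> \<open>The empty set has fewer than \<open>n - 1\<close> elements since \<open>n \<ge> d \<ge> 2\<close>.\<close>
        have "g1 {} = 0" "g2 {} = 0" using g1(1)[of "{}"] g2(1)[of "{}"] d2 n by auto
        then show ?thesis using True by (intro exI[of _ "\<lambda>_. 0"]) (simp add: cobd_def k_def)
      next
        case False
        obtain h where "\<And>U. U \<subseteq> X \<Longrightarrow> cobd h U = k U"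
        proof (rule cobd_acyclic_on[OF XW(2) False, where f = k and n = "n - 1"])
          fix U assume U: "U \<subseteq> X"
          show "cobd k U = 0"
          proof (cases "card U = n")
            case True
            have "cobd k U = cobd g1 U - cobd g2 U" unfolding k_def by (rule cobd_diff)
            also have "cobd g1 U = w U" by (rule g1(2)) (use U cX True in \<open>auto simp: X_def\<close>)
            also have "cobd g2 U = w U" by (rule g2(2)) (use U cX True in \<open>auto simp: X_def\<close>)
            finally show ?thesis by simp
          next
            case False
            show ?thesis
            proof (rule cobd_eq_zero)
              fix v assume v: "v \<in> U"
              have "Suc (card (U - {v})) \<noteq> n"
                using False card_Suc_Diff1[of U v] v fin[of U] U XW(1) by auto
              then have "g1 (U - {v}) = 0" "g2 (U - {v}) = 0"
                using g1(1)[of "U - {v}"] g2(1)[of "U - {v}"] by blast+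
              then show "k (U - {v}) = 0" by (simp add: k_def)
            qed
          qed
          show "card U = n - 1" if "k U \<noteq> 0"
            using that g1(1)[of U] g2(1)[of U]
            by (cases "g1 U = 0"; cases "g2 U = 0") (auto simp: k_def)
        qed blast
        then show ?thesis by blast
      qed
      then obtain h where h: "\<And>U. U \<subseteq> X \<Longrightarrow> cobd h U = k U" by blast
      define g where "g U = (if U \<subseteq> V1 then g1 U - cobd h U else g2 U)" for U
      show thesis
      proof (rule that[of g])
        fix U assume U: "U \<subseteq> W" "is_clique d C U" "card U = n"
        have "(U \<subseteq> V1 \<and> is_clique d C1 U) \<or> (U \<subseteq> V2 \<and> is_clique d C2 U)"
          using sp U W n unfolding splits_def by (meson order_trans)
        then consider "U \<subseteq> V1" "is_clique d C1 U" | "U \<subseteq> V2" "is_clique d C2 U" by blast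
        then show "cobd g U = w U"
        proof cases
          case 1
          have "cobd g U = cobd (\<lambda>U. g1 U - cobd h U) U"
            by (rule cobd_cong) (use 1 in \<open>auto simp: g_def\<close>)
          also have "\<dots> = cobd g1 U - cobd (cobd h) U" by (rule cobd_diff)
          also have "cobd g1 U = w U" by (rule g1(2)) (use U 1 in auto)
          also have "cobd (cobd h) U = 0" by (rule cobd_cobd) (use U W in auto)
          finally show ?thesis by simp
        next
          case 2
          have "cobd g U = cobd g2 U"
          proof (rule cobd_cong)
            fix v assume "v \<in> U"
            show "g (U - {v}) = g2 (U - {v})"
            proof (cases "U - {v} \<subseteq> V1")
              case True
              then have "U - {v} \<subseteq> X" using U 2 by (auto simp: X_def)
              then show ?thesis using h True by (simp add: g_def k_def)
            qed (simp add: g_def)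
          qed
          also have "\<dots> = w U" by (rule g2(2)) (use U 2 in auto)
          finally show ?thesis .
        qed
      qed
    qed
  qed
qed

text \<open>
  The relative primitive of \<open>z\<close> is \<open>w\<close> corrected by the coboundary of the glued primitive.
\<close>

lemma rel_acyclic_glue:
  assumes dec: "decomposition d V C V1 C1 V2 C2" and W: "W \<subseteq> V" and u: "u > d"
    and a1: "rel_acyclic TYPE('k::field) (nonclique d C1) (W \<inter> V1) u"
    and a2: "rel_acyclic TYPE('k) (nonclique d C2) (W \<inter> V2) u"
  shows "rel_acyclic TYPE('k) (nonclique d C) W u"
  unfolding rel_acyclic_def
proof (intro allI impI, elim conjE)
  fix z :: "'v set \<Rightarrow> 'k"
  assume z: "\<forall>U. z U \<noteq> 0 \<longrightarrow> U \<subseteq> W \<and> card U = u \<and> \<not> is_clique d C U" "\<forall>U\<subseteq>W. cobd z U = 0"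
  have pos: "d > 0" by (rule decomposition_pos[OF dec])
  obtain n where n: "u = Suc n" "n \<ge> d" using u by (cases u) auto
  have C: "C1 \<subseteq> C" "C2 \<subseteq> C" using decompositionD(4)[OF dec] by auto
  show "\<exists>y. (\<forall>U. y U \<noteq> 0 \<longrightarrow> U \<subseteq> W \<and> Suc (card U) = u \<and> \<not> is_clique d C U) \<and> (\<forall>U\<subseteq>W. cobd y U = z U)"
  proof (cases "W = {}")
    case True
    have "z U = 0" for U using z(1) True n(1) by fastforce
    then show ?thesis by (intro exI[of _ "\<lambda>_. 0"]) (simp add: cobd_def)
  next
    case False
    obtain w where w: "\<And>U. U \<subseteq> W \<Longrightarrow> cobd w U = z U" "\<And>U. w U \<noteq> 0 \<Longrightarrow> U \<subseteq> W \<and> Suc (card U) = u"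
      using cobd_acyclic_on[OF W False, of z u] z by blast
    have wn: "card U = n" if "w U \<noteq> 0" for U using w(2)[OF that] n(1) by simp
    have zC: "\<not> is_clique d C U" if "z U \<noteq> 0" for U using z(1) that by blast
    have n0: "n > 0" using n pos by simp
    have cl1: "is_clique d C U" if "is_clique d C1 U" for U using that C by (auto simp:
        is_clique_def)
    have cl2: "is_clique d C U" if "is_clique d C2 U" for U using that C by (auto simp:
        is_clique_def)
    obtain g1 where g1: "\<And>U. g1 U \<noteq> 0 \<Longrightarrow> U \<subseteq> W \<inter> V1 \<and> Suc (card U) = n"
      "\<And>U. U \<subseteq> W \<inter> V1 \<Longrightarrow> is_clique d C1 U \<Longrightarrow> card U = n \<Longrightarrow> cobd g1 U = w U"
      using primitive_on_piece[OF W _ a1[unfolded n(1)] n0 cl1 zC w(1) wn] by blast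
    obtain g2 where g2: "\<And>U. g2 U \<noteq> 0 \<Longrightarrow> U \<subseteq> W \<inter> V2 \<and> Suc (card U) = n"
      "\<And>U. U \<subseteq> W \<inter> V2 \<Longrightarrow> is_clique d C2 U \<Longrightarrow> card U = n \<Longrightarrow> cobd g2 U = w U"
      using primitive_on_piece[OF W _ a2[unfolded n(1)] n0 cl2 zC w(1) wn] by blast
    have w0: "cobd w U = 0" if "U \<subseteq> W" "is_clique d C U" for U using w(1) zC that by metis
    obtain g where g: "\<And>U. U \<subseteq> W \<Longrightarrow> is_clique d C U \<Longrightarrow> card U = n \<Longrightarrow> cobd g U = w U"
      using glue_primitives[OF dec W n(2) w0 wn g1 g2] by blast
    define y where "y U = (if U \<subseteq> W \<and> card U = n then w U - cobd g U else 0)" for U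
    have "U \<subseteq> W \<and> Suc (card U) = u \<and> \<not> is_clique d C U" if "y U \<noteq> 0" for U
      using that g n(1) by (auto simp: y_def split: if_splits)
    moreover have "cobd y U = z U" if U: "U \<subseteq> W" for U
    proof (cases "card U = u")
      case True
      have "cobd y U = cobd (\<lambda>U. w U - cobd g U) U"
      proof (rule cobd_cong)
        fix v assume "v \<in> U"
        then have "card (U - {v}) = n" using True n(1) by simp
        then show "y (U - {v}) = w (U - {v}) - cobd g (U - {v})" using U by (auto simp: y_def)
      qed
      also have "\<dots> = cobd w U - cobd (cobd g) U" by (rule cobd_diff)
      also have "cobd (cobd g) U = 0" by (rule cobd_cobd) (use U W in auto)
      finally show ?thesis using w(1)[OF U] by simp
    next
      case False
      have "cobd y U = 0"
      proof (rule cobd_eq_zero)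
        fix v assume v: "v \<in> U"
        have "finite U" using U W finV finite_subset by metis
        then have "card (U - {v}) \<noteq> n" using False n(1) card_Suc_Diff1[of U v] v by auto
        then show "y (U - {v}) = 0" by (simp add: y_def)
      qed
      moreover have "z U = 0" using z(1) False by blast
      ultimately show ?thesis by simp
    qed
    ultimately show ?thesis by blast
  qed
qed

section \<open>Superadditivity of the Betti numbers\<close>

lemma delta_delta:
  assumes f: "f \<in> cochains V N i j"
  shows "delta (delta f) = (0 :: 'v set \<Rightarrow> 'v set \<Rightarrow> 'k::field)"
proof (intro ext)
  fix W U
  show "delta (delta f) W U = 0 W U"
  proof (cases "U \<subseteq> W \<and> W \<subseteq> V")
    case True
    then have "delta (delta f) W U = cobd (cobd (f W)) U"
      unfolding delta_def[of "delta f"] by (auto simp: delta_def intro!: cobd_cong)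
    then show ?thesis using cobd_cobd[of U "f W"] True by auto
  next
    case False
    have "f W U' = 0" if "\<not> W \<subseteq> V" for U' using cochainsD[OF f, of W U'] that by blast
    then have "delta f W U' = 0" if "\<not> W \<subseteq> V" for U' using that by (simp add: delta_def cobd_def)
    then show ?thesis using False by (cases "U \<subseteq> W") (simp_all add: delta_def[of "delta f"]
        cobd_def)
  qed
qed

text \<open>
  In the case of a clique, \<open>z\<close> itself is a cocycle of \<open>C\<close>, and its restriction to \<open>V2\<close> vanishes
  as all subsets of \<open>V1 \<inter> V2\<close> are cliques. In the disjoint case \<open>z\<close> may be nonzero on cliques of
  \<open>C2\<close>. Then \<open>z\<close> is written as the coboundary of \<open>a + b\<close> with \<open>a\<close> supported on cliques of \<open>C1\<close>
  and \<open>b\<close> off them, and the coboundary of \<open>a\<close> is the lift: it is cohomologous to \<open>z\<close>, it agrees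
  with \<open>z\<close> on the cliques of \<open>C1\<close> and so vanishes there, it vanishes on the cliques of \<open>C2\<close>
  because these have no faces with at least \<open>d\<close> vertices in common with those of \<open>C1\<close>, and it is
  trivial relative to \<open>C2\<close> because \<open>a\<close> is supported off the cliques of \<open>C2\<close>.
\<close>

lemma lift_cocycle:
  fixes z :: "'v set \<Rightarrow> 'v set \<Rightarrow> 'k::field"
  assumes dec: "decomposition d V C V1 C1 V2 C2" and j: "j > i + d"
    and z: "z \<in> cocycles V1 (nonclique d C1) i j"
  shows "\<exists>z'\<in>cocycles V (nonclique d C) i j.
    restrict_to V1 z' - z \<in> delta ` cochains V1 (nonclique d C1) (Suc i) j \<and>
    restrict_to V2 z' \<in> delta ` cochains V2 (nonclique d C2) (Suc i) j"
proof -
  have zc: "z \<in> cochains V1 (nonclique d C1) i j" and dz: "delta z = 0"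
    using z by (auto simp: cocycles_def)
  have V1: "V1 \<subseteq> V" using decompositionD(3)[OF dec] by blast
  have pos: "d > 0" by (rule decomposition_pos[OF dec])
  have zero: "(0 :: 'v set \<Rightarrow> 'v set \<Rightarrow> 'k) \<in> delta ` cochains X N (Suc i) j" for X N
    by (rule image_eqI[of _ _ 0]) (rule delta_zero[symmetric], rule cochains_zero)
  from dec show ?thesis
  proof (cases rule: decomposition_cases)
    case clique
    have cl: "is_clique d C1 U" if "is_clique d C U" "U \<subseteq> V1" for U
      using that clique(2) by (auto simp: is_clique_def induced_subclutter_def)
    have "z \<in> cochains V (nonclique d C) i j"
    proof (rule cochainsI)
      fix W U assume "z W U \<noteq> 0"
      from cochainsD[OF zc this] cl[of U] V1
      show "U \<subseteq> W \<and> W \<subseteq> V \<and> card W = j \<and> card (W - U) = i \<and> \<not> is_clique d C U" by blast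
    qed
    then have "z \<in> cocycles V (nonclique d C) i j" using dz by (simp only: cocycles_def
        mem_Collect_eq)
    moreover have "restrict_to V1 z - z = 0"
    proof (intro ext)
      fix W U show "(restrict_to V1 z - z) W U = 0 W U"
        using cochainsD[OF zc, of W U] by (cases "z W U = 0") (simp_all add: restrict_to_def)
    qed
    moreover have "restrict_to V2 z = 0"
    proof (intro ext)
      fix W U
      show "restrict_to V2 z W U = 0 W U"
      proof (rule ccontr)
        assume "restrict_to V2 z W U \<noteq> 0 W U"
        then have "W \<subseteq> V2" "z W U \<noteq> 0" by (auto simp: restrict_to_def split: if_splits)
        with cochainsD[OF zc this(2)] have U: "U \<subseteq> V1 \<inter> V2" "\<not> is_clique d C1 U" by blast+
        then show False using cl is_clique_mono[OF clique(1) U(1)] by blast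
      qed
    qed
    ultimately show ?thesis using zero by (intro bexI[of _ z]) simp_all
  next
    case disjoint
    have ncf: "no_common_face d C1 C2" by (rule disjoint_submaximal_no_common_face[OF disjoint pos])
    have sp: "splits d V C V1 C1 V2 C2" by (rule decomposition_splits[OF dec]) (use disjoint in
        blast)
    define u where "u = j - i"
    have u: "u > d" "j = i + u" using j by (simp_all add: u_def)
    have size: "card (W - U) = l \<longleftrightarrow> l + card U = card W" if "U \<subseteq> W" "W \<subseteq> V1" for W U l
    proof -
      have "finite W" using finite_subset[OF that(2)] finite_subset[OF V1 finV] by blast
      then show ?thesis using that card_Diff_subset[of U W] card_mono[of W U] finite_subset[of U W]
          by auto
    qed
    have "\<exists>g. (\<forall>U\<subseteq>W. cobd g U = z W U) \<and> (\<forall>U. g U \<noteq> 0 \<longrightarrow> U \<subseteq> W \<and> Suc (card U) = u)"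
      if W: "W \<subseteq> V1" "card W = j" for W
    proof -
      have WV: "W \<subseteq> V" "W \<noteq> {}" using W V1 j by auto
      have "cobd (z W) U = 0" if "U \<subseteq> W" for U
      proof -
        have "cobd (z W) U = delta z W U" using that by (simp add: delta_def)
        then show ?thesis unfolding dz by simp
      qed
      moreover have "card U = u" if "z W U \<noteq> 0" for U
        using cochainsD[OF zc that] size[of U W i] u(2) by auto
      ultimately show ?thesis using cobd_acyclic_on[OF WV, of "z W" u] by metis
    qed
    then obtain g where g: "\<And>W U. W \<subseteq> V1 \<Longrightarrow> card W = j \<Longrightarrow> U \<subseteq> W \<Longrightarrow> cobd (g W) U = z W U"
      "\<And>W U. W \<subseteq> V1 \<Longrightarrow> card W = j \<Longrightarrow> g W U \<noteq> 0 \<Longrightarrow> U \<subseteq> W \<and> Suc (card U) = u"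
      by metis
    \<comment> \<open>A primitive of \<open>z\<close> on the full simplices, cut into its parts on and off the cliques of \<open>C1\<close>.\<close>
    define a where "a W U = (if W \<subseteq> V1 \<and> card W = j \<and> is_clique d C1 U then g W U else 0)" for W U
    define b where "b W U = (if W \<subseteq> V1 \<and> card W = j \<and> \<not> is_clique d C1 U then g W U else 0)" for W U
    have gD: "U \<subseteq> W \<and> card (W - U) = Suc i \<and> Suc (card U) = u"
      if "W \<subseteq> V1" "card W = j" "g W U \<noteq> 0" for W U
      using g(2)[OF that] size[of U W "Suc i"] that u(2) by auto
    have ac: "a \<in> cochains V1 (is_clique d C1) (Suc i) j"
      by (rule cochainsI) (use gD in \<open>auto simp: a_def split: if_splits\<close>)
    have bc: "b \<in> cochains V1 (nonclique d C1) (Suc i) j"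
      by (rule cochainsI) (use gD in \<open>auto simp: b_def split: if_splits\<close>)
    have "z = delta (a + b)"
    proof (intro ext)
      fix W U
      show "z W U = delta (a + b) W U"
      proof (cases "U \<subseteq> W \<and> W \<subseteq> V1 \<and> card W = j")
        case True
        then have "delta (a + b) W U = cobd (g W) U"
          by (auto simp: delta_def a_def b_def intro!: cobd_cong)
        then show ?thesis using g(1) True by simp
      next
        case False
        then have "z W U = 0" using cochainsD[OF zc, of W U] by blast
        moreover have "U \<subseteq> W \<Longrightarrow> (a + b) W U' = 0" for U'
          using False by (cases "W \<subseteq> V1 \<and> card W = j") (auto simp: a_def b_def)
        then have "delta (a + b) W U = 0" by (auto simp: delta_def intro!: cobd_eq_zero)
        ultimately show ?thesis by simp
      qed
    qed
    then have zab: "z = delta a + delta b" by (simp only: delta_add)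
    have aV: "a \<in> cochains V (is_clique d C1) (Suc i) j"
    proof (rule cochainsI)
      fix W U assume "a W U \<noteq> 0"
      from cochainsD[OF ac this] V1
      show "U \<subseteq> W \<and> W \<subseteq> V \<and> card W = j \<and> card (W - U) = Suc i \<and> is_clique d C1 U" by blast
    qed
    have big: "finite U \<and> d \<le> card U" if "a W U \<noteq> 0" for W U
    proof -
      from cochainsD[OF aV that] have U: "U \<subseteq> V" by blast
      have "W \<subseteq> V1" "card W = j" "g W U \<noteq> 0" using that by (auto simp: a_def split: if_splits)
      from gD[OF this] u(1) have "d \<le> card U" by simp
      then show ?thesis using finite_subset[OF U finV] by blast
    qed
    have "delta a \<in> cochains V (nonclique d C) i j"
    proof (rule cochainsI)
      fix W U assume nz: "delta a W U \<noteq> 0"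
      then have UW: "U \<subseteq> W" and cz: "cobd (a W) U \<noteq> 0" by (auto simp: delta_def split: if_splits)
      obtain v where v: "v \<in> U" "a W (U - {v}) \<noteq> 0" using cobd_nonzero[OF cz] .
      from cochainsD[OF ac v(2)] have W: "W \<subseteq> V1" "card W = j" "card (W - (U - {v})) = Suc i"
          by blast+
      have fU: "finite U" using big[OF v(2)] by simp
      have cU: "Suc (card (U - {v})) = card U" by (rule card_Suc_Diff1[OF fU v(1)])
      have "U - {v} \<subseteq> W" using UW by blast
      then have "card (W - U) = i"
        using W(3) size[OF _ W(1), of "U - {v}" "Suc i"] size[OF UW W(1), of i] cU by simp
      moreover have "\<not> is_clique d C U"
      proof
        assume "is_clique d C U"
        moreover have "d \<le> card U" using big[OF v(2)] cU by simp
        moreover have "U \<subseteq> V" using UW W(1) V1 by blast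
        ultimately consider "is_clique d C1 U" | "is_clique d C2 U" using sp unfolding splits_def
            by blast
        then show False
        proof cases
          case 1
          have "cobd (b W) U = 0"
            by (rule cobd_eq_zero) (use is_clique_mono[OF 1] in \<open>auto simp: b_def\<close>)
          then have "z W U = cobd (a W) U" using zab UW by (simp add: delta_def)
          then show False using cz cochainsD[OF zc, of W U] 1 by simp
        next
          case 2
          have "is_clique d C2 (U - {v})" by (rule is_clique_mono[OF 2]) auto
          moreover have "is_clique d C1 (U - {v})" using cochainsD[OF ac v(2)] by blast
          ultimately have "Suc (card (U - {v})) < d"
            using ncf big[OF v(2)] unfolding no_common_face_def by blast
          then show False using big[OF v(2)] by simp
        qed
      qed
      ultimately show "U \<subseteq> W \<and> W \<subseteq> V \<and> card W = j \<and> card (W - U) = i \<and> \<not> is_clique d C U"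
        using UW W V1 by blast
    qed
    then have "delta a \<in> cocycles V (nonclique d C) i j"
      using delta_delta[OF aV] by (simp only: cocycles_def mem_Collect_eq simp_thms)
    moreover have "restrict_to V1 (delta a) - z = delta (scale_fun (-1) b)"
    proof -
      have "restrict_to V1 a = a"
      proof (intro ext)
        fix W U show "restrict_to V1 a W U = a W U"
          using cochainsD[OF ac, of W U] by (cases "a W U = 0") (simp_all add: restrict_to_def)
      qed
      then have "restrict_to V1 (delta a) = delta a" by (simp only: restrict_to_delta)
      moreover have "delta (scale_fun (-1) b) = - delta b"
        unfolding delta_scale by (simp add: scale_fun_def fun_eq_iff)
      ultimately show ?thesis using zab by simp
    qed
    then have "restrict_to V1 (delta a) - z \<in> delta ` cochains V1 (nonclique d C1) (Suc i) j"
      using cochains_scale[OF bc] by (simp only: imageI)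
    moreover have "restrict_to V2 (delta a) \<in> delta ` cochains V2 (nonclique d C2) (Suc i) j"
      unfolding restrict_to_delta
    proof (intro imageI cochainsI)
      fix W U assume "restrict_to V2 a W U \<noteq> 0"
      then have W: "W \<subseteq> V2" and nz: "a W U \<noteq> 0" by (auto simp: restrict_to_def split: if_splits)
      have "\<not> is_clique d C2 U"
      proof
        assume "is_clique d C2 U"
        then have "Suc (card U) < d"
          using ncf big[OF nz] cochainsD[OF ac nz] unfolding no_common_face_def by blast
        then show False using big[OF nz] by simp
      qed
      then show "U \<subseteq> W \<and> W \<subseteq> V2 \<and> card W = j \<and> card (W - U) = Suc i \<and> \<not> is_clique d C2 U"
        using cochainsD[OF ac nz] W by blast
    qed
    ultimately show ?thesis by blast
  qed
qed

lemma betti_superadditive: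
  assumes dec: "decomposition d V C V1 C1 V2 C2" and j: "j > i + d"
  shows "betti V1 (circuit_ideal d V1 C1 :: ('v, 'k::field) mpoly set) i j +
    betti V2 (circuit_ideal d V2 C2 :: ('v, 'k) mpoly set) i j
    \<le> betti V (circuit_ideal d V C :: ('v, 'k) mpoly set) i j"
proof -
  interpret vs: vector_space "scale_fun :: 'k \<Rightarrow> ('v set \<Rightarrow> 'v set \<Rightarrow> 'k) \<Rightarrow> _" by (rule
      vector_space_scale_fun)
  let ?N = "\<lambda>C. nonclique d C"
  have V: "V1 \<subseteq> V" "V2 \<subseteq> V" using decompositionD(3)[OF dec] by blast+
  have C: "?N C U \<Longrightarrow> ?N C1 U" "?N C U \<Longrightarrow> ?N C2 U" for U
    using decompositionD(4)[OF dec] by (auto simp: is_clique_def)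
  have "indep_mod (scale_fun :: 'k \<Rightarrow> _)
     (betti V1 (circuit_ideal d V1 C1 :: ('v, 'k) mpoly set) i j +
      betti V2 (circuit_ideal d V2 C2 :: ('v, 'k) mpoly set) i j)
     (cocycles V (?N C) i j) (delta ` cochains V (?N C) (Suc i) j)"
  proof (rule vs.indep_mod_direct_sum[where pA = "restrict_to V1" and pB = "restrict_to V2"])
    show "indep_mod (scale_fun :: 'k \<Rightarrow> _) (betti V1 (circuit_ideal d V1 C1 :: ('v, 'k) mpoly set) i
        j)
      (cocycles V1 (?N C1) i j) (delta ` cochains V1 (?N C1) (Suc i) j)"
      by (rule iffD1[OF betti_circuit_ideal[OF V(1)] order_refl])
    show "indep_mod (scale_fun :: 'k \<Rightarrow> _) (betti V2 (circuit_ideal d V2 C2 :: ('v, 'k) mpoly set) i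
        j)
      (cocycles V2 (?N C2) i j) (delta ` cochains V2 (?N C2) (Suc i) j)"
      by (rule iffD1[OF betti_circuit_ideal[OF V(2)] order_refl])
    fix y :: "'v set \<Rightarrow> 'v set \<Rightarrow> 'k" assume "y \<in> delta ` cochains V (?N C) (Suc i) j"
    then obtain x where x: "x \<in> cochains V (?N C) (Suc i) j" "y = delta x" by blast
    show "restrict_to V1 y \<in> delta ` cochains V1 (?N C1) (Suc i) j \<and>
        restrict_to V2 y \<in> delta ` cochains V2 (?N C2) (Suc i) j"
      unfolding x(2) restrict_to_delta
      by (intro conjI imageI restrict_to_cochains[OF x(1) V(1)] restrict_to_cochains[OF x(1) V(2)]
          C)
  next
    fix z :: "'v set \<Rightarrow> 'v set \<Rightarrow> 'k" assume "z \<in> cocycles V1 (?N C1) i j"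
    then show "\<exists>z'\<in>cocycles V (?N C) i j. restrict_to V1 z' - z \<in> delta ` cochains V1 (?N C1) (Suc
        i) j \<and>
        restrict_to V2 z' \<in> delta ` cochains V2 (?N C2) (Suc i) j"
      by (rule lift_cocycle[OF dec j])
  next
    fix z :: "'v set \<Rightarrow> 'v set \<Rightarrow> 'k" assume "z \<in> cocycles V2 (?N C2) i j"
    from lift_cocycle[OF decomposition_sym[OF dec] j this]
    show "\<exists>z'\<in>cocycles V (?N C) i j. restrict_to V1 z' \<in> delta ` cochains V1 (?N C1) (Suc i) j \<and>
        restrict_to V2 z' - z \<in> delta ` cochains V2 (?N C2) (Suc i) j" by blast
  qed (rule subspace_coboundaries restrict_to_module_hom)+
  then show ?thesis using betti_circuit_ideal[OF order_refl] by blast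
qed

section \<open>Regularity\<close>

text \<open>
  The size \<open>u\<close> of the sets \<open>U\<close> is kept when \<open>W\<close> is replaced by its intersection with the vertex
  set of a piece; only the homological degree drops.
\<close>

lemma betti_nonzero_descends:
  assumes dec: "decomposition d V C V1 C1 V2 C2" and u: "u > d"
    and nz: "betti V (circuit_ideal d V C :: ('v, 'k::field) mpoly set) i (i + u) \<noteq> 0"
  shows "\<exists>l. betti V1 (circuit_ideal d V1 C1 :: ('v, 'k) mpoly set) l (l + u) \<noteq> 0 \<or>
    betti V2 (circuit_ideal d V2 C2 :: ('v, 'k) mpoly set) l (l + u) \<noteq> 0"
proof -
  have V: "V1 \<subseteq> V" "V2 \<subseteq> V" using decompositionD(3)[OF dec] by blast+
  obtain W where W: "W \<subseteq> V" and na: "\<not> rel_acyclic TYPE('k) (nonclique d C) W u"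
    using nz unfolding betti_zero_rel_acyclic[OF order_refl] by blast
  have step: "betti X (circuit_ideal d X D :: ('v, 'k) mpoly set) (card (W \<inter> X) - u) (card (W \<inter> X) -
      u + u) \<noteq> 0"
    if X: "X \<subseteq> V" and na: "\<not> rel_acyclic TYPE('k) (nonclique d D) (W \<inter> X) u" for X D
  proof -
    have "u \<le> card (W \<inter> X)"
    proof (rule ccontr)
      assume "\<not> u \<le> card (W \<inter> X)"
      moreover have "finite (W \<inter> X)" using finite_subset[OF W finV] by blast
      ultimately have "card U \<noteq> u" if "U \<subseteq> W \<inter> X" for U
        using card_mono[OF _ that] by auto
      then have "rel_acyclic TYPE('k) (nonclique d D) (W \<inter> X) u"
        unfolding rel_acyclic_def
        by (intro allI impI exI[of _ "\<lambda>_. 0"]) (auto simp: cobd_def)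
      then show False using na by blast
    qed
    then show ?thesis
      using betti_zero_rel_acyclic[OF X, of d D "card (W \<inter> X) - u" u, where ?'k = 'k] na by auto
  qed
  show ?thesis using rel_acyclic_glue[OF dec W u] na step[OF V(1)] step[OF V(2)] by blast
qed

text \<open>
  Every monomial of the ideal has at least \<open>d\<close> variables.
\<close>

lemma betti_zero_below:
  assumes X: "X \<subseteq> V" and j: "j < i + d"
  shows "betti X (circuit_ideal d X C :: ('v, 'k::field) mpoly set) i j = 0"
  unfolding betti_zero_iff[OF X]
proof
  fix z :: "'v set \<Rightarrow> 'v set \<Rightarrow> 'k" assume "z \<in> cocycles X (nonclique d C) i j"
  then have zc: "z \<in> cochains X (nonclique d C) i j" by (simp add: cocycles_def)
  have "z W U = 0" for W U
  proof (rule ccontr)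
    assume "z W U \<noteq> 0"
    from cochainsD[OF zc this] have *: "U \<subseteq> W" "W \<subseteq> X" "card W = j" "card (W - U) = i" "\<not> is_clique
        d C U"
      by blast+
    have fU: "finite W" using finite_subset[OF _ finV, of W] * X by blast
    then have "card U + i = j" using * card_Diff_subset[of U W] card_mono[of W U] finite_subset[of U
        W] by auto
    obtain T where "T \<subseteq> U" "card T = d" using *(5) by (auto simp: is_clique_def)
    then have "d \<le> card U" using card_mono[of U T] fU * finite_subset by metis
    then show False using \<open>card U + i = j\<close> j by simp
  qed
  then have "z = delta 0" unfolding delta_zero by (simp add: fun_eq_iff)
  then show "z \<in> delta ` cochains X (nonclique d C) (Suc i) j"
    by (rule image_eqI[of _ delta 0]) (rule cochains_zero)
qed

text \<open>
  A missing \<open>d\<close>-set is itself a cocycle, and no nonclique has fewer than \<open>d\<close> elements.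
\<close>

lemma betti_generators:
  assumes X: "X \<subseteq> V" and T: "T \<in> clutter_complement d X C"
  shows "betti X (circuit_ideal d X C :: ('v, 'k::field) mpoly set) 0 d \<noteq> 0"
proof
  assume "betti X (circuit_ideal d X C :: ('v, 'k) mpoly set) 0 d = 0"
  then have ac: "rel_acyclic TYPE('k) (nonclique d C) T d"
    using betti_zero_rel_acyclic[OF X, of d C 0 d, where ?'k = 'k] T by (auto simp:
        clutter_complement_def)
  define z :: "'v set \<Rightarrow> 'k" where "z U = (if U = T then 1 else 0)" for U
  have TX: "T \<subseteq> X" "card T = d" "T \<notin> C" using T by (auto simp: clutter_complement_def)
  have "finite T" using finite_subset[OF TX(1)] finite_subset[OF X finV] by blast
  have zN: "U \<subseteq> T \<and> card U = d \<and> \<not> is_clique d C U" if "z U \<noteq> 0" for U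
    using TX that by (auto simp: z_def is_clique_def split: if_splits)
  have dz: "cobd z U = 0" if "U \<subseteq> T" for U
    by (intro cobd_eq_zero) (use that in \<open>auto simp: z_def\<close>)
  obtain y where y: "\<And>U. y U \<noteq> 0 \<Longrightarrow> U \<subseteq> T \<and> Suc (card U) = d \<and> \<not> is_clique d C U"
    "\<And>U. U \<subseteq> T \<Longrightarrow> cobd y U = z U"
    using rel_acyclicD[OF ac zN dz] by blast
  have "y U = 0" for U
  proof (rule ccontr)
    assume "y U \<noteq> 0"
    from y(1)[OF this] obtain S where "S \<subseteq> U" "card S = d" "finite U" "Suc (card U) = d"
      using \<open>finite T\<close> finite_subset by (auto simp: is_clique_def)
    then show False using card_mono[of U S] by simp
  qed
  then have "z T = 0" using y(2)[of T] by (simp add: cobd_def)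
  then show False by (simp add: z_def)
qed

end

text \<open>
  In the disjoint case a complete \<open>C\<close> would, like every clique with at least \<open>d\<close> vertices, be
  contained in one piece, but the pieces are proper.
\<close>

lemma complement_nonempty_of_piece:
  assumes dec: "decomposition d V C V1 C1 V2 C2" and T: "clutter_complement d V1 C1 \<noteq> {}"
  shows "clutter_complement d V C \<noteq> {}"
proof
  assume e: "clutter_complement d V C = {}"
  obtain T where T: "T \<subseteq> V1" "card T = d" "T \<notin> C1" using T by (auto simp: clutter_complement_def)
  have pos: "d > 0" by (rule decomposition_pos[OF dec])
  have V: "is_clique d C V" using e by (auto simp: clutter_complement_def is_clique_def)
  have TC: "T \<in> C" using V T decompositionD(3)[OF dec] by (auto simp: is_clique_def)
  from dec show False
  proof (cases rule: decomposition_cases)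
    case clique
    then show False using T TC by (auto simp: induced_subclutter_def)
  next
    case disjoint
    have "T \<subseteq> V" using T(1) decompositionD(3)[OF dec] by blast
    then have "d \<le> card V" using T(2) card_mono[OF decompositionD(1)[OF dec]] by blast
    then have "is_clique d C1 V \<or> is_clique d C2 V"
      using decomposition_splits[OF dec] disjoint V unfolding splits_def by blast
    then have "C \<subseteq> C1 \<or> C \<subseteq> C2" using decompositionD(2)[OF dec] by (auto simp: is_clique_def)
    then show False using decompositionD(4-6)[OF dec] by blast
  qed
qed

theorem theorem4p10:
  fixes d :: nat and V V1 V2 :: "'v set" and C C1 C2 :: "'v set set"
    and I I1 I2 :: "('v, 'k::field) mpoly set"
  assumes "decomposition d V C V1 C1 V2 C2"
    and "I = circuit_ideal d V C"
    and "I1 = circuit_ideal d V1 C1"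
    and "I2 = circuit_ideal d V2 C2"
  shows "(\<forall>i j. int j - int i > int d \<longrightarrow>
            betti V I i j \<ge> betti V1 I1 i j + betti V2 I2 i j) \<and>
         (I1 \<noteq> {0} \<and> I2 \<noteq> {0} \<longrightarrow> reg V I = max (reg V1 I1) (reg V2 I2))"
proof -
  note dec = assms(1)
  have finV: "finite V" by (rule decompositionD(1)[OF dec])
  obtain pos :: "'v \<Rightarrow> nat" where "inj_on pos V"
    using finite_imp_inj_to_nat_seg[OF finV] by blast
  then interpret vertex_order V pos using finV by unfold_locales
  have V: "V1 \<subseteq> V" "V2 \<subseteq> V" using decompositionD(3)[OF dec] by blast+
  have finV1: "finite V1" by (rule finite_subset[OF V(1) finV])
  have i: "betti V I i j \<ge> betti V1 I1 i j + betti V2 I2 i j" if "j > i + d" for i j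
    unfolding assms(2-4) by (rule betti_superadditive[OF dec that])
  have ii: "reg V I = max (reg V1 I1) (reg V2 I2)" if nz: "I1 \<noteq> {0}"
  proof -
    have regI: "ereal (real j - real i) \<le> reg X J" if "betti X J i j \<noteq> 0" for X i j and J ::
        "('v, 'k) mpoly set"
      unfolding reg_def using that by (intro Sup_upper) blast
    have c1: "clutter_complement d V1 C1 \<noteq> {}"
      using nz circuit_ideal_nonzero[OF finV1] assms(3) by blast
    have c: "clutter_complement d V C \<noteq> {}" by (rule complement_nonempty_of_piece[OF dec c1])
    have g: "betti V I 0 d \<noteq> 0" "betti V1 I1 0 d \<noteq> 0"
      unfolding assms(2,3) using c c1 betti_generators[OF order_refl] betti_generators[OF V(1)]
          by blast+
    have low: "j \<ge> i + d" if "betti X (circuit_ideal d X D :: ('v, 'k) mpoly set) i j \<noteq> 0" "X \<subseteq> V"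
        for X D i j
      using betti_zero_below[OF that(2), of j i d D, where ?'k = 'k] that(1) by (meson not_le)
    have piece: "reg X J \<le> reg V I"
      if "J = circuit_ideal d X D" "X \<subseteq> V" "\<And>i j. j > i + d \<Longrightarrow> betti X J i j \<le> betti V I i j"
      for X D and J :: "('v, 'k) mpoly set"
      unfolding reg_def[of X]
    proof (rule Sup_least)
      fix x assume "x \<in> {ereal (real j - real i) | i j. betti X J i j \<noteq> 0}"
      then obtain i j where x: "x = ereal (real j - real i)" and b: "betti X J i j \<noteq> 0" by blast
      have "ereal (real j - real i) \<le> reg V I"
      proof (cases "j > i + d")
        case True
        then show ?thesis using that(3)[OF True] b regI by (metis le_zero_eq)
      next
        case False
        then have "j = i + d" using low[OF b[unfolded that(1)] that(2)] by simp
        then show ?thesis using regI[OF g(1)] by simp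
      qed
      then show "x \<le> reg V I" by (simp only: x)
    qed
    have "reg V I \<le> max (reg V1 I1) (reg V2 I2)"
      unfolding reg_def[of V]
    proof (rule Sup_least)
      fix x assume "x \<in> {ereal (real j - real i) | i j. betti V I i j \<noteq> 0}"
      then obtain i j where x: "x = ereal (real j - real i)" and b: "betti V I i j \<noteq> 0" by blast
      have "j \<ge> i + d" using low[OF b[unfolded assms(2)]] by simp
      then obtain u where u: "j = i + u" "u \<ge> d" by (metis le_Suc_ex le_add1 add.assoc)
      have "ereal (real j - real i) \<le> max (reg V1 I1) (reg V2 I2)"
      proof (cases "u = d")
        case True
        then show ?thesis using regI[OF g(2)] u by (simp add: le_max_iff_disj)
      next
        case False
        then obtain l where "betti V1 I1 l (l + u) \<noteq> 0 \<or> betti V2 I2 l (l + u) \<noteq> 0"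
          using betti_nonzero_descends[OF dec, of u i, where ?'k = 'k] u b unfolding assms(2-4)
              by auto
        then show ?thesis
          using regI[of V1 I1 l "l + u"] regI[of V2 I2 l "l + u"] u by (auto simp: le_max_iff_disj)
      qed
      then show "x \<le> max (reg V1 I1) (reg V2 I2)" by (simp only: x)
    qed
    moreover have "reg V1 I1 \<le> reg V I" by (rule piece[OF assms(3) V(1)]) (use i in \<open>fastforce\<close>)
    moreover have "reg V2 I2 \<le> reg V I" by (rule piece[OF assms(4) V(2)]) (use i in \<open>fastforce\<close>)
    ultimately show ?thesis by (intro antisym) simp_all
  qed
  show ?thesis using i ii by auto
qed

end
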